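(* Let $p(x,y)$ be a $d\times d$ matrix-valued hermitian free polynomial in the freely noncommuting hermitian variables $x=(x_1,\dots,x_\mu)$, $y=(y_1,\dots,y_\mu)$. The following statements are equivalent. (i) $p$ is $xy$-convex. (ii) $p$ is convex in $x$ and $y$ separately. (iii) There exist a hermitian $d\times d$ matrix-valued $xy$-pencil $\lambda$, a positive integer $N$ and an $N\times d$ matrix-valued $xy$-pencil $\Lambda$ such that $p(x,y)=\lambda(x,y)+\Lambda(x,y)^*\Lambda(x,y)$. In particular, $p$ is $xy$-convex if and only if $p$ is convex in $x$ and $y$ separately.
   Context: $\mathbb S_n(\mathbb C^\mu)$ denotes the set of $\mu$-tuples of $n\times n$ complex hermitian matrices. For hermitian matrices, $S\preceq T$ means $T-S$ is positive semidefinite. An isometry $V:\mathbb C^m\to\mathbb C^n$ satisfies $V^*V=I_m$. Free polynomials: an $N\times d$ matrix-valued free polynomial is a finite sum $p=\sum_w p_w w$ over words $w$ (including the empty word) in the freely noncommuting variables $x_1,\dots,x_\mu,y_1,\dots,y_\mu$, with $p_w\in M_{N,d}(\mathbb C)$. It is evaluated at $(X,Y)\in\mathbb S_n(\mathbb C^\mu)\times\mathbb S_n(\mathbb C^\mu)$ by $p(X,Y)=\sum_w p_w\otimes w(X,Y)$, where $w(X,Y)$ is the product obtained by substituting $X_j$ for $x_j$ and $Y_k$ for $y_k$ (the empty word gives $I_n$). The involution is $p^*=\sum_w p_w^* w^*$, where $w^*$ is $w$ with the order of its letters reversed (the variables are fixed by the involution). A $d\times d$ matrix-valued $p$ is hermitian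 if $p^*=p$. An $xy$-pencil is a free polynomial of the form $$L(x,y)=A_0-\sum_{j=1}^\mu A_jx_j-\sum_{k=1}^\mu B_ky_k-\sum_{p,q=1}^\mu C_{pq}x_py_q-\sum_{p,q=1}^\mu D_{qp}y_qx_p,$$ with coefficient matrices all of the same (possibly rectangular) size. It is hermitian if it is hermitian as a polynomial, i.e. the coefficients are square, $A_0,A_j,B_k$ are hermitian and $D_{qp}=C_{pq}^*$. An $xy$-pair is a tuple $((X,Y),V)$ where, for some positive integers $m,n$, $(X,Y)\in\mathbb S_n(\mathbb C^\mu)\times\mathbb S_n(\mathbb C^\mu)$ and $V:\mathbb C^m\to\mathbb C^n$ is an isometry such that $V^*(X_iY_j)V=(V^*X_iV)(V^*Y_jV)$ for all $1\le i,j\le\mu$. Write $V^*(X,Y)V$ for the tuple $(V^*X_1V,\dots,V^*X_\mu V,V^*Y_1V,\dots,V^*Y_\mu V)$. A hermitian $d\times d$ matrix-valued free polynomial $p(x,y)$ is $xy$-convex if $p(V^*(X,Y)V)\preceq (I_d\otimes V)^*p(X,Y)(I_d\otimes V)$ for all $xy$-pairs $((X,Y),V)$. $p$ is convex in $x$ if for every positive integer $n$, all $X^1,X^2,Y\in\mathbb S_n(\mathbb C^\mu)$ and all $0<t<1$, $p(tX^1+(1-t)X^2,Y)\preceq t\,p(X^1,Y)+(1-t)\,p(X^2,Y)$; convexity in $y$ is defined in the same way with the roles of $x$ and $y$ interchanged. $p$ is convex in $x$ and $y$ separately if it is both convex in $x$ and convex in $y$. *)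

theory Defs
  imports "Jordan_Normal_Form.Schur_Decomposition"
begin

section \<open>Complex matrices of varying size\<close>

(* Matrices form no additive monoid type class (their size is not part of the type), so a finite
   sum of nr x nc matrices is taken entrywise. *)
definition mat_sum :: "nat \<Rightarrow> nat \<Rightarrow> ('b \<Rightarrow> complex mat) \<Rightarrow> 'b set \<Rightarrow> complex mat" where
  "mat_sum nr nc F S = mat nr nc (\<lambda>ij. \<Sum>a\<in>S. F a $$ ij)"

definition kron :: "complex mat \<Rightarrow> complex mat \<Rightarrow> complex mat" where
  "kron A B = mat (dim_row A * dim_row B) (dim_col A * dim_col B)
     (\<lambda>(i, j). A $$ (i div dim_row B, j div dim_col B) * B $$ (i mod dim_row B, j mod dim_col B))"

definition hermitian_mat :: "nat \<Rightarrow> complex mat \<Rightarrow> bool" where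
  "hermitian_mat n A \<longleftrightarrow> A \<in> carrier_mat n n \<and> mat_adjoint A = A"

definition psd_mat :: "nat \<Rightarrow> complex mat \<Rightarrow> bool" where
  "psd_mat n A \<longleftrightarrow> hermitian_mat n A \<and> (\<forall>v \<in> carrier_vec n. 0 \<le> Re ((A *\<^sub>v v) \<bullet>c v))"

definition psd_le :: "nat \<Rightarrow> complex mat \<Rightarrow> complex mat \<Rightarrow> bool" where
  "psd_le n S T \<longleftrightarrow> hermitian_mat n S \<and> hermitian_mat n T \<and> psd_mat n (T - S)"

definition isometry_mat :: "nat \<Rightarrow> nat \<Rightarrow> complex mat \<Rightarrow> bool" where
  "isometry_mat m n V \<longleftrightarrow> V \<in> carrier_mat n m \<and> mat_adjoint V * V = 1\<^sub>m m"

definition compress :: "complex mat \<Rightarrow> complex mat \<Rightarrow> complex mat" where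
  "compress V A = mat_adjoint V * A * V"

section \<open>Free polynomials\<close>

(* The indices 1, ..., mu are the elements of a finite type 'i, so mu = CARD('i); a mu-tuple of
   matrices is a function on 'i. *)
datatype 'i letter = Xv 'i | Yv 'i

type_synonym 'i word = "'i letter list"

(* A matrix-valued free polynomial is given by its coefficient function. *)
type_synonym 'i fpoly = "'i word \<Rightarrow> complex mat"

definition herm_tuple :: "nat \<Rightarrow> ('i \<Rightarrow> complex mat) \<Rightarrow> bool" where
  "herm_tuple n X \<longleftrightarrow> (\<forall>j. hermitian_mat n (X j))"

definition fp_support :: "nat \<Rightarrow> nat \<Rightarrow> 'i fpoly \<Rightarrow> 'i word set" where
  "fp_support N d p = {w. p w \<noteq> 0\<^sub>m N d}"

definition is_fpoly :: "nat \<Rightarrow> nat \<Rightarrow> 'i fpoly \<Rightarrow> bool" where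
  "is_fpoly N d p \<longleftrightarrow> (\<forall>w. p w \<in> carrier_mat N d) \<and> finite (fp_support N d p)"

definition fp_add :: "'i fpoly \<Rightarrow> 'i fpoly \<Rightarrow> 'i fpoly" where
  "fp_add p q = (\<lambda>w. p w + q w)"

(* The product of an M x N by an N x d matrix-valued polynomial: the coefficient of w is the sum
   over all factorizations of w into two subwords. *)
definition fp_mult :: "nat \<Rightarrow> nat \<Rightarrow> 'i fpoly \<Rightarrow> 'i fpoly \<Rightarrow> 'i fpoly" where
  "fp_mult M d p q = (\<lambda>w. mat_sum M d (\<lambda>k. p (take k w) * q (drop k w)) {..length w})"

definition fp_adjoint :: "'i fpoly \<Rightarrow> 'i fpoly" where
  "fp_adjoint p = (\<lambda>w. mat_adjoint (p (rev w)))"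

definition hermitian_fpoly :: "nat \<Rightarrow> 'i fpoly \<Rightarrow> bool" where
  "hermitian_fpoly d p \<longleftrightarrow> is_fpoly d d p \<and> fp_adjoint p = p"

fun letter_eval :: "('i \<Rightarrow> complex mat) \<Rightarrow> ('i \<Rightarrow> complex mat) \<Rightarrow> 'i letter \<Rightarrow> complex mat" where
  "letter_eval X Y (Xv j) = X j"
| "letter_eval X Y (Yv k) = Y k"

fun word_eval :: "nat \<Rightarrow> ('i \<Rightarrow> complex mat) \<Rightarrow> ('i \<Rightarrow> complex mat) \<Rightarrow> 'i word \<Rightarrow> complex mat" where
  "word_eval n X Y [] = 1\<^sub>m n"
| "word_eval n X Y (l # w) = letter_eval X Y l * word_eval n X Y w"

definition fp_eval ::
  "nat \<Rightarrow> nat \<Rightarrow> 'i fpoly \<Rightarrow> nat \<Rightarrow> ('i \<Rightarrow> complex mat) \<Rightarrow> ('i \<Rightarrow> complex mat) \<Rightarrow> complex mat" where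
  "fp_eval N d p n X Y =
     mat_sum (N * n) (d * n) (\<lambda>w. kron (p w) (word_eval n X Y w)) (fp_support N d p)"

section \<open>Pencils\<close>

fun pencil ::
  "nat \<Rightarrow> nat \<Rightarrow> complex mat \<Rightarrow> ('i \<Rightarrow> complex mat) \<Rightarrow> ('i \<Rightarrow> complex mat) \<Rightarrow>
     ('i \<Rightarrow> 'i \<Rightarrow> complex mat) \<Rightarrow> ('i \<Rightarrow> 'i \<Rightarrow> complex mat) \<Rightarrow> 'i fpoly" where
  "pencil N d A0 A B C D [] = A0"
| "pencil N d A0 A B C D [Xv j] = - A j"
| "pencil N d A0 A B C D [Yv k] = - B k"
| "pencil N d A0 A B C D [Xv p, Yv q] = - C p q"
| "pencil N d A0 A B C D [Yv q, Xv p] = - D q p"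
| "pencil N d A0 A B C D _ = 0\<^sub>m N d"

definition xy_pencil :: "nat \<Rightarrow> nat \<Rightarrow> 'i fpoly \<Rightarrow> bool" where
  "xy_pencil N d L \<longleftrightarrow>
     (\<exists>A0 A B C D. A0 \<in> carrier_mat N d \<and>
        (\<forall>j. A j \<in> carrier_mat N d) \<and> (\<forall>k. B k \<in> carrier_mat N d) \<and>
        (\<forall>p q. C p q \<in> carrier_mat N d) \<and> (\<forall>q p. D q p \<in> carrier_mat N d) \<and>
        L = pencil N d A0 A B C D)"

section \<open>Convexity\<close>

definition xy_pair ::
  "nat \<Rightarrow> nat \<Rightarrow> ('i \<Rightarrow> complex mat) \<Rightarrow> ('i \<Rightarrow> complex mat) \<Rightarrow> complex mat \<Rightarrow> bool" where
  "xy_pair m n X Y V \<longleftrightarrow> 0 < m \<and> 0 < n \<and> herm_tuple n X \<and> herm_tuple n Y \<and> isometry_mat m n V \<and>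
     (\<forall>i j. compress V (X i * Y j) = compress V (X i) * compress V (Y j))"

definition xy_convex :: "nat \<Rightarrow> ('i::finite) fpoly \<Rightarrow> bool" where
  "xy_convex d p \<longleftrightarrow> (\<forall>m n X Y V. xy_pair m n X Y V \<longrightarrow>
     psd_le (d * m) (fp_eval d d p m (\<lambda>j. compress V (X j)) (\<lambda>k. compress V (Y k)))
       (compress (kron (1\<^sub>m d) V) (fp_eval d d p n X Y)))"

definition tuple_comb ::
  "real \<Rightarrow> ('i \<Rightarrow> complex mat) \<Rightarrow> ('i \<Rightarrow> complex mat) \<Rightarrow> 'i \<Rightarrow> complex mat" where
  "tuple_comb t X1 X2 = (\<lambda>j. complex_of_real t \<cdot>\<^sub>m X1 j + complex_of_real (1 - t) \<cdot>\<^sub>m X2 j)"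

definition convex_in_x :: "nat \<Rightarrow> ('i::finite) fpoly \<Rightarrow> bool" where
  "convex_in_x d p \<longleftrightarrow> (\<forall>n X1 X2 Y t. 0 < n \<and> herm_tuple n X1 \<and> herm_tuple n X2 \<and> herm_tuple n Y \<and>
       0 < t \<and> t < 1 \<longrightarrow>
     psd_le (d * n) (fp_eval d d p n (tuple_comb t X1 X2) Y)
       (complex_of_real t \<cdot>\<^sub>m fp_eval d d p n X1 Y + complex_of_real (1 - t) \<cdot>\<^sub>m fp_eval d d p n X2 Y))"

definition convex_in_y :: "nat \<Rightarrow> ('i::finite) fpoly \<Rightarrow> bool" where
  "convex_in_y d p \<longleftrightarrow> (\<forall>n X Y1 Y2 t. 0 < n \<and> herm_tuple n X \<and> herm_tuple n Y1 \<and> herm_tuple n Y2 \<and>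
       0 < t \<and> t < 1 \<longrightarrow>
     psd_le (d * n) (fp_eval d d p n X (tuple_comb t Y1 Y2))
       (complex_of_real t \<cdot>\<^sub>m fp_eval d d p n X Y1 + complex_of_real (1 - t) \<cdot>\<^sub>m fp_eval d d p n X Y2))"

definition separately_convex :: "nat \<Rightarrow> ('i::finite) fpoly \<Rightarrow> bool" where
  "separately_convex d p \<longleftrightarrow> convex_in_x d p \<and> convex_in_y d p"

end

theory Submission
  imports "HOL-Analysis.Function_Topology" "HOL-Analysis.Topology_Euclidean_Space" Defs
begin

text \<open>Let the border words be x_j, y_k, x_j y_k and y_k x_j. Evaluating on matrices supported by a
  path labelled by a word shows that a separately convex p has degree at most two in x and in y,
  and that a word of degree two in x or y with nonzero coefficient is of the form u^* v with border
  words u and v. Writing p as in (iii) amounts to solving the equations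
  p_w = (sum over w = u^* v of K(u, v)), for these words w, with a positive semidefinite K.
  For a best approximate solution, minus the residual is a positive semidefinite Hankel kernel
  \<rho>(u, v) depending on u^* v only, and it has no entry linking some x_i with some y_j. Hence \<rho>
  splits into two positive semidefinite kernels, one not involving the y_k and one not involving
  the x_j. A GNS construction realises the first by hermitian matrices that test convexity in x, and
  symmetrically the second; adding both tests shows that the residual vanishes.
  Conversely, compression by an xy-pair commutes with the evaluation of pencils, and V V^* is at most
  the identity; direct sums of two points are xy-pairs that yield separate convexity.\<close>

section \<open>Positive semidefinite kernels\<close>

text \<open>Two obstacles shape the argument. Gram vectors may be linearly dependent, so
  multiplication by a y-letter need not be well defined on them; adding \<open>\<epsilon>\<close>
  times an orthonormal family makes them independent, and the error of order
  \<open>\<epsilon>^2\<close> is sent to zero at the end. Moreover, convexity in x sees only words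
  with two x, convexity in y only words with two y, and a word such as y x x y is seen by both, so
  the dual kernel has to be shared out with each word counted once. Entries with a single-letter
  half leave no choice: they belong to one test entirely. Eliminating the rows of the letters x_j
  respects this, because x_i y_j is not a constrained word and so the rows of the letters y_k have
  nothing to eliminate. A best approximation exists because rev u @ u has a single factorization
  into border words: each diagonal entry of K is constrained alone, which bounds the candidates.
  Since the approximation is a projection onto a convex cone, the residual is orthogonal to the
  approximant, and its pairing with p is its squared norm; the two tests force this pairing to be
  nonpositive.\<close>

definition ker_form :: "'s set \<Rightarrow> ('s \<Rightarrow> 's \<Rightarrow> complex) \<Rightarrow> ('s \<Rightarrow> complex) \<Rightarrow> complex" where
  "ker_form S K z = (\<Sum>s\<in>S. \<Sum>t\<in>S. cnj (z s) * K s t * z t)"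

definition ker_herm :: "'s set \<Rightarrow> ('s \<Rightarrow> 's \<Rightarrow> complex) \<Rightarrow> bool" where
  "ker_herm S K \<longleftrightarrow> (\<forall>s\<in>S. \<forall>t\<in>S. K t s = cnj (K s t))"

text \<open>Kernels on arbitrary index sets take the place of matrices, so that border words with a
  coordinate, vertices of a path and basis vectors of a test space can serve as indices directly. A
  numbering is chosen only where a statement about \<open>complex mat\<close> is needed.\<close>

definition ker_psd :: "'s set \<Rightarrow> ('s \<Rightarrow> 's \<Rightarrow> complex) \<Rightarrow> bool" where
  "ker_psd S K \<longleftrightarrow> ker_herm S K \<and> (\<forall>z. 0 \<le> Re (ker_form S K z))"

lemma ker_hermD: "ker_herm S K \<Longrightarrow> s \<in> S \<Longrightarrow> t \<in> S \<Longrightarrow> K t s = cnj (K s t)"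
  unfolding ker_herm_def by blast

lemma ker_psd_herm: "ker_psd S K \<Longrightarrow> ker_herm S K"
  unfolding ker_psd_def by blast

lemma ker_psdD: "ker_psd S K \<Longrightarrow> 0 \<le> Re (ker_form S K z)"
  unfolding ker_psd_def by blast

lemma ker_psd_cong:
  assumes "\<And>s t. s \<in> S \<Longrightarrow> t \<in> S \<Longrightarrow> K s t = K' s t"
  shows "ker_psd S K \<longleftrightarrow> ker_psd S K'"
  using assms unfolding ker_psd_def ker_herm_def ker_form_def by (auto cong: sum.cong)

lemma ker_form_add:
  "ker_form S (\<lambda>s t. K s t + K' s t) z = ker_form S K z + ker_form S K' z"
  unfolding ker_form_def by (simp add: algebra_simps sum.distrib)

lemma ker_form_scale:
  "ker_form S (\<lambda>s t. c * K s t) z = c * ker_form S K z"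
  unfolding ker_form_def by (simp add: algebra_simps sum_distrib_left)

lemma ker_psd_add_scale:
  assumes "ker_psd S K" "ker_psd S K'" "0 \<le> r"
  shows "ker_psd S (\<lambda>s t. K s t + of_real r * K' s t)"
proof -
  have "ker_herm S (\<lambda>s t. K s t + of_real r * K' s t)"
    using ker_hermD[OF ker_psd_herm[OF assms(1)]] ker_hermD[OF ker_psd_herm[OF assms(2)]]
    unfolding ker_herm_def by (metis complex_cnj_add complex_cnj_complex_of_real complex_cnj_mult)
  then show ?thesis
    using ker_psdD[OF assms(1)] ker_psdD[OF assms(2)] assms(3)
    unfolding ker_psd_def ker_form_add ker_form_scale by simp
qed

lemma ker_psd_zero: "ker_psd S (\<lambda>_ _. 0)"
  unfolding ker_psd_def ker_herm_def ker_form_def by simp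

lemma ker_psd_scale:
  assumes "ker_psd S K" "0 \<le> r"
  shows "ker_psd S (\<lambda>s t. of_real r * K s t)"
  using ker_psd_add_scale[OF ker_psd_zero assms] by simp

lemma ker_form_two_points:
  assumes "finite S" "s \<in> S" "t \<in> S" "s \<noteq> t"
  shows "ker_form S K (\<lambda>u. if u = s then \<alpha> else if u = t then \<beta> else 0) =
    cnj \<alpha> * K s s * \<alpha> + cnj \<alpha> * K s t * \<beta> + cnj \<beta> * K t s * \<alpha> + cnj \<beta> * K t t * \<beta>"
proof -
  let ?z = "\<lambda>u. if u = s then \<alpha> else if u = t then \<beta> else 0"
  have r: "(\<Sum>v\<in>S. g v * ?z v) = g s * \<alpha> + g t * \<beta>" for g :: "'a \<Rightarrow> complex"
  proof -
    have "(\<Sum>v\<in>S. g v * ?z v) = (\<Sum>v\<in>{s,t}. g v * ?z v)"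
      by (rule sum.mono_neutral_right) (use assms in auto)
    also have "\<dots> = g s * \<alpha> + g t * \<beta>" using assms by simp
    finally show ?thesis .
  qed
  have "ker_form S K ?z = (\<Sum>u\<in>S. cnj (?z u) * (K u s * \<alpha> + K u t * \<beta>))"
    unfolding ker_form_def
    by (intro sum.cong[OF refl]) (simp only: r[symmetric] sum_distrib_left mult.assoc)
  also have "\<dots> = (\<Sum>u\<in>{s,t}. cnj (?z u) * (K u s * \<alpha> + K u t * \<beta>))"
    by (rule sum.mono_neutral_right) (use assms in auto)
  also have "\<dots> = cnj \<alpha> * (K s s * \<alpha> + K s t * \<beta>) + cnj \<beta> * (K t s * \<alpha> + K t t * \<beta>)"
    using assms by simp
  finally show ?thesis by (simp add: algebra_simps)
qed

lemma ker_form_one_point: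
  assumes "finite S" "s \<in> S"
  shows "ker_form S K (\<lambda>u. if u = s then \<alpha> else 0) = cnj \<alpha> * K s s * \<alpha>"
proof -
  have "ker_form S K (\<lambda>u. if u = s then \<alpha> else 0)
      = (\<Sum>u\<in>S. if u = s then (\<Sum>v\<in>S. if v = s then cnj \<alpha> * K s s * \<alpha> else 0) else 0)"
    unfolding ker_form_def by (auto intro!: sum.cong)
  also have "\<dots> = cnj \<alpha> * K s s * \<alpha>" using assms by simp
  finally show ?thesis .
qed

lemma ker_psd_diag:
  assumes "ker_psd S K" "finite S" "s \<in> S"
  shows "K s s = of_real (Re (K s s))" and "0 \<le> Re (K s s)"
proof -
  have "K s s = cnj (K s s)" using assms ker_psd_herm ker_hermD by metis
  then show "K s s = of_real (Re (K s s))" by (metis Reals_cnj_iff of_real_Re)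
  show "0 \<le> Re (K s s)"
    using ker_psdD[OF assms(1), of "\<lambda>u. if u = s then 1 else 0"] ker_form_one_point[OF assms(2,3), of K 1]
    by simp
qed

lemma ker_psd_two_points:
  assumes "ker_psd S K" "finite S" "s \<in> S" "t \<in> S" "s \<noteq> t"
  shows "0 \<le> (cmod \<alpha>)\<^sup>2 * Re (K s s) + 2 * Re (cnj \<alpha> * K s t * \<beta>) + (cmod \<beta>)\<^sup>2 * Re (K t t)"
proof -
  have ts: "K t s = cnj (K s t)" using assms ker_psd_herm ker_hermD by metis
  have q: "Re (cnj z * x * z) = (cmod z)\<^sup>2 * Re x" if "x = of_real (Re x)" for z x
  proof -
    have "cnj z * x * z = x * (z * cnj z)" by (simp add: algebra_simps)
    also have "\<dots> = x * of_real ((cmod z)\<^sup>2)" by (simp add: complex_norm_square[symmetric])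
    also have "Re \<dots> = (cmod z)\<^sup>2 * Re x" by simp
    finally show ?thesis .
  qed
  have "0 \<le> Re (cnj \<alpha> * K s s * \<alpha> + cnj \<alpha> * K s t * \<beta> + cnj \<beta> * K t s * \<alpha> + cnj \<beta> * K t t * \<beta>)"
    using ker_psdD[OF assms(1), of "\<lambda>u. if u = s then \<alpha> else if u = t then \<beta> else 0"]
    unfolding ker_form_two_points[OF assms(2-5)] .
  also have "\<dots> = (cmod \<alpha>)\<^sup>2 * Re (K s s) + 2 * Re (cnj \<alpha> * K s t * \<beta>) + (cmod \<beta>)\<^sup>2 * Re (K t t)"
  proof -
    have "cnj \<beta> * K t s * \<alpha> = cnj (cnj \<alpha> * K s t * \<beta>)"
      unfolding ts complex_cnj_mult complex_cnj_cnj by (simp only: ac_simps)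
    then have "Re (cnj \<beta> * K t s * \<alpha>) = Re (cnj \<alpha> * K s t * \<beta>)" by (simp only: cnj.sel)
    then show ?thesis
      using q[OF ker_psd_diag(1)[OF assms(1,2,3)], of \<alpha>] q[OF ker_psd_diag(1)[OF assms(1,2,4)], of \<beta>]
      by (simp only: plus_complex.sel)
  qed
  finally show ?thesis .
qed

text \<open>With a zero diagonal entry at \<open>s\<close> the two-point form is affine in the
  weight at \<open>s\<close>, so a nonzero \<open>K s t\<close> would make it negative for a
  suitable weight.\<close>

lemma ker_psd_zero_row:
  assumes "ker_psd S K" "finite S" "s \<in> S" "t \<in> S" "K s s = 0"
  shows "K s t = 0"
proof (cases "s = t")
  case False
  show ?thesis
  proof (rule ccontr)
    assume nz: "K s t \<noteq> 0"
    \<comment> \<open>This weight gives the two-point form the value -1.\<close>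
    define c where "c = - ((Re (K t t) + 1) / (2 * (cmod (K s t))\<^sup>2))"
    have "0 \<le> 2 * Re (cnj (of_real c * K s t) * K s t * 1) + Re (K t t)"
      using ker_psd_two_points[OF assms(1-4) False, of "of_real c * K s t" 1] assms(5) by simp
    moreover have "cnj (of_real c * K s t) * K s t * 1 = of_real (c * (cmod (K s t))\<^sup>2)"
      by (simp add: complex_norm_square[unfolded of_real_power] algebra_simps)
    ultimately have "0 \<le> 2 * (c * (cmod (K s t))\<^sup>2) + Re (K t t)" by (metis Re_complex_of_real)
    moreover have "2 * (c * (cmod (K s t))\<^sup>2) = - (Re (K t t) + 1)"
      using nz unfolding c_def by (simp add: field_simps)
    ultimately show False by simp
  qed
qed (use assms in simp)

text \<open>With the weight \<open>- sgn (K s t)\<close> at \<open>s\<close> and 1 at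
  \<open>t\<close>, the cross terms contribute minus twice the modulus of the entry, and the
  diagonal terms at most 2 C. The bound confines kernels with bounded diagonal to a compact
  box.\<close>

lemma ker_psd_entry_le:
  assumes "ker_psd S K" "finite S" "s \<in> S" "t \<in> S" "Re (K s s) \<le> C" "Re (K t t) \<le> C"
  shows "cmod (K s t) \<le> C"
proof (cases "s = t")
  case True
  then show ?thesis
    using ker_psd_diag[OF assms(1-3)] assms(5) by (metis norm_of_real abs_of_nonneg)
next
  case False
  define \<alpha> where "\<alpha> = - sgn (K s t)"
  have "0 \<le> (cmod \<alpha>)\<^sup>2 * Re (K s s) + 2 * Re (cnj \<alpha> * K s t * 1) + (cmod 1)\<^sup>2 * Re (K t t)"
    by (rule ker_psd_two_points[OF assms(1-4) False])
  moreover have "(cmod \<alpha>)\<^sup>2 * Re (K s s) \<le> C"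
    using assms(5) ker_psd_diag(2)[OF assms(1,2,3)] unfolding \<alpha>_def
    by (cases "K s t = 0") (auto simp: norm_sgn)
  moreover have "cnj \<alpha> * K s t * 1 = - of_real (cmod (K s t))"
  proof (cases "K s t = 0")
    case False
    have "cnj (K s t) * K s t = of_real (cmod (K s t)) * of_real (cmod (K s t))"
      by (metis complex_norm_square mult.commute of_real_mult power2_eq_square)
    then show ?thesis using False unfolding \<alpha>_def sgn_eq by (simp add: field_simps)
  qed (simp add: \<alpha>_def)
  ultimately have "0 \<le> (cmod \<alpha>)\<^sup>2 * Re (K s s) + 2 * Re (- of_real (cmod (K s t))) + (cmod 1)\<^sup>2 * Re (K t t)"
      "(cmod \<alpha>)\<^sup>2 * Re (K s s) \<le> C"
    by metis+
  then show ?thesis using assms(6) by simp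
qed

lemma ker_psd_rank_one: "ker_psd S (\<lambda>s t. z s * cnj (z t))"
proof -
  have "ker_form S (\<lambda>s t. z s * cnj (z t)) y = of_real ((cmod (\<Sum>s\<in>S. cnj (z s) * y s))\<^sup>2)" for y
  proof -
    have "ker_form S (\<lambda>s t. z s * cnj (z t)) y = (\<Sum>s\<in>S. cnj (y s) * z s) * (\<Sum>t\<in>S. cnj (z t) * y t)"
      unfolding ker_form_def sum_product by (simp add: algebra_simps)
    also have "(\<Sum>s\<in>S. cnj (y s) * z s) = cnj (\<Sum>t\<in>S. cnj (z t) * y t)"
      by (simp add: mult.commute)
    finally show ?thesis by (simp only: complex_norm_square mult.commute)
  qed
  then show ?thesis unfolding ker_psd_def ker_herm_def by simp
qed

text \<open>Completing the square: among all shifts of \<open>z\<close> at the point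
  \<open>s\<close>, the shift by \<open>- \<sigma> / K s s\<close> minimizes the form of
  \<open>K\<close>, and the minimum is the form of the Schur complement at \<open>z\<close>.\<close>

lemma ker_psd_Schur:
  assumes psd: "ker_psd S K" and fin: "finite S" and s: "s \<in> S" and nz: "K s s \<noteq> 0"
  shows "ker_psd S (\<lambda>t u. K t u - K t s * K s u / K s s)"
  unfolding ker_psd_def
proof (intro conjI allI)
  have kss: "cnj (K s s) = K s s" using psd s ker_psd_herm ker_hermD by metis
  show "ker_herm S (\<lambda>t u. K t u - K t s * K s u / K s s)"
    unfolding ker_herm_def
  proof (intro ballI)
    fix t u assume tu: "t \<in> S" "u \<in> S"
    note h = ker_hermD[OF ker_psd_herm[OF psd]]
    show "K u t - K u s * K s t / K s s = cnj (K t u - K t s * K s u / K s s)"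
      using h[OF tu] h[OF tu(1) s] h[OF s tu(2)] kss by simp
  qed
  fix z
  define \<sigma> where "\<sigma> = (\<Sum>t\<in>S. K s t * z t)"
  define \<alpha> where "\<alpha> = - \<sigma> / K s s"
  define e where "e = (\<lambda>t. if t = s then \<alpha> else 0)"
  have cs: "(\<Sum>t\<in>S. cnj (z t) * K t s) = cnj \<sigma>"
    unfolding \<sigma>_def cnj_sum using ker_hermD[OF ker_psd_herm[OF psd] s]
    by (intro sum.cong) simp_all
  have e1: "(\<Sum>t\<in>S. g t * e t) = g s * \<alpha>" for g :: "'a \<Rightarrow> complex"
  proof -
    have "(\<Sum>t\<in>S. g t * e t) = (\<Sum>t\<in>S. if t = s then g s * \<alpha> else 0)"
      unfolding e_def by (auto intro!: sum.cong)
    then show ?thesis using s fin by simp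
  qed
  have e2: "(\<Sum>t\<in>S. cnj (e t) * g t) = cnj \<alpha> * g s" for g :: "'a \<Rightarrow> complex"
  proof -
    have "(\<Sum>t\<in>S. cnj (e t) * g t) = (\<Sum>t\<in>S. if t = s then cnj \<alpha> * g s else 0)"
      unfolding e_def by (auto intro!: sum.cong)
    then show ?thesis using s fin by simp
  qed
  have "ker_form S K (\<lambda>t. z t + e t) = ker_form S K z
      + (\<Sum>t\<in>S. \<Sum>u\<in>S. cnj (z t) * K t u * e u) + (\<Sum>t\<in>S. \<Sum>u\<in>S. cnj (e t) * K t u * z u)
      + (\<Sum>t\<in>S. \<Sum>u\<in>S. cnj (e t) * K t u * e u)"
    unfolding ker_form_def by (simp add: algebra_simps sum.distrib)
  also have "(\<Sum>t\<in>S. \<Sum>u\<in>S. cnj (z t) * K t u * e u) = cnj \<sigma> * \<alpha>"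
    unfolding e1 cs[symmetric] sum_distrib_right by simp
  also have "(\<Sum>t\<in>S. \<Sum>u\<in>S. cnj (e t) * K t u * z u) = cnj \<alpha> * \<sigma>"
    unfolding mult.assoc sum_distrib_left[symmetric] e2 \<sigma>_def ..
  also have "(\<Sum>t\<in>S. \<Sum>u\<in>S. cnj (e t) * K t u * e u) = cnj \<alpha> * K s s * \<alpha>"
    unfolding e1 by (simp only: mult.assoc e2)
  also have "ker_form S K z + cnj \<sigma> * \<alpha> + cnj \<alpha> * \<sigma> + cnj \<alpha> * K s s * \<alpha>
      = ker_form S K z - cnj \<sigma> * \<sigma> / K s s"
    using nz kss unfolding \<alpha>_def by (simp add: field_simps)
  also have "\<dots> = ker_form S (\<lambda>t u. K t u - K t s * K s u / K s s) z"
  proof -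
    have "cnj \<sigma> * \<sigma> / K s s = (\<Sum>t\<in>S. \<Sum>u\<in>S. cnj (z t) * (K t s * K s u / K s s) * z u)"
    proof -
      have "cnj \<sigma> * \<sigma> = (\<Sum>t\<in>S. cnj (z t) * K t s) * (\<Sum>u\<in>S. K s u * z u)"
        unfolding cs by (simp add: \<sigma>_def)
      then show ?thesis
        unfolding sum_product sum_divide_distrib by (simp add: sum_divide_distrib mult.assoc)
    qed
    then show ?thesis unfolding ker_form_def by (simp add: algebra_simps sum_subtractf)
  qed
  finally show "0 \<le> Re (ker_form S (\<lambda>t u. K t u - K t s * K s u / K s s) z)"
    using ker_psdD[OF psd] by metis
qed

text \<open>Gaussian elimination of the points of \<open>X\<close> by Schur complements, one
  rank-one term for each nonzero pivot. A point \<open>y\<close> not linked to \<open>X\<close> by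
  \<open>K\<close> gets the coordinate 0 in each new term, and its entries against \<open>X\<close>
  stay 0 in the complement; this gives the last clause, which later keeps the letters y_k out of the
  part that tests convexity in x.\<close>

lemma ker_psd_split:
  assumes "finite S" "finite X" "X \<subseteq> S" "ker_psd S K"
  shows "\<exists>(r::nat) f K'. ker_psd S K' \<and>
    (\<forall>s\<in>S. \<forall>t\<in>S. K s t = (\<Sum>l<r. f l s * cnj (f l t)) + K' s t) \<and>
    (\<forall>x\<in>X. \<forall>t\<in>S. K' x t = 0) \<and>
    (\<forall>y\<in>S. (\<forall>x\<in>X. K y x = 0) \<longrightarrow> (\<forall>l<r. f l y = 0))"
  using assms(2,3,4)
proof (induction X arbitrary: K rule: finite_induct)
  case empty
  then show ?case by (intro exI[of _ 0] exI[of _ "\<lambda>_ _. 0"] exI[of _ K]) simp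
next
  case (insert x X)
  have xS: "x \<in> S" using insert.prems by simp
  show ?case
  proof (cases "K x x = 0")
    case True
    have row: "K x t = 0" if "t \<in> S" for t
      using ker_psd_zero_row[OF insert.prems(2) assms(1) xS that True] .
    obtain r f K' where *: "ker_psd S K'"
      "\<And>s t. s\<in>S \<Longrightarrow> t\<in>S \<Longrightarrow> K s t = (\<Sum>l<r. f l s * cnj (f l t)) + K' s t"
      "\<And>x t. x\<in>X \<Longrightarrow> t\<in>S \<Longrightarrow> K' x t = 0"
      "\<And>y l. y\<in>S \<Longrightarrow> \<forall>x\<in>X. K y x = 0 \<Longrightarrow> l < (r::nat) \<Longrightarrow> f l y = 0"
      using insert.IH[of K] insert.prems by auto
    \<comment> \<open>The last clause of the induction hypothesis is applied to \<open>x\<close>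
      itself: its row is zero, so the vectors vanish at \<open>x\<close> and the remainder has a
      zero row there.\<close>
    have "\<forall>x'\<in>X. K x x' = 0" using row insert.prems by auto
    then have "f l x = 0" if "l < r" for l using *(4)[OF xS] that by blast
    then have "K' x t = 0" if "t \<in> S" for t
      using *(2)[OF xS that] row[OF that] by simp
    then show ?thesis using * by (intro exI[of _ r] exI[of _ f] exI[of _ K']) auto
  next
    case False
    define c where "c = Re (K x x)"
    have c: "K x x = of_real c" "0 < c"
      using ker_psd_diag[OF insert.prems(2) assms(1) xS] False unfolding c_def by (auto simp: order_less_le)
    define K1 where "K1 = (\<lambda>t u. K t u - K t x * K x u / K x x)"
    have "ker_psd S K1"
      unfolding K1_def by (rule ker_psd_Schur[OF insert.prems(2) assms(1) xS False])
    then obtain r f K' where *: "ker_psd S K'"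
      "\<And>s t. s\<in>S \<Longrightarrow> t\<in>S \<Longrightarrow> K1 s t = (\<Sum>l<r. f l s * cnj (f l t)) + K' s t"
      "\<And>x t. x\<in>X \<Longrightarrow> t\<in>S \<Longrightarrow> K' x t = 0"
      "\<And>y l. y\<in>S \<Longrightarrow> \<forall>x\<in>X. K1 y x = 0 \<Longrightarrow> l < (r::nat) \<Longrightarrow> f l y = 0"
      using insert.IH[of K1] insert.prems by auto
    define f' where "f' = (\<lambda>l s. if l = r then K s x / of_real (sqrt c) else f l s)"
    have herm: "K x t = cnj (K t x)" if "t \<in> S" for t
      using ker_hermD[OF ker_psd_herm[OF insert.prems(2)] that xS] .
    have new: "f' r s * cnj (f' r t) = K s x * K x t / K x x" if "t \<in> S" for s t
    proof -
      have "complex_of_real (sqrt c) * of_real (sqrt c) = of_real c"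
        using c(2) by (simp flip: of_real_mult)
      then show ?thesis unfolding f'_def c(1) herm[OF that] by simp
    qed
    have K1x: "K1 x t = 0" "K1 t x = 0" for t using False unfolding K1_def by simp_all
    have "f l x = 0" if "l < r" for l using *(4)[OF xS] that K1x by simp
    then have K'x: "K' x t = 0" if "t \<in> S" for t
      using *(2)[OF xS that] K1x(1)[of t] by simp
    show ?thesis
    proof (intro exI[of _ "Suc r"] exI[of _ f'] exI[of _ K'] conjI ballI impI allI)
      show "ker_psd S K'" by fact
      show "K s t = (\<Sum>l<Suc r. f' l s * cnj (f' l t)) + K' s t" if "s \<in> S" "t \<in> S" for s t
      proof -
        have "(\<Sum>l<r. f' l s * cnj (f' l t)) = (\<Sum>l<r. f l s * cnj (f l t))"
          unfolding f'_def by (intro sum.cong) auto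
        then show ?thesis using *(2)[OF that] new[OF that(2), of s] unfolding K1_def by (simp add: diff_eq_eq algebra_simps)
      qed
      show "K' y t = 0" if "y \<in> insert x X" "t \<in> S" for y t using that K'x *(3) by auto
      show "f' l y = 0" if "y \<in> S" "\<forall>x'\<in>insert x X. K y x' = 0" "l < Suc r" for y l
        using *(4)[OF that(1), of l] that(2,3) unfolding f'_def K1_def by (cases "l = r") auto
    qed
  qed
qed

lemma ker_psd_Gram:
  assumes "finite S" "ker_psd S K"
  shows "\<exists>(r::nat) f. \<forall>s\<in>S. \<forall>t\<in>S. K s t = (\<Sum>l<r. f l s * cnj (f l t))"
proof -
  obtain r :: nat and f K' where "\<forall>s\<in>S. \<forall>t\<in>S. K s t = (\<Sum>l<r. f l s * cnj (f l t)) + K' s t"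
    "\<forall>x\<in>S. \<forall>t\<in>S. K' x t = 0"
    using ker_psd_split[OF assms(1) assms(1) subset_refl assms(2)] by blast
  then have "\<forall>s\<in>S. \<forall>t\<in>S. K s t = (\<Sum>l<r. f l s * cnj (f l t))" by simp
  then show ?thesis by blast
qed

section \<open>Matrices as kernels\<close>

lemma ker_form_reindex:
  assumes "bij_betw h S' S"
  shows "ker_form S' (\<lambda>s t. K (h s) (h t)) (\<lambda>s. z (h s)) = ker_form S K z"
proof -
  have "ker_form S K z = (\<Sum>s\<in>S'. \<Sum>t\<in>S. cnj (z (h s)) * K (h s) t * z t)"
    unfolding ker_form_def by (rule sum.reindex_bij_betw[OF assms, symmetric])
  also have "\<dots> = (\<Sum>s\<in>S'. \<Sum>t\<in>S'. cnj (z (h s)) * K (h s) (h t) * z (h t))"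
    by (intro sum.cong refl sum.reindex_bij_betw[OF assms, symmetric])
  finally show ?thesis unfolding ker_form_def by simp
qed

lemma ker_psd_reindex:
  assumes h: "bij_betw h S' S"
  shows "ker_psd S' (\<lambda>s t. K (h s) (h t)) \<longleftrightarrow> ker_psd S K"
proof -
  have im: "h ` S' = S" using h by (simp add: bij_betw_def)
  have herm: "ker_herm S' (\<lambda>s t. K (h s) (h t)) \<longleftrightarrow> ker_herm S K"
    unfolding ker_herm_def im[symmetric] by simp
  have form: "ker_form S' (\<lambda>s t. K (h s) (h t)) z = ker_form S K (\<lambda>s. z (inv_into S' h s))" for z
  proof -
    have "ker_form S' (\<lambda>s t. K (h s) (h t)) z
        = ker_form S' (\<lambda>s t. K (h s) (h t)) (\<lambda>s. z (inv_into S' h (h s)))"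
      unfolding ker_form_def using h by (intro sum.cong) (simp_all add: bij_betw_def)
    also have "\<dots> = ker_form S K (\<lambda>s. z (inv_into S' h s))"
      by (rule ker_form_reindex[OF h])
    finally show ?thesis .
  qed
  show ?thesis
    unfolding ker_psd_def herm using form ker_form_reindex[OF h, of K] by metis
qed

lemma mat_adjoint_dim [simp]: "dim_row (mat_adjoint A) = dim_col A" "dim_col (mat_adjoint A) = dim_row A"
  unfolding mat_adjoint_def by auto

lemma mat_adjoint_index [simp]:
  "i < dim_col A \<Longrightarrow> j < dim_row A \<Longrightarrow> mat_adjoint A $$ (i, j) = cnj (A $$ (j, i))"
  unfolding mat_adjoint_def by (simp add: mat_of_rows_def conjugate_complex_def)

lemma mat_adjoint_carrier [simp]: "mat_adjoint A \<in> carrier_mat m n \<longleftrightarrow> A \<in> carrier_mat n m"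
  unfolding carrier_mat_def by (simp add: conj_commute)

lemma hermitian_mat_iff:
  "hermitian_mat n A \<longleftrightarrow> A \<in> carrier_mat n n \<and> ker_herm {..<n} (\<lambda>i j. A $$ (i, j))"
proof -
  have "mat_adjoint A = A \<longleftrightarrow> ker_herm {..<n} (\<lambda>i j. A $$ (i, j))" if "A \<in> carrier_mat n n"
  proof -
    have "mat_adjoint A = A \<longleftrightarrow> (\<forall>i<n. \<forall>j<n. mat_adjoint A $$ (i, j) = A $$ (i, j))"
      using that by (auto simp: mat_eq_iff)
    also have "\<dots> \<longleftrightarrow> (\<forall>i<n. \<forall>j<n. cnj (A $$ (j, i)) = A $$ (i, j))"
      using that by simp
    also have "\<dots> \<longleftrightarrow> (\<forall>i<n. \<forall>j<n. A $$ (j, i) = cnj (A $$ (i, j)))"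
      by (intro iffI allI impI) (drule spec, drule mp, assumption, drule spec, drule mp, assumption, erule sym)+
    finally show ?thesis unfolding ker_herm_def Ball_def lessThan_iff by blast
  qed
  then show ?thesis unfolding hermitian_mat_def by blast
qed

lemma mat_quadratic_form:
  assumes "A \<in> carrier_mat n n" "v \<in> carrier_vec n"
  shows "(A *\<^sub>v v) \<bullet>c v = ker_form {..<n} (\<lambda>i j. A $$ (i, j)) (\<lambda>i. v $ i)"
proof -
  have "(A *\<^sub>v v) \<bullet>c v = (\<Sum>i<n. (\<Sum>j<n. A $$ (i, j) * v $ j) * cnj (v $ i))"
    using assms by (simp add: scalar_prod_def atLeast0LessThan conjugate_complex_def)
  also have "\<dots> = ker_form {..<n} (\<lambda>i j. A $$ (i, j)) (\<lambda>i. v $ i)"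
    unfolding ker_form_def sum_distrib_right by (intro sum.cong refl) (simp only: ac_simps)
  finally show ?thesis .
qed

lemma psd_mat_iff:
  "psd_mat n A \<longleftrightarrow> A \<in> carrier_mat n n \<and> ker_psd {..<n} (\<lambda>i j. A $$ (i, j))"
proof (cases "A \<in> carrier_mat n n")
  case True
  have "(\<forall>v\<in>carrier_vec n. 0 \<le> Re ((A *\<^sub>v v) \<bullet>c v)) \<longleftrightarrow>
      (\<forall>z. 0 \<le> Re (ker_form {..<n} (\<lambda>i j. A $$ (i, j)) z))"
  proof (intro iffI allI ballI)
    fix z assume *: "\<forall>v\<in>carrier_vec n. 0 \<le> Re ((A *\<^sub>v v) \<bullet>c v)"
    have "ker_form {..<n} (\<lambda>i j. A $$ (i, j)) z = ker_form {..<n} (\<lambda>i j. A $$ (i, j)) (\<lambda>i. vec n z $ i)"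
      unfolding ker_form_def by (intro sum.cong) auto
    then show "0 \<le> Re (ker_form {..<n} (\<lambda>i j. A $$ (i, j)) z)"
      using * mat_quadratic_form[OF True, of "vec n z"] by (metis vec_carrier)
  qed (use mat_quadratic_form[OF True] in auto)
  then show ?thesis unfolding psd_mat_def hermitian_mat_iff ker_psd_def using True by blast
qed (auto simp: psd_mat_def hermitian_mat_def)

lemma block_index_less: "a < d \<Longrightarrow> s < n \<Longrightarrow> a * n + s < d * (n::nat)"
proof -
  assume "a < d" "s < n"
  then have "a * n + s < Suc a * n" by simp
  also have "\<dots> \<le> d * n" using \<open>a < d\<close> by (intro mult_le_mono1) simp
  finally show ?thesis .
qed

lemma bij_betw_block_index:
  "bij_betw (\<lambda>(a, s). a * n + s) ({..<d} \<times> {..<n}) {..<d * (n::nat)}"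
  unfolding bij_betw_def
proof
  show "inj_on (\<lambda>(a, s). a * n + s) ({..<d} \<times> {..<n})"
  proof (rule inj_onI, clarsimp)
    fix a s b t assume *: "s < n" "t < n" "a * n + s = b * n + t"
    have "(a * n + s) div n = a" "(b * n + t) div n = b" using *(1,2) by simp_all
    then have "a = b" using *(3) by simp
    then show "a = b \<and> s = t" using *(3) by simp
  qed
  show "(\<lambda>(a, s). a * n + s) ` ({..<d} \<times> {..<n}) = {..<d * n}"
  proof
    show "{..<d * n} \<subseteq> (\<lambda>(a, s). a * n + s) ` ({..<d} \<times> {..<n})"
    proof
      fix i assume "i \<in> {..<d * n}"
      then have i: "i < d * n" by simp
      then have "0 < n" by (cases n) auto
      then have "i mod n < n" by simp
      moreover have "i div n < d" using i by (simp add: less_mult_imp_div_less)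
      moreover have "i = i div n * n + i mod n" by simp
      ultimately show "i \<in> (\<lambda>(a, s). a * n + s) ` ({..<d} \<times> {..<n})" by force
    qed
  qed (auto intro: block_index_less)
qed

text \<open>\<open>a * n + s\<close> is the index convention of \<open>kron\<close>; passing to
  pairs separates the coefficient index \<open>a\<close> from the matrix index
  \<open>s\<close>.\<close>

lemma block_kernel:
  "ker_psd {..<d * n} (\<lambda>i j. P $$ (i, j)) \<longleftrightarrow>
   ker_psd ({..<d} \<times> {..<n}) (\<lambda>(a, s) (b, t). P $$ (a * n + s, b * n + t))"
  using ker_psd_reindex[OF bij_betw_block_index, of d n "\<lambda>i j. P $$ (i, j)"]
  by (simp add: case_prod_unfold)

section \<open>Evaluation of words and polynomials on kernels\<close>

fun word_ker :: "'b set \<Rightarrow> ('i letter \<Rightarrow> 'b \<Rightarrow> 'b \<Rightarrow> complex) \<Rightarrow> 'i word \<Rightarrow> 'b \<Rightarrow> 'b \<Rightarrow> complex" where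
  "word_ker T Z [] s t = (if s = t then 1 else 0)"
| "word_ker T Z (l # w) s t = (\<Sum>u\<in>T. Z l s u * word_ker T Z w u t)"

lemma word_ker_cong:
  assumes "\<And>l s t. s \<in> T \<Longrightarrow> t \<in> T \<Longrightarrow> Z l s t = Z' l s t" "s \<in> T" "t \<in> T"
  shows "word_ker T Z w s t = word_ker T Z' w s t"
  using assms(2,3) by (induction w arbitrary: s) (auto intro!: sum.cong simp: assms(1))

lemma word_ker_reindex:
  assumes "bij_betw h S T" "s \<in> S" "t \<in> S"
  shows "word_ker S (\<lambda>l s t. Z l (h s) (h t)) w s t = word_ker T Z w (h s) (h t)"
  using assms(2)
proof (induction w arbitrary: s)
  case Nil
  then show ?case using assms by (auto simp: bij_betw_def inj_on_def)
next
  case (Cons l w)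
  have "word_ker S (\<lambda>l s t. Z l (h s) (h t)) (l # w) s t = (\<Sum>u\<in>S. Z l (h s) (h u) * word_ker T Z w (h u) (h t))"
    using Cons by (auto intro!: sum.cong)
  also have "\<dots> = (\<Sum>u\<in>T. Z l (h s) u * word_ker T Z w u (h t))"
    by (rule sum.reindex_bij_betw[OF assms(1)])
  finally show ?case by simp
qed

lemma word_ker_append:
  assumes "finite T" "s \<in> T"
  shows "word_ker T Z (v @ w) s t = (\<Sum>u\<in>T. word_ker T Z v s u * word_ker T Z w u t)"
  using assms(2)
proof (induction v arbitrary: s)
  case Nil
  have "(\<Sum>u\<in>T. word_ker T Z [] s u * word_ker T Z w u t) = (\<Sum>u\<in>T. if u = s then word_ker T Z w u t else 0)"
    by (intro sum.cong) auto
  then show ?case using assms(1) Nil by simp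
next
  case (Cons l v)
  have "word_ker T Z ((l # v) @ w) s t = (\<Sum>u\<in>T. \<Sum>r\<in>T. Z l s u * word_ker T Z v u r * word_ker T Z w r t)"
    using Cons by (auto intro!: sum.cong simp: sum_distrib_left mult.assoc)
  also have "\<dots> = (\<Sum>r\<in>T. \<Sum>u\<in>T. Z l s u * word_ker T Z v u r * word_ker T Z w r t)" by (rule sum.swap)
  finally show ?case by (simp add: sum_distrib_right)
qed

lemma word_ker_single: "finite T \<Longrightarrow> t \<in> T \<Longrightarrow> word_ker T Z [l] s t = Z l s t"
proof -
  assume "finite T" "t \<in> T"
  have "word_ker T Z [l] s t = (\<Sum>u\<in>T. if u = t then Z l s u else 0)" by (auto intro!: sum.cong)
  then show ?thesis using \<open>finite T\<close> \<open>t \<in> T\<close> by simp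
qed

lemma word_ker_rev:
  assumes "finite T" "\<And>l. ker_herm T (Z l)" "s \<in> T" "t \<in> T"
  shows "word_ker T Z (rev w) s t = cnj (word_ker T Z w t s)"
  using assms(3,4)
proof (induction w arbitrary: s t)
  case (Cons l w)
  have "word_ker T Z (rev (l # w)) s t = (\<Sum>u\<in>T. word_ker T Z (rev w) s u * word_ker T Z [l] u t)"
    using word_ker_append[OF assms(1) Cons.prems(1), of Z "rev w" "[l]" t] by simp
  also have "\<dots> = (\<Sum>u\<in>T. cnj (Z l t u * word_ker T Z w u s))"
  proof (rule sum.cong)
    fix u assume u: "u \<in> T"
    have "Z l u t = cnj (Z l t u)" using ker_hermD[OF assms(2)] u Cons.prems by blast
    moreover have "word_ker T Z (rev w) s u = cnj (word_ker T Z w u s)" using Cons.IH Cons.prems u by blast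
    ultimately show "word_ker T Z (rev w) s u * word_ker T Z [l] u t = cnj (Z l t u * word_ker T Z w u s)"
      unfolding word_ker_single[OF assms(1) Cons.prems(2)] by (simp add: mult.commute)
  qed simp
  finally show ?case by simp
qed simp

lemma herm_tuple_letter:
  assumes "herm_tuple n X" "herm_tuple n Y"
  shows "hermitian_mat n (letter_eval X Y l)"
  using assms unfolding herm_tuple_def by (cases l) auto

lemma letter_eval_carrier:
  assumes "herm_tuple n X" "herm_tuple n Y"
  shows "letter_eval X Y l \<in> carrier_mat n n"
  using herm_tuple_letter[OF assms] unfolding hermitian_mat_def by blast

lemma word_eval_carrier:
  assumes "herm_tuple n X" "herm_tuple n Y"
  shows "word_eval n X Y w \<in> carrier_mat n n"
  by (induction w) (auto intro: mult_carrier_mat letter_eval_carrier[OF assms])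

lemma word_eval_index:
  assumes "herm_tuple n X" "herm_tuple n Y" "s < n" "t < n"
  shows "word_eval n X Y w $$ (s, t) = word_ker {..<n} (\<lambda>l s t. letter_eval X Y l $$ (s, t)) w s t"
  using assms(3)
proof (induction w arbitrary: s)
  case Nil
  then show ?case using assms by simp
next
  case (Cons l w)
  have dims: "dim_row (letter_eval X Y l) = n" "dim_col (letter_eval X Y l) = n"
    "dim_row (word_eval n X Y w) = n" "dim_col (word_eval n X Y w) = n"
    using letter_eval_carrier[OF assms(1,2), of l] word_eval_carrier[OF assms(1,2), of w] by auto
  show ?case using Cons assms(4) dims by (simp add: scalar_prod_def atLeast0LessThan)
qed

lemma fp_eval_carrier: "fp_eval N d p n X Y \<in> carrier_mat (N * n) (d * n)"
  unfolding fp_eval_def mat_sum_def by simp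

lemma fp_eval_index:
  assumes p: "is_fpoly N d p" and W: "\<And>w. word_eval n X Y w \<in> carrier_mat n n"
    and "a < N" "s < n" "b < d" "t < n"
  shows "fp_eval N d p n X Y $$ (a * n + s, b * n + t) =
    (\<Sum>w\<in>fp_support N d p. p w $$ (a, b) * word_eval n X Y w $$ (s, t))"
proof -
  have pc: "p w \<in> carrier_mat N d" for w using p unfolding is_fpoly_def by blast
  have dims: "dim_row (p w) = N" "dim_col (p w) = d"
    "dim_row (word_eval n X Y w) = n" "dim_col (word_eval n X Y w) = n" for w
    using pc[of w] W[of w] by auto
  have "kron (p w) (word_eval n X Y w) $$ (a * n + s, b * n + t) = p w $$ (a, b) * word_eval n X Y w $$ (s, t)" for w
    unfolding kron_def using assms(3-6) dims[of w] by (simp add: block_index_less)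
  then show ?thesis
    unfolding fp_eval_def mat_sum_def using assms(3-6) by (simp add: block_index_less)
qed

text \<open>Counterpart of \<open>fp_eval\<close> for letters acting by kernels on an arbitrary set
  \<open>T\<close>, with pairs in place of the indices of a Kronecker product.\<close>

definition poly_ker :: "nat \<Rightarrow> 'i fpoly \<Rightarrow> 'b set \<Rightarrow> ('i letter \<Rightarrow> 'b \<Rightarrow> 'b \<Rightarrow> complex) \<Rightarrow>
    nat \<times> 'b \<Rightarrow> nat \<times> 'b \<Rightarrow> complex" where
  "poly_ker d p T Z = (\<lambda>(a, s) (b, t). \<Sum>w\<in>fp_support d d p. p w $$ (a, b) * word_ker T Z w s t)"

lemma fp_eval_poly_ker:
  assumes "is_fpoly d d p" "herm_tuple n X" "herm_tuple n Y" "a < d" "s < n" "b < d" "t < n"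
  shows "fp_eval d d p n X Y $$ (a * n + s, b * n + t) =
    poly_ker d p {..<n} (\<lambda>l s t. letter_eval X Y l $$ (s, t)) (a, s) (b, t)"
  unfolding poly_ker_def
  using fp_eval_index[OF assms(1) word_eval_carrier[OF assms(2,3)] assms(4-7)]
    word_eval_index[OF assms(2,3,5,7)] by simp

text \<open>Midpoint convexity between \<open>Z + D\<close> and \<open>Z - D\<close>, doubled. As
  \<open>D\<close> vanishes on the y-letters, the two points share their Y and only x varies. A
  numbering \<open>h\<close> of \<open>T\<close> carries the kernels to matrices and back.\<close>

lemma convex_in_x_second_difference:
  fixes p :: "('i::finite) fpoly" and T :: "'b set"
  assumes conv: "convex_in_x d p" and p: "is_fpoly d d p"
    and T: "finite T" "T \<noteq> {}"
    and Z: "\<And>l. ker_herm T (Z l)" and D: "\<And>l. ker_herm T (D l)"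
    and Dy: "\<And>k s t. D (Yv k) s t = 0"
  shows "ker_psd ({..<d} \<times> T) (\<lambda>s t.
      poly_ker d p T (\<lambda>l s t. Z l s t + D l s t) s t + poly_ker d p T (\<lambda>l s t. Z l s t - D l s t) s t
      - 2 * poly_ker d p T Z s t)"
proof -
  define n where "n = card T"
  have n0: "0 < n" unfolding n_def using T by (simp add: card_gt_0_iff)
  obtain h where h: "bij_betw h {..<n} T"
    unfolding n_def using T(1) by (metis atLeast0LessThan ex_bij_betw_nat_finite)
  have hT: "h s \<in> T" if "s < n" for s using h that by (auto simp: bij_betw_def)
  define M where "M = (\<lambda>(G :: 'i letter \<Rightarrow> 'b \<Rightarrow> 'b \<Rightarrow> complex) l. mat n n (\<lambda>(i, j). G l (h i) (h j)))"
  define Zp where "Zp = (\<lambda>l s t. Z l s t + D l s t)"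
  define Zm where "Zm = (\<lambda>l s t. Z l s t - D l s t)"
  have HZp: "ker_herm T (Zp l)" for l
    unfolding Zp_def ker_herm_def using ker_hermD[OF Z[of l]] ker_hermD[OF D[of l]]
    by (metis complex_cnj_add)
  have HZm: "ker_herm T (Zm l)" for l
    unfolding Zm_def ker_herm_def using ker_hermD[OF Z[of l]] ker_hermD[OF D[of l]]
    by (metis complex_cnj_diff)
  have HM: "hermitian_mat n (M G l)" if "ker_herm T (G l)" for G l
  proof -
    have "ker_herm {..<n} (\<lambda>i j. M G l $$ (i, j))"
      unfolding ker_herm_def
    proof (intro ballI)
      fix i j assume "i \<in> {..<n}" "j \<in> {..<n}"
      then show "M G l $$ (j, i) = cnj (M G l $$ (i, j))"
        using ker_hermD[OF that hT[of i] hT[of j]] unfolding M_def by simp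
    qed
    then show ?thesis unfolding hermitian_mat_iff M_def by simp
  qed
  define X where "X = (\<lambda>G j. M G (Xv j))"
  define Y where "Y = (\<lambda>G j. M G (Yv j))"
  have le: "letter_eval (X G) (Y G) l = M G l" for G l
    unfolding X_def Y_def by (cases l) auto
  have HX: "herm_tuple n (X G)" "herm_tuple n (Y G)" if "\<And>l. ker_herm T (G l)" for G
    unfolding herm_tuple_def X_def Y_def using HM that by blast+
  have Yeq: "Y Zp = Y Z" "Y Zm = Y Z" unfolding Y_def M_def Zp_def Zm_def using Dy by simp_all
  have Xeq: "tuple_comb (1/2) (X Zp) (X Zm) = X Z"
    unfolding tuple_comb_def X_def M_def Zp_def Zm_def by (rule ext, rule eq_matI) (auto simp: field_simps)
  define P where "P = (\<lambda>G. fp_eval d d p n (X G) (Y G))"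
  have Pd: "P G \<in> carrier_mat (d * n) (d * n)" for G unfolding P_def by (rule fp_eval_carrier)
  then have Pdim: "dim_row (P G) = d * n" "dim_col (P G) = d * n" for G by auto
  have "psd_le (d * n) (fp_eval d d p n (tuple_comb (1/2) (X Zp) (X Zm)) (Y Z))
      (complex_of_real (1/2) \<cdot>\<^sub>m fp_eval d d p n (X Zp) (Y Z) + complex_of_real (1 - 1/2) \<cdot>\<^sub>m fp_eval d d p n (X Zm) (Y Z))"
    using conv[unfolded convex_in_x_def, rule_format, of n "X Zp" "X Zm" "Y Z" "1/2"]
      n0 HX[of Zp] HX[of Zm] HX[of Z] HZp HZm Z by simp
  then have "psd_mat (d * n) (complex_of_real (1/2) \<cdot>\<^sub>m P Zp + complex_of_real (1 - 1/2) \<cdot>\<^sub>m P Zm - P Z)"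
    unfolding psd_le_def Xeq P_def Yeq by blast
  then have "ker_psd {..<d * n} (\<lambda>i j. (complex_of_real (1/2) \<cdot>\<^sub>m P Zp + complex_of_real (1 - 1/2) \<cdot>\<^sub>m P Zm - P Z) $$ (i, j))"
    unfolding psd_mat_iff by blast
  then have "ker_psd ({..<d} \<times> {..<n}) (\<lambda>(a, s) (b, t). (complex_of_real (1/2) \<cdot>\<^sub>m P Zp + complex_of_real (1 - 1/2) \<cdot>\<^sub>m P Zm - P Z) $$ (a * n + s, b * n + t))"
    unfolding block_kernel .
  then have psd: "ker_psd ({..<d} \<times> {..<n}) (\<lambda>s t. of_real 2 * (\<lambda>(a, s) (b, t). (complex_of_real (1/2) \<cdot>\<^sub>m P Zp + complex_of_real (1 - 1/2) \<cdot>\<^sub>m P Zm - P Z) $$ (a * n + s, b * n + t)) s t)"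
    by (rule ker_psd_scale) simp
  have PG: "P G $$ (a * n + s, b * n + t) = poly_ker d p T G (a, h s) (b, h t)"
    if G: "\<And>l. ker_herm T (G l)" and as: "a < d" "s < n" "b < d" "t < n" for G a s b t
  proof -
    have "P G $$ (a * n + s, b * n + t) =
        (\<Sum>w\<in>fp_support d d p. p w $$ (a, b) * word_ker {..<n} (\<lambda>l s t. M G l $$ (s, t)) w s t)"
      unfolding P_def using fp_eval_poly_ker[OF p HX[OF G] as] by (simp add: poly_ker_def le)
    also have "\<dots> = (\<Sum>w\<in>fp_support d d p. p w $$ (a, b) * word_ker T G w (h s) (h t))"
    proof (rule sum.cong)
      fix w
      have "word_ker {..<n} (\<lambda>l s t. M G l $$ (s, t)) w s t = word_ker {..<n} (\<lambda>l s t. G l (h s) (h t)) w s t"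
        by (rule word_ker_cong) (use as in \<open>auto simp: M_def\<close>)
      also have "\<dots> = word_ker T G w (h s) (h t)" by (rule word_ker_reindex[OF h]) (use as in auto)
      finally show "p w $$ (a, b) * word_ker {..<n} (\<lambda>l s t. M G l $$ (s, t)) w s t = p w $$ (a, b) * word_ker T G w (h s) (h t)"
        by simp
    qed simp
    finally show ?thesis by (simp add: poly_ker_def)
  qed
  define h' where "h' = (\<lambda>(a::nat, s). (a, h s))"
  have h': "bij_betw h' ({..<d} \<times> {..<n}) ({..<d} \<times> T)"
    unfolding h'_def using bij_betw_map_prod[OF bij_betw_id h] by (simp add: map_prod_def id_def)
  let ?Q = "\<lambda>s t. poly_ker d p T Zp s t + poly_ker d p T Zm s t - 2 * poly_ker d p T Z s t"
  have "ker_psd ({..<d} \<times> {..<n}) (\<lambda>s t. ?Q (h' s) (h' t))"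
    using psd
  proof (rule ker_psd_cong[THEN iffD1, rotated])
    fix u v assume "u \<in> {..<d} \<times> {..<n}" "v \<in> {..<d} \<times> {..<n}"
    then obtain a s b t where uv: "u = (a, s)" "v = (b, t)" "a < d" "s < n" "b < d" "t < n" by auto
    show "of_real 2 * (\<lambda>(a, s) (b, t). (complex_of_real (1/2) \<cdot>\<^sub>m P Zp + complex_of_real (1 - 1/2) \<cdot>\<^sub>m P Zm - P Z) $$ (a * n + s, b * n + t)) u v = ?Q (h' u) (h' v)"
      unfolding uv(1,2) h'_def case_prod_conv PG[of Zp, OF HZp uv(3-6), symmetric]
        PG[of Zm, OF HZm uv(3-6), symmetric] PG[of Z, OF Z uv(3-6), symmetric]
      using block_index_less[OF uv(3,4)] block_index_less[OF uv(5,6)] by (simp add: Pdim)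
  qed
  then have "ker_psd ({..<d} \<times> T) ?Q" by (rule iffD1[OF ker_psd_reindex[OF h', of ?Q]])
  then show ?thesis unfolding Zp_def Zm_def .
qed

section \<open>Vanishing coefficients\<close>

fun is_x :: "'i letter \<Rightarrow> bool" where
  "is_x (Xv j) = True"
| "is_x (Yv k) = False"

abbreviation cnt :: "('a \<Rightarrow> bool) \<Rightarrow> 'a list \<Rightarrow> nat" where
  "cnt P w \<equiv> length (filter P w)"

abbreviation xdeg :: "'i word \<Rightarrow> nat" where "xdeg \<equiv> cnt is_x"
abbreviation ydeg :: "'i word \<Rightarrow> nat" where "ydeg \<equiv> cnt (\<lambda>l. \<not> is_x l)"

text \<open>Weighted adjacency kernel of the path with vertices 0, ..., \<open>length w\<close>,
  whose edge from \<open>i\<close> to \<open>Suc i\<close> has label \<open>w ! i\<close> and weight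
  \<open>e i\<close>. Each edge can be used in both directions, which makes the kernel hermitian. An
  entry of \<open>word_ker\<close> then sums the weights of the walks whose labels spell the
  word.\<close>

definition path_ker :: "'i word \<Rightarrow> (nat \<Rightarrow> real) \<Rightarrow> 'i letter \<Rightarrow> nat \<Rightarrow> nat \<Rightarrow> complex" where
  "path_ker w e l s t =
    (if t = Suc s \<and> s < length w \<and> w ! s = l then of_real (e s) else 0) +
    (if s = Suc t \<and> t < length w \<and> w ! t = l then of_real (e t) else 0)"

lemma path_ker_herm: "ker_herm T (path_ker w e l)"
  unfolding ker_herm_def path_ker_def by auto

lemma path_ker_add:
  "path_ker w (\<lambda>i. e i + e' i) = (\<lambda>l s t. path_ker w e l s t + path_ker w e' l s t)"
  unfolding path_ker_def by (intro ext) simp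

lemma path_ker_diff:
  "path_ker w (\<lambda>i. e i - e' i) = (\<lambda>l s t. path_ker w e l s t - path_ker w e' l s t)"
  unfolding path_ker_def by (intro ext) simp

lemma word_ker_path_Cons:
  assumes "s \<le> length w"
  shows "word_ker {..length w} (path_ker w e) (l # q) s t =
    (if s < length w \<and> w ! s = l then of_real (e s) * word_ker {..length w} (path_ker w e) q (Suc s) t else 0) +
    (if 0 < s \<and> w ! (s - 1) = l then of_real (e (s - 1)) * word_ker {..length w} (path_ker w e) q (s - 1) t else 0)"
proof -
  let ?W = "\<lambda>u. word_ker {..length w} (path_ker w e) q u t"
  have "word_ker {..length w} (path_ker w e) (l # q) s t =
      (\<Sum>u\<le>length w. (if u = Suc s then (if s < length w \<and> w ! s = l then of_real (e s) * ?W (Suc s) else 0) else 0))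
      + (\<Sum>u\<le>length w. (if u = s - 1 then (if 0 < s \<and> w ! (s - 1) = l then of_real (e (s - 1)) * ?W (s - 1) else 0) else 0))"
    unfolding word_ker.simps sum.distrib[symmetric] path_ker_def using assms
    by (intro sum.cong refl) (auto simp: algebra_simps)
  also have "\<dots> = (if s < length w \<and> w ! s = l then of_real (e s) * ?W (Suc s) else 0) +
      (if 0 < s \<and> w ! (s - 1) = l then of_real (e (s - 1)) * ?W (s - 1) else 0)"
    using assms by (auto simp: sum.delta)
  finally show ?thesis .
qed

lemma cnt_take_Suc: "s < length w \<Longrightarrow> cnt P (take (Suc s) w) = cnt P (take s w) + (if P (w ! s) then 1 else 0)"
  by (simp add: take_Suc_conv_app_nth)

lemma cnt_drop: "s < length w \<Longrightarrow> cnt P (drop s w) = (if P (w ! s) then 1 else 0) + cnt P (drop (Suc s) w)"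
  by (simp add: Cons_nth_drop_Suc[symmetric])

lemma add_ne_zero: "a + b \<noteq> (0::complex) \<Longrightarrow> a \<noteq> 0 \<or> b \<noteq> 0"
  by auto

lemma add_ne_add: "a + b \<noteq> a' + (b'::complex) \<Longrightarrow> a \<noteq> a' \<or> b \<noteq> b'"
  by auto

text \<open>A walk from \<open>s\<close> to the right end crosses each edge beyond \<open>s\<close>
  at least once and reads its label. The predicate \<open>P\<close> is free, so one may count
  x-letters, y-letters or all letters.\<close>

lemma word_ker_path_to_end:
  assumes "s \<le> length w" "word_ker {..length w} (path_ker w e) q s (length w) \<noteq> 0"
  shows "cnt P (drop s w) \<le> cnt P q"
  using assms
proof (induction q arbitrary: s)
  case (Cons l q)
  from add_ne_zero[OF Cons.prems(2)[unfolded word_ker_path_Cons[OF Cons.prems(1)]]]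
  consider "s < length w" "w ! s = l" "word_ker {..length w} (path_ker w e) q (Suc s) (length w) \<noteq> 0"
    | "0 < s" "w ! (s - 1) = l" "word_ker {..length w} (path_ker w e) q (s - 1) (length w) \<noteq> 0"
    by (auto split: if_splits)
  then show ?case
  proof cases
    case 1
    then show ?thesis using Cons.IH[of "Suc s"] cnt_drop[of s w P] by auto
  next
    case 2
    then obtain r where "s = Suc r" by (cases s) auto
    then show ?thesis using 2 Cons.IH[of r] Cons.prems(1) cnt_drop[of r w P] by auto
  qed
qed (simp split: if_splits)

lemma word_ker_path_to_start:
  assumes "s \<le> length w" "word_ker {..length w} (path_ker w e) q s 0 \<noteq> 0"
  shows "cnt P (take s w) \<le> cnt P q"
  using assms
proof (induction q arbitrary: s)
  case (Cons l q)
  from add_ne_zero[OF Cons.prems(2)[unfolded word_ker_path_Cons[OF Cons.prems(1)]]]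
  consider "s < length w" "w ! s = l" "word_ker {..length w} (path_ker w e) q (Suc s) 0 \<noteq> 0"
    | "0 < s" "w ! (s - 1) = l" "word_ker {..length w} (path_ker w e) q (s - 1) 0 \<noteq> 0"
    by (auto split: if_splits)
  then show ?case
  proof cases
    case 1
    then show ?thesis using Cons.IH[of "Suc s"] cnt_take_Suc[of s w P] by auto
  next
    case 2
    then obtain r where "s = Suc r" by (cases s) auto
    then show ?thesis using 2 Cons.IH[of r] Cons.prems(1) cnt_take_Suc[of r w P] by auto
  qed
qed (simp split: if_splits)

text \<open>With so few steps only the straight walk can reach the end, and its labels spell
  \<open>drop s w\<close>.\<close>

lemma word_ker_path_short:
  assumes "s \<le> length w" "length q \<le> length w - s"
  shows "word_ker {..length w} (path_ker w e) q s (length w) =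
    (if q = drop s w then of_real (\<Prod>i=s..<length w. e i) else 0)"
  using assms
proof (induction q arbitrary: s)
  case (Cons l q)
  have s: "s < length w" using Cons.prems by auto
  \<comment> \<open>After a step back, what is left of the word is too short to reach the
    end.\<close>
  have backward: "word_ker {..length w} (path_ker w e) q (s - 1) (length w) = 0" if "0 < s"
  proof (rule ccontr)
    assume "\<not> ?thesis"
    from word_ker_path_to_end[OF _ this, of "\<lambda>_. True"] have "length w - (s - 1) \<le> length q"
      using Cons.prems(1) by simp
    moreover have "Suc (length q) \<le> length w - s" using Cons.prems by simp
    ultimately show False using that Cons.prems(1) by linarith
  qed
  have "length q \<le> length w - Suc s" using Cons.prems(2) by simp
  then have IH: "word_ker {..length w} (path_ker w e) q (Suc s) (length w) =
      (if q = drop (Suc s) w then of_real (\<Prod>i=Suc s..<length w. e i) else 0)"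
    using Cons.IH[of "Suc s"] s by simp
  have "(l # q = drop s w) = (w ! s = l \<and> q = drop (Suc s) w)"
    using Cons_nth_drop_Suc[OF s] by (metis list.inject)
  moreover have "(\<Prod>i=s..<length w. e i) = e s * (\<Prod>i=Suc s..<length w. e i)"
    using s by (simp add: prod.atLeast_Suc_lessThan)
  ultimately show ?case
    unfolding word_ker_path_Cons[OF Cons.prems(1)] using s backward IH by auto
qed auto

text \<open>The two weightings agree on the edges before \<open>E\<close>, so a difference can only
  come from a walk that crosses edge \<open>E\<close> and returns to 0. It crosses the edges from
  \<open>s\<close> to \<open>E\<close> on the way out and all edges up to \<open>E\<close> on the
  way back.\<close>

lemma word_ker_path_closed:
  assumes "E < length w" "\<And>i. i < E \<Longrightarrow> e i = e' i" "s \<le> E"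
    and "word_ker {..length w} (path_ker w e) q s 0 \<noteq> word_ker {..length w} (path_ker w e') q s 0"
  shows "2 * cnt P (take (Suc E) w) \<le> cnt P q + cnt P (take s w)"
  using assms(3,4)
proof (induction q arbitrary: s)
  case (Cons l q)
  let ?W = "\<lambda>e s. word_ker {..length w} (path_ker w e) q s 0"
  have sw: "s \<le> length w" using Cons.prems assms(1) by simp
  from add_ne_add[OF Cons.prems(2)[unfolded word_ker_path_Cons[OF sw]]]
  consider "w ! s = l" "of_real (e s) * ?W e (Suc s) \<noteq> of_real (e' s) * ?W e' (Suc s)"
    | "0 < s" "w ! (s - 1) = l" "of_real (e (s - 1)) * ?W e (s - 1) \<noteq> of_real (e' (s - 1)) * ?W e' (s - 1)"
    by (auto split: if_splits)
  then show ?case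
  proof cases
    case 1
    show ?thesis
    proof (cases "s < E")
      case True
      then have "?W e (Suc s) \<noteq> ?W e' (Suc s)" using 1(2) assms(2) by auto
      then show ?thesis using Cons.IH[of "Suc s"] True assms(1) cnt_take_Suc[of s w P] 1(1) by auto
    next
      case False
      \<comment> \<open>Edge \<open>E\<close> is being crossed now, where the weights may differ, so
        the induction hypothesis is replaced by the count for the way back from \<open>Suc E\<close>
        to 0.\<close>
      then have sE: "s = E" using Cons.prems by simp
      have "?W e (Suc s) \<noteq> 0 \<or> ?W e' (Suc s) \<noteq> 0" using 1(2) by auto
      then have "cnt P (take (Suc s) w) \<le> cnt P q"
        using word_ker_path_to_start[of "Suc s" w] sE assms(1) by auto
      then show ?thesis using cnt_take_Suc[of s w P] sE assms(1) 1(1) by auto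
    qed
  next
    case 2
    then have "?W e (s - 1) \<noteq> ?W e' (s - 1)" using assms(2)[of "s - 1"] Cons.prems by auto
    moreover obtain r where "s = Suc r" using 2(1) by (cases s) auto
    ultimately show ?thesis
      using Cons.IH[of r] Cons.prems(1) 2(1) cnt_take_Suc[of r w P] assms(1) by auto
  qed
qed simp

text \<open>On the path graph with edges labelled by w, the entry of the second difference from one end to
  the other only sees the coefficient of w, while the diagonal entry at the start vanishes because
  no word of p is long enough to walk to the varied edges and back.\<close>

lemma convex_in_x_coeff_zero:
  fixes p :: "('i::finite) fpoly"
  assumes conv: "convex_in_x d p" and p: "is_fpoly d d p"
    and E: "E < E'" "E' < length w" "is_x (w ! E)" "is_x (w ! E')"
    and long: "\<And>q. q \<in> fp_support d d p \<Longrightarrow> length w < length q \<Longrightarrow> \<exists>P. cnt P q < cnt P w"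
    and closed: "\<And>q. q \<in> fp_support d d p \<Longrightarrow> \<exists>P. cnt P q < 2 * cnt P (take (Suc E) w)"
  shows "p w = 0\<^sub>m d d"
proof (rule ccontr)
  assume nz: "p w \<noteq> 0\<^sub>m d d"
  define T where "T = {..length w}"
  define m where "m = length w"
  \<comment> \<open>The varied weight sits on two edges labelled by x, so the straight walk has
    weight \<open>\<tau> * \<tau>\<close>: 1 for \<tau> = 1 and \<tau> = -1, and 0 at the midpoint.
    The second difference is then twice the coefficient of \<open>w\<close>.\<close>
  define e where "e = (\<lambda>\<tau> i. if i = E \<or> i = E' then \<tau> else (1::real))"
  define G where "G = (\<lambda>\<tau>. path_ker w (e \<tau>))"
  define D where "D = path_ker w (\<lambda>i. if i = E \<or> i = E' then 1 else 0)"
  have supp: "finite (fp_support d d p)" using p unfolding is_fpoly_def by blast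
  have GD: "(\<lambda>l s t. G 0 l s t + D l s t) = G 1" "(\<lambda>l s t. G 0 l s t - D l s t) = G (-1)"
    unfolding G_def D_def path_ker_add[symmetric] path_ker_diff[symmetric] e_def
    by (intro arg_cong[of _ _ "path_ker w"] ext; simp)+
  have Dy: "D (Yv k) s t = 0" for k s t
    using E unfolding D_def path_ker_def by auto
  have "ker_psd ({..<d} \<times> T) (\<lambda>s t. poly_ker d p T (G 1) s t + poly_ker d p T (G (-1)) s t - 2 * poly_ker d p T (G 0) s t)"
  proof -
    have h: "ker_herm T (G 0 l)" "ker_herm T (D l)" for l
      unfolding G_def D_def by (rule path_ker_herm)+
    have "finite T" "T \<noteq> {}" unfolding T_def by auto
    from convex_in_x_second_difference[of d p T "G 0" D, OF conv p this h Dy] show ?thesis unfolding GD .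
  qed
  moreover define Q where "Q = (\<lambda>s t. poly_ker d p T (G 1) s t + poly_ker d p T (G (-1)) s t - 2 * poly_ker d p T (G 0) s t)"
  ultimately have psd: "ker_psd ({..<d} \<times> T) Q" by simp
  have start: "word_ker T (G \<tau>) q 0 0 = word_ker T (G 0) q 0 0" if q: "q \<in> fp_support d d p" for q \<tau>
  proof (rule ccontr)
    assume ne: "\<not> ?thesis"
    have "2 * cnt P (take (Suc E) w) \<le> cnt P q + cnt P (take 0 w)" for P
      by (rule word_ker_path_closed[of E w "e \<tau>" "e 0"]) (use E ne in \<open>auto simp: G_def e_def T_def\<close>)
    then show False using closed[OF q] by (metis add.right_neutral filter.simps(1) list.size(3) not_le take0)
  qed
  have diag: "Q (a, 0) (a, 0) = 0" for a
  proof -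
    have "poly_ker d p T (G \<tau>) (a, 0) (a, 0) = poly_ker d p T (G 0) (a, 0) (a, 0)" for \<tau>
      unfolding poly_ker_def by (simp add: start[of _ \<tau>] cong: sum.cong)
    from this[of 1] this[of "-1"] show ?thesis unfolding Q_def by simp
  qed
  have cross: "word_ker T (G \<tau>) q 0 m = (if q = w then of_real (\<tau> * \<tau>) else 0)" if q: "q \<in> fp_support d d p" for q \<tau>
  proof (cases "length q \<le> length w")
    case True
    have "(\<Prod>i=0..<length w. e \<tau> i) = (\<Prod>i\<in>{E, E'}. e \<tau> i)"
      by (rule prod.mono_neutral_right) (use E in \<open>auto simp: e_def\<close>)
    also have "\<dots> = \<tau> * \<tau>" using E by (simp add: e_def)
    finally show ?thesis
      using word_ker_path_short[of 0 w q "e \<tau>"] True unfolding T_def m_def G_def by simp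
  next
    case False
    \<comment> \<open>A longer word of the support has too few letters of some kind to label a walk
      along the whole path.\<close>
    then obtain P where "cnt P q < cnt P w" using long[OF q] by auto
    then have "word_ker T (G \<tau>) q 0 m = 0"
      using word_ker_path_to_end[of 0 w "e \<tau>" q P] unfolding T_def m_def G_def by auto
    then show ?thesis using False by auto
  qed
  have pw: "w \<in> fp_support d d p" using nz unfolding fp_support_def by simp
  have "p w $$ (a, b) = 0" if ab: "a < d" "b < d" for a b
  proof -
    have "poly_ker d p T (G \<tau>) (a, 0) (b, m) = p w $$ (a, b) * of_real (\<tau> * \<tau>)" for \<tau>
    proof -
      have "poly_ker d p T (G \<tau>) (a, 0) (b, m) =
          (\<Sum>q\<in>fp_support d d p. if q = w then p w $$ (a, b) * of_real (\<tau> * \<tau>) else 0)"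
        unfolding poly_ker_def by (auto intro!: sum.cong simp: cross)
      then show ?thesis using supp pw by simp
    qed
    then have "Q (a, 0) (b, m) = 2 * p w $$ (a, b)" unfolding Q_def by simp
    moreover have "Q (a, 0) (b, m) = 0"
      by (rule ker_psd_zero_row[OF psd]) (use ab diag in \<open>auto simp: T_def m_def\<close>)
    ultimately show ?thesis by simp
  qed
  moreover have "p w \<in> carrier_mat d d" using p unfolding is_fpoly_def by blast
  ultimately have "p w = 0\<^sub>m d d" by (intro eq_matI) auto
  then show False using nz by simp
qed

text \<open>\<open>E\<close> is the last but one x of \<open>w\<close>, so the prefix ending there
  misses a single x. Going there and back costs \<open>2 * (xdeg w - 1)\<close> x-letters, which
  exceeds \<open>xdeg w\<close> once the degree is at least 3.\<close>

lemma last_two_x: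
  assumes "2 \<le> xdeg w"
  shows "\<exists>E E'. E < E' \<and> E' < length w \<and> is_x (w ! E) \<and> is_x (w ! E') \<and> Suc (xdeg (take (Suc E) w)) = xdeg w"
proof -
  have "filter is_x w \<noteq> []" using assms by auto
  then have "\<exists>x\<in>set w. is_x x" by (simp add: filter_empty_conv)
  then obtain u x z where w: "w = u @ x # z" "is_x x" "\<forall>y\<in>set z. \<not> is_x y"
    using split_list_last_prop[of w is_x] by blast
  have z0: "filter is_x z = []" using w(3) by (simp add: filter_empty_conv)
  then have "1 \<le> xdeg u" using assms w by simp
  then have "filter is_x u \<noteq> []" by auto
  then have "\<exists>x\<in>set u. is_x x" by (simp add: filter_empty_conv)
  then obtain u' x' z' where u: "u = u' @ x' # z'" "is_x x'" "\<forall>y\<in>set z'. \<not> is_x y"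
    using split_list_last_prop[of u is_x] by blast
  have z0': "filter is_x z' = []" using u(3) by (simp add: filter_empty_conv)
  show ?thesis
    by (rule exI[of _ "length u'"], rule exI[of _ "length u"]) (use w u z0 z0' in \<open>simp add: nth_append\<close>)
qed

text \<open>The path is labelled by a word \<open>v\<close> of the support of maximal x-degree and,
  among those, of maximal length. Longer words then have fewer x than \<open>v\<close>, and for
  degree at least 3 no word has enough x for the walk to the last two x and back.\<close>

lemma convex_in_x_xdeg:
  fixes p :: "('i::finite) fpoly"
  assumes conv: "convex_in_x d p" and p: "is_fpoly d d p" and w: "w \<in> fp_support d d p"
  shows "xdeg w \<le> 2"
proof (rule ccontr)
  assume w3: "\<not> xdeg w \<le> 2"
  have supp: "finite (fp_support d d p)" using p unfolding is_fpoly_def by blast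
  define Dx where "Dx = Max (xdeg ` fp_support d d p)"
  have Dx_ge: "xdeg q \<le> Dx" if "q \<in> fp_support d d p" for q
    unfolding Dx_def using supp that by simp
  have "Dx \<in> xdeg ` fp_support d d p" unfolding Dx_def using supp w by (intro Max_in) auto
  then have ne: "{q \<in> fp_support d d p. xdeg q = Dx} \<noteq> {}" by auto
  define S where "S = {q \<in> fp_support d d p. xdeg q = Dx}"
  have Sf: "finite S" "S \<noteq> {}" unfolding S_def using supp ne by auto
  have "Max (length ` S) \<in> length ` S" using Sf by (intro Max_in) auto
  then obtain v where v: "v \<in> S" "length v = Max (length ` S)" by auto
  have vmax: "length q \<le> length v" if "q \<in> S" for q using v(2) Sf that by simp
  have vD: "xdeg v = Dx" "v \<in> fp_support d d p" using v(1) unfolding S_def by auto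
  have D3: "3 \<le> Dx" using w3 Dx_ge[OF w] by simp
  obtain E E' where E: "E < E'" "E' < length v" "is_x (v ! E)" "is_x (v ! E')"
    "Suc (xdeg (take (Suc E) v)) = xdeg v"
    using last_two_x[of v] vD D3 by auto
  have "p v = 0\<^sub>m d d"
  proof (rule convex_in_x_coeff_zero[OF conv p E(1-4)])
    show "\<exists>P. cnt P q < cnt P v" if "q \<in> fp_support d d p" "length v < length q" for q
    proof -
      have "q \<notin> S" using vmax that(2) by force
      then have "xdeg q < xdeg v" using that(1) Dx_ge[OF that(1)] vD unfolding S_def by auto
      then show ?thesis by blast
    qed
    show "\<exists>P. cnt P q < 2 * cnt P (take (Suc E) v)" if "q \<in> fp_support d d p" for q
      using Dx_ge[OF that] E(5) vD D3 by (intro exI[of _ is_x]) linarith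
  qed
  then show False using vD unfolding fp_support_def by simp
qed

lemma xdeg_ydeg: "xdeg w + ydeg w = length w"
  by (rule sum_length_filter_compl)

text \<open>The varied edges are the two final x. The prefix up to the first of them contains both
  y, so a return trip would read four y-letters; words longer than four are excluded by the degree
  bounds.\<close>

lemma convex_in_x_yyxx:
  fixes p :: "('i::finite) fpoly"
  assumes conv: "convex_in_x d p" and p: "is_fpoly d d p"
    and deg: "\<And>w. w \<in> fp_support d d p \<Longrightarrow> xdeg w \<le> 2 \<and> ydeg w \<le> 2"
  shows "p [Yv k, Yv l, Xv i, Xv j] = 0\<^sub>m d d"
proof (rule convex_in_x_coeff_zero[OF conv p, of 2 3])
  show "\<exists>P. cnt P q < cnt P [Yv k, Yv l, Xv i, Xv j]"
    if "q \<in> fp_support d d p" "length [Yv k, Yv l, Xv i, Xv j] < length q" for q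
    using deg[OF that(1)] that(2) xdeg_ydeg[of q] by simp
  show "\<exists>P. cnt P q < 2 * cnt P (take (Suc 2) [Yv k, Yv l, Xv i, Xv j])" if "q \<in> fp_support d d p" for q
    using deg[OF that] by (intro exI[of _ "\<lambda>l. \<not> is_x l"]) simp
qed simp_all

section \<open>Testing convexity with Gram vectors\<close>

text \<open>Basis of the test space: coordinates of given vectors, a scaled orthonormal copy of the
  border words that makes these vectors independent, the cyclic vectors and their images under
  the y-letters.\<close>

datatype 'i gns = GF nat | GE "'i word" nat | GXi nat | GEta 'i nat

text \<open>The possible right halves \<open>v\<close> in a factorization rev u @ v of a word with
  two x and at most two y: each half carries one x and at most one y.\<close>

definition xborder :: "'i word set" where
  "xborder = range (\<lambda>j. [Xv j]) \<union> range (\<lambda>(j, k). [Xv j, Yv k]) \<union> range (\<lambda>(k, j). [Yv k, Xv j])"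

lemma xborder_cases:
  assumes "u \<in> xborder"
  obtains (x) j where "u = [Xv j]" | (xy) j k where "u = [Xv j, Yv k]" | (yx) k j where "u = [Yv k, Xv j]"
  using assms unfolding xborder_def by auto

lemma finite_xborder: "finite (xborder :: ('i::finite) word set)"
  unfolding xborder_def by simp

lemma xborderI [simp, intro]: "[Xv j] \<in> xborder" "[Xv j, Yv k] \<in> xborder" "[Yv k, Xv j] \<in> xborder"
  unfolding xborder_def by (auto intro: rev_image_eqI)

definition gbasis :: "nat \<Rightarrow> nat \<Rightarrow> ('i::finite) gns set" where
  "gbasis r d = GF ` {..<r} \<union> (\<lambda>(u, a). GE u a) ` (xborder \<times> {..<d}) \<union> GXi ` {..<d} \<union>
     (\<lambda>(k, a). GEta k a) ` (UNIV \<times> {..<d})"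

lemma finite_gbasis: "finite (gbasis r d)"
  unfolding gbasis_def using finite_xborder by auto

lemma gbasis_simps [simp]:
  "GF l \<in> gbasis r d \<longleftrightarrow> l < r"
  "GE u a \<in> gbasis r d \<longleftrightarrow> u \<in> xborder \<and> a < d"
  "GXi a \<in> gbasis r d \<longleftrightarrow> a < d"
  "GEta k a \<in> gbasis r d \<longleftrightarrow> a < d"
  unfolding gbasis_def by auto

text \<open>The vector of the border word \<open>u\<close> and the coordinate \<open>a\<close>: the
  given Gram vector, perturbed by \<open>\<epsilon>\<close> times a basis vector that belongs to (u,
  a) alone. The perturbed vectors are independent whatever \<open>f\<close> is.\<close>

fun gvec :: "real \<Rightarrow> ('i word \<Rightarrow> nat \<Rightarrow> nat \<Rightarrow> complex) \<Rightarrow> 'i word \<Rightarrow> nat \<Rightarrow> 'i gns \<Rightarrow> complex" where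
  "gvec \<epsilon> f u a (GF l) = f u a l"
| "gvec \<epsilon> f u a (GE v b) = (if v = u \<and> b = a then of_real \<epsilon> else 0)"
| "gvec \<epsilon> f u a (GXi b) = 0"
| "gvec \<epsilon> f u a (GEta k b) = 0"

text \<open>Half of a hermitian kernel, to be added to its adjoint. Column \<open>GXi a\<close> is
  the vector of x_j, column \<open>GEta k a\<close> that of x_j y_k. The rows \<open>GXi\<close> and
  \<open>GEta\<close> are zero, so the adjoint does not disturb these columns.\<close>

fun gX_half :: "real \<Rightarrow> ('i word \<Rightarrow> nat \<Rightarrow> nat \<Rightarrow> complex) \<Rightarrow> 'i \<Rightarrow> 'i gns \<Rightarrow> 'i gns \<Rightarrow> complex" where
  "gX_half \<epsilon> f j s (GXi a) = gvec \<epsilon> f [Xv j] a s"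
| "gX_half \<epsilon> f j s (GEta k a) = gvec \<epsilon> f [Xv j, Yv k] a s"
| "gX_half \<epsilon> f j s (GF l) = 0"
| "gX_half \<epsilon> f j s (GE u a) = 0"

text \<open>Together with its adjoint, this sends \<open>GXi b\<close> to \<open>GEta k b\<close>,
  and \<open>GE [Xv j] a\<close> to \<open>GE [Yv k, Xv j] a\<close> plus 1/\<epsilon> times the
  Gram vector of y_k x_j. On the vector of x_j, which contains \<epsilon> times
  \<open>GE [Xv j] a\<close>, this yields the vector of y_k x_j and unwanted \<open>GE\<close> terms
  caused by its Gram part, which the correction below cancels.\<close>

fun gY_half :: "real \<Rightarrow> ('i word \<Rightarrow> nat \<Rightarrow> nat \<Rightarrow> complex) \<Rightarrow> 'i \<Rightarrow> 'i gns \<Rightarrow> 'i gns \<Rightarrow> complex" where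
  "gY_half \<epsilon> f k (GEta k' a) (GXi b) = (if k' = k \<and> a = b then 1 else 0)"
| "gY_half \<epsilon> f k (GE u b) (GF l) = (if length u = 1 then of_real (1 / \<epsilon>) * cnj (f (Yv k # u) b l) else 0)"
| "gY_half \<epsilon> f k (GE u b) (GE v a) = (if u = Yv k # v \<and> a = b then 1 else 0)"
| "gY_half \<epsilon> f k _ _ = 0"

text \<open>The correction makes the y-kernel map the vector of x_j to that of y_k x_j; it is hermitian
  because the vectors have a Hankel Gram matrix.\<close>

fun gY_corr :: "nat \<Rightarrow> real \<Rightarrow> ('i word \<Rightarrow> nat \<Rightarrow> nat \<Rightarrow> complex) \<Rightarrow> 'i \<Rightarrow> 'i gns \<Rightarrow> 'i gns \<Rightarrow> complex" where
  "gY_corr r \<epsilon> f k (GE u b) (GE v a) =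
     (if length u = 1 \<and> length v = 1 then - of_real (1 / \<epsilon>\<^sup>2) * (\<Sum>l<r. f v a l * cnj (f (Yv k # u) b l)) else 0)"
| "gY_corr r \<epsilon> f k _ _ = 0"

fun gker :: "nat \<Rightarrow> real \<Rightarrow> ('i word \<Rightarrow> nat \<Rightarrow> nat \<Rightarrow> complex) \<Rightarrow> 'i letter \<Rightarrow> 'i gns \<Rightarrow> 'i gns \<Rightarrow> complex" where
  "gker r \<epsilon> f (Xv j) s t = gX_half \<epsilon> f j s t + cnj (gX_half \<epsilon> f j t s)"
| "gker r \<epsilon> f (Yv k) s t = gY_half \<epsilon> f k s t + cnj (gY_half \<epsilon> f k t s) + gY_corr r \<epsilon> f k s t"

lemma xborder_length_1: "u \<in> xborder \<Longrightarrow> length u = 1 \<Longrightarrow> \<exists>j. u = [Xv j]"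
  by (erule xborder_cases) auto

text \<open>The halves become hermitian by adding adjoints; only the correction needs an argument.
  Its symmetry is the Hankel relation: both inner products belong to the same word x_j y_k
  x_i.\<close>

lemma gker_herm:
  fixes f :: "('i::finite) word \<Rightarrow> nat \<Rightarrow> nat \<Rightarrow> complex"
  assumes hankel: "\<And>i j k a b. a < d \<Longrightarrow> b < d \<Longrightarrow>
    (\<Sum>l<r. cnj (f [Yv k, Xv j] a l) * f [Xv i] b l) = (\<Sum>l<r. cnj (f [Xv j] a l) * f [Yv k, Xv i] b l)"
  shows "ker_herm (gbasis r d) (gker r \<epsilon> f l)"
proof (cases l)
  case (Xv j)
  then show ?thesis unfolding ker_herm_def by (simp add: add.commute)
next
  case (Yv k)
  have corr: "gY_corr r \<epsilon> f k t s = cnj (gY_corr r \<epsilon> f k s t)" if mem: "s \<in> gbasis r d" "t \<in> gbasis r d" for s t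
  proof (cases "\<exists>u b v a. s = GE u b \<and> t = GE v a \<and> length u = 1 \<and> length v = 1")
    case True
    then obtain u b v a where st: "s = GE u b" "t = GE v a" "length u = 1" "length v = 1" by blast
    obtain i j where uv: "u = [Xv i]" "v = [Xv j]"
      using st mem xborder_length_1[of u] xborder_length_1[of v] by auto
    show ?thesis
      using hankel[of a b k j i] mem unfolding st uv by (simp add: mult.commute)
  next
    case False
    then show ?thesis by (cases s; cases t) auto
  qed
  show ?thesis unfolding ker_herm_def
  proof (intro ballI)
    fix s t :: "'i gns" assume st: "s \<in> gbasis r d" "t \<in> gbasis r d"
    show "gker r \<epsilon> f l t s = cnj (gker r \<epsilon> f l s t)"
      unfolding Yv gker.simps corr[OF st] by simp
  qed
qed

lemma sum_gvec:
  assumes "u \<in> xborder" "a < d"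
  shows "(\<Sum>t\<in>gbasis r d. F t * gvec \<epsilon> f u a t) = (\<Sum>l<r. F (GF l) * f u a l) + F (GE u a) * of_real \<epsilon>"
proof -
  have "(\<Sum>t\<in>gbasis r d. F t * gvec \<epsilon> f u a t) = (\<Sum>t\<in>insert (GE u a) (GF ` {..<r}). F t * gvec \<epsilon> f u a t)"
  proof (rule sum.mono_neutral_right)
    show "\<forall>t\<in>gbasis r d - insert (GE u a) (GF ` {..<r}). F t * gvec \<epsilon> f u a t = 0"
    proof
      fix t assume "t \<in> gbasis r d - insert (GE u a) (GF ` {..<r})"
      then show "F t * gvec \<epsilon> f u a t = 0" by (cases t) auto
    qed
  qed (use assms in \<open>auto simp: finite_gbasis\<close>)
  also have "\<dots> = (\<Sum>t\<in>GF ` {..<r}. F t * gvec \<epsilon> f u a t) + F (GE u a) * of_real \<epsilon>"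
    by (subst sum.insert) auto
  also have "(\<Sum>t\<in>GF ` {..<r}. F t * gvec \<epsilon> f u a t) = (\<Sum>l<r. F (GF l) * f u a l)"
    by (subst sum.reindex) (auto simp: inj_on_def)
  finally show ?thesis .
qed

lemma gker_X_Xi: "gker r \<epsilon> f (Xv j) s (GXi a) = gvec \<epsilon> f [Xv j] a s"
  by (cases s) auto

lemma gker_X_Eta: "gker r \<epsilon> f (Xv j) s (GEta k a) = gvec \<epsilon> f [Xv j, Yv k] a s"
  by (cases s) auto

lemma gker_Y_Xi: "gker r \<epsilon> f (Yv k) s (GXi a) = (if s = GEta k a then 1 else 0)"
  by (cases s) auto

text \<open>The critical coordinates are \<open>GE [Xv i] b\<close>: the Gram part of the vector
  contributes 1/\<epsilon> times an inner product there, and the correction contributes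
  -1/\<epsilon>^2 times the same inner product, multiplied by the component \<epsilon>.\<close>

lemma gker_Y_gvec:
  assumes "\<epsilon> > 0" "a < d" "s \<in> gbasis r d"
  shows "(\<Sum>t\<in>gbasis r d. gker r \<epsilon> f (Yv k) s t * gvec \<epsilon> f [Xv j] a t) = gvec \<epsilon> f [Yv k, Xv j] a s"
proof -
  have e: "complex_of_real \<epsilon> \<noteq> 0" using assms by simp
  have S: "(\<Sum>t\<in>gbasis r d. gker r \<epsilon> f (Yv k) s t * gvec \<epsilon> f [Xv j] a t) =
      (\<Sum>l<r. gker r \<epsilon> f (Yv k) s (GF l) * f [Xv j] a l) + gker r \<epsilon> f (Yv k) s (GE [Xv j] a) * of_real \<epsilon>"
    by (rule sum_gvec) (use assms in auto)
  show ?thesis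
  proof (cases s)
    case (GE u b)
    show ?thesis
    proof (cases "length u = 1")
      case True
      then obtain i where u: "u = [Xv i]" using xborder_length_1 assms(3) GE by auto
      have "(\<Sum>l<r. gker r \<epsilon> f (Yv k) s (GF l) * f [Xv j] a l)
          = of_real (1 / \<epsilon>) * (\<Sum>l<r. f [Xv j] a l * cnj (f [Yv k, Xv i] b l))"
        unfolding GE u sum_distrib_left by (intro sum.cong) simp_all
      moreover have "gker r \<epsilon> f (Yv k) s (GE [Xv j] a) * of_real \<epsilon> =
          - of_real (1 / \<epsilon>) * (\<Sum>l<r. f [Xv j] a l * cnj (f [Yv k, Xv i] b l))"
        unfolding GE u using e by (simp add: power2_eq_square)
      ultimately show ?thesis unfolding S unfolding GE u by simp
    next
      case False
      then show ?thesis unfolding S unfolding GE by auto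
    qed
  qed (unfold S, use e in auto)
qed

text \<open>The \<open>GXi a\<close> act as cyclic vectors: applying a border word to them recovers
  the vector of that word, as in a GNS representation.\<close>

lemma word_ker_gker:
  assumes "\<epsilon> > 0" "a < d" "u \<in> xborder" "s \<in> gbasis r d"
  shows "word_ker (gbasis r d) (gker r \<epsilon> f) u s (GXi a) = gvec \<epsilon> f u a s"
proof -
  have one: "word_ker (gbasis r d) (gker r \<epsilon> f) [l] t (GXi a) = gker r \<epsilon> f l t (GXi a)" for l t
    by (rule word_ker_single[OF finite_gbasis]) (use assms(2) in simp)
  have two: "word_ker (gbasis r d) (gker r \<epsilon> f) [l, l'] s (GXi a) =
      (\<Sum>t\<in>gbasis r d. gker r \<epsilon> f l s t * gker r \<epsilon> f l' t (GXi a))" for l l'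
    unfolding word_ker.simps(2)[of _ _ l] one ..
  show ?thesis using assms(3)
  proof (cases rule: xborder_cases)
    case (x j)
    then show ?thesis unfolding x one gker_X_Xi by simp
  next
    case (xy j k)
    have "(\<Sum>t\<in>gbasis r d. gker r \<epsilon> f (Xv j) s t * gker r \<epsilon> f (Yv k) t (GXi a)) =
        (\<Sum>t\<in>gbasis r d. if t = GEta k a then gker r \<epsilon> f (Xv j) s t else 0)"
      unfolding gker_Y_Xi by (intro sum.cong) auto
    also have "\<dots> = gker r \<epsilon> f (Xv j) s (GEta k a)" using assms(2) by (simp add: finite_gbasis)
    finally show ?thesis unfolding xy two gker_X_Eta .
  next
    case (yx k j)
    show ?thesis unfolding yx two gker_X_Xi by (rule gker_Y_gvec[OF assms(1,2,4)])
  qed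
qed

text \<open>By hermiticity, rev u can be moved to the left slot, which turns the entry into the
  inner product of the vectors of \<open>u\<close> and \<open>v\<close>. The excess
  \<open>\<epsilon>^2\<close> comes from the orthonormal perturbations.\<close>

lemma word_ker_gker_product:
  assumes "\<epsilon> > 0" "a < d" "b < d" "u \<in> xborder" "v \<in> xborder"
    and herm: "\<And>l. ker_herm (gbasis r d) (gker r \<epsilon> f l)"
  shows "word_ker (gbasis r d) (gker r \<epsilon> f) (rev u @ v) (GXi a) (GXi b) =
    (\<Sum>l<r. cnj (f u a l) * f v b l) + (if u = v \<and> a = b then of_real (\<epsilon>\<^sup>2) else 0)"
proof -
  let ?T = "gbasis r d" and ?Z = "gker r \<epsilon> f"
  have ab: "GXi a \<in> ?T" "GXi b \<in> ?T" using assms by auto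
  have "word_ker ?T ?Z (rev u @ v) (GXi a) (GXi b) = (\<Sum>t\<in>?T. cnj (gvec \<epsilon> f u a t) * gvec \<epsilon> f v b t)"
    unfolding word_ker_append[OF finite_gbasis ab(1)]
  proof (rule sum.cong)
    fix t :: "'a gns" assume t: "t \<in> ?T"
    show "word_ker ?T ?Z (rev u) (GXi a) t * word_ker ?T ?Z v t (GXi b) = cnj (gvec \<epsilon> f u a t) * gvec \<epsilon> f v b t"
      unfolding word_ker_rev[OF finite_gbasis herm ab(1) t] word_ker_gker[OF assms(1,2,4) t] word_ker_gker[OF assms(1,3,5) t] ..
  qed simp
  also have "\<dots> = (\<Sum>l<r. cnj (f u a l) * f v b l) + cnj (gvec \<epsilon> f u a (GE v b)) * of_real \<epsilon>"
    unfolding sum_gvec[OF assms(5,3), of "\<lambda>t. cnj (gvec \<epsilon> f u a t)"] by simp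
  finally show ?thesis by (auto simp: power2_eq_square)
qed

lemma word_ker_scale_x:
  assumes "\<And>j s t. Z' (Xv j) s t = c * Z (Xv j) s t" "\<And>k s t. Z' (Yv k) s t = Z (Yv k) s t"
  shows "word_ker T Z' w s t = c ^ xdeg w * word_ker T Z w s t"
proof (induction w arbitrary: s)
  case (Cons l w)
  show ?case by (cases l) (simp_all add: Cons assms sum_distrib_left ac_simps)
qed simp

text \<open>Second difference at X = 0 in the direction of X itself. A word of x-degree k is
  weighted by \<open>1 + (-1) ^ k - 2 * 0 ^ k\<close>, which is 0, 0, 2 for k = 0, 1, 2, so exactly
  the part of x-degree two survives.\<close>

lemma convex_in_x_xdeg_2_part:
  fixes p :: "('i::finite) fpoly" and T :: "'b set"
  assumes conv: "convex_in_x d p" and p: "is_fpoly d d p"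
    and T: "finite T" "T \<noteq> {}" and Z: "\<And>l. ker_herm T (Z l)"
    and deg: "\<And>w. w \<in> fp_support d d p \<Longrightarrow> xdeg w \<le> 2"
    and \<xi>: "\<And>a. a < d \<Longrightarrow> \<xi> a \<in> T"
  shows "0 \<le> Re (\<Sum>w\<in>{w \<in> fp_support d d p. xdeg w = 2}. \<Sum>a<d. \<Sum>b<d. p w $$ (a, b) * word_ker T Z w (\<xi> a) (\<xi> b))"
proof -
  have supp: "finite (fp_support d d p)" using p unfolding is_fpoly_def by blast
  define D where "D = (\<lambda>l s t. if is_x l then Z l s t else 0)"
  define Z0 where "Z0 = (\<lambda>l s t. if is_x l then 0 else Z l s t)"
  have HD: "ker_herm T (D l)" "ker_herm T (Z0 l)" for l
  proof -
    have zero: "ker_herm T (\<lambda>_ _. 0)" unfolding ker_herm_def by simp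
    have "D l = (if is_x l then Z l else (\<lambda>_ _. 0))" "Z0 l = (if is_x l then (\<lambda>_ _. 0) else Z l)"
      unfolding D_def Z0_def by auto
    then show "ker_herm T (D l)" "ker_herm T (Z0 l)" using Z[of l] zero by presburger+
  qed
  have Dy: "D (Yv k) s t = 0" for k s t unfolding D_def by simp
  define Q where "Q = (\<lambda>s t. poly_ker d p T (\<lambda>l s t. Z0 l s t + D l s t) s t
    + poly_ker d p T (\<lambda>l s t. Z0 l s t - D l s t) s t - 2 * poly_ker d p T Z0 s t)"
  have psd: "ker_psd ({..<d} \<times> T) Q"
    unfolding Q_def by (rule convex_in_x_second_difference[of d p T Z0 D, OF conv p T HD(2) HD(1) Dy])
  have W: "word_ker T (\<lambda>l s t. Z0 l s t + D l s t) w s t = word_ker T Z w s t"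
    "word_ker T (\<lambda>l s t. Z0 l s t - D l s t) w s t = (-1) ^ xdeg w * word_ker T Z w s t"
    "word_ker T Z0 w s t = 0 ^ xdeg w * word_ker T Z w s t" for w s t
    using word_ker_scale_x[of "\<lambda>l s t. Z0 l s t + D l s t" 1 Z] word_ker_scale_x[of "\<lambda>l s t. Z0 l s t - D l s t" "-1" Z]
      word_ker_scale_x[of Z0 0 Z] by (simp_all add: D_def Z0_def)
  have Q: "Q (a, s) (b, t) = (\<Sum>w\<in>fp_support d d p. if xdeg w = 2 then 2 * (p w $$ (a, b) * word_ker T Z w s t) else 0)" for a b s t
  proof -
    have "Q (a, s) (b, t) = (\<Sum>w\<in>fp_support d d p. p w $$ (a, b) * word_ker T Z w s t * (1 + (-1) ^ xdeg w - 2 * 0 ^ xdeg w))"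
      unfolding Q_def poly_ker_def W
      by (simp add: sum.distrib sum_subtractf sum_distrib_left algebra_simps)
    also have "\<dots> = (\<Sum>w\<in>fp_support d d p. if xdeg w = 2 then 2 * (p w $$ (a, b) * word_ker T Z w s t) else 0)"
    proof (rule sum.cong)
      fix w assume "w \<in> fp_support d d p"
      then have "xdeg w \<le> 2" by (rule deg)
      then have "xdeg w = 0 \<or> xdeg w = 1 \<or> xdeg w = 2" by linarith
      then show "p w $$ (a, b) * word_ker T Z w s t * (1 + (-1) ^ xdeg w - 2 * 0 ^ xdeg w) =
          (if xdeg w = 2 then 2 * (p w $$ (a, b) * word_ker T Z w s t) else 0)" by auto
    qed simp
    finally show ?thesis .
  qed
  \<comment> \<open>The test vector is the sum over \<open>a\<close> of the basis vectors e_a tensor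
    \<open>\<xi> a\<close>; pairing with it sums the selected entries over all \<open>a\<close> and
    \<open>b\<close>.\<close>
  define z where "z = (\<lambda>(a, t). if t = \<xi> a then 1 else (0::complex))"
  have "ker_form ({..<d} \<times> T) Q z = (\<Sum>a<d. \<Sum>b<d. Q (a, \<xi> a) (b, \<xi> b))"
  proof -
    have delta: "(\<Sum>s\<in>{..<d} \<times> T. if snd s = \<xi> (fst s) then g s else 0) = (\<Sum>a<d. g (a, \<xi> a))"
      for g :: "nat \<times> 'b \<Rightarrow> complex"
    proof -
      have "(\<Sum>s\<in>{..<d} \<times> T. if snd s = \<xi> (fst s) then g s else 0)
          = (\<Sum>a<d. \<Sum>t\<in>T. if t = \<xi> a then g (a, t) else 0)"
        by (subst sum.cartesian_product) (auto intro!: sum.cong)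
      also have "\<dots> = (\<Sum>a<d. g (a, \<xi> a))" using \<xi> T(1) by (intro sum.cong) auto
      finally show ?thesis .
    qed
    have "ker_form ({..<d} \<times> T) Q z =
        (\<Sum>s\<in>{..<d} \<times> T. if snd s = \<xi> (fst s) then (\<Sum>t\<in>{..<d} \<times> T. if snd t = \<xi> (fst t) then Q s t else 0) else 0)"
      unfolding ker_form_def z_def by (auto intro!: sum.cong simp: case_prod_unfold)
    then show ?thesis unfolding delta by simp
  qed
  also have "\<dots> = (\<Sum>w\<in>fp_support d d p. if xdeg w = 2 then 2 * (\<Sum>a<d. \<Sum>b<d. p w $$ (a, b) * word_ker T Z w (\<xi> a) (\<xi> b)) else 0)"
    unfolding Q
    by (subst sum.swap[of _ "fp_support d d p"], subst sum.swap[of _ "fp_support d d p"])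
      (auto intro!: sum.cong simp: sum_distrib_left)
  also have "\<dots> = 2 * (\<Sum>w\<in>{w \<in> fp_support d d p. xdeg w = 2}. \<Sum>a<d. \<Sum>b<d. p w $$ (a, b) * word_ker T Z w (\<xi> a) (\<xi> b))"
    unfolding sum.inter_filter[OF supp, symmetric] sum_distrib_left ..
  finally show ?thesis using ker_psdD[OF psd, of z] by simp
qed

text \<open>A functional on words that is a Gram matrix on border products is, up to
  \<open>\<epsilon>^2\<close>, given by entries of hermitian matrices. Convexity makes the perturbed
  value nonnegative for each \<epsilon>, and \<epsilon> tends to 0.\<close>

lemma convex_in_x_Gram_test:
  fixes p :: "('i::finite) fpoly" and r :: nat and f :: "'i word \<Rightarrow> nat \<Rightarrow> nat \<Rightarrow> complex"
  assumes conv: "convex_in_x d p" and p: "is_fpoly d d p"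
    and deg: "\<And>w. w \<in> fp_support d d p \<Longrightarrow> xdeg w \<le> 2"
    and split: "\<And>w. w \<in> fp_support d d p \<Longrightarrow> xdeg w = 2 \<Longrightarrow> \<exists>u\<in>xborder. \<exists>v\<in>xborder. w = rev u @ v"
    and V: "\<And>u v a b. u \<in> xborder \<Longrightarrow> v \<in> xborder \<Longrightarrow> a < d \<Longrightarrow> b < d \<Longrightarrow>
      V (rev u @ v) a b = (\<Sum>l<r. cnj (f u a l) * f v b l)"
  shows "0 \<le> Re (\<Sum>w\<in>{w \<in> fp_support d d p. xdeg w = 2}. \<Sum>a<d. \<Sum>b<d. p w $$ (a, b) * V w a b)"
    (is "0 \<le> Re ?S")
proof (cases "d = 0")
  case False
  define S where "S = {w \<in> fp_support d d p. xdeg w = 2}"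
  define M where "M = (\<Sum>w\<in>S. \<Sum>a<d. \<Sum>b<d. cmod (p w $$ (a, b)))"
  have M0: "0 \<le> M" unfolding M_def by (intro sum_nonneg) auto
  \<comment> \<open>Both sides are \<open>V\<close> at the word x_j y_k x_i, cut after and before
    y_k.\<close>
  have hankel: "(\<Sum>l<r. cnj (f [Yv k, Xv j] a l) * f [Xv i] b l) = (\<Sum>l<r. cnj (f [Xv j] a l) * f [Yv k, Xv i] b l)"
    if "a < d" "b < d" for i j k a b
    using V[of "[Yv k, Xv j]" "[Xv i]" a b] V[of "[Xv j]" "[Yv k, Xv i]" a b] that by simp
  have bound: "- (\<epsilon>\<^sup>2 * M) \<le> Re ?S" if e: "\<epsilon> > 0" for \<epsilon>
  proof -
    let ?T = "gbasis r d :: 'i gns set" and ?Z = "gker r \<epsilon> f"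
    have herm: "ker_herm ?T (?Z l)" for l by (rule gker_herm) (rule hankel)
    have Tne: "?T \<noteq> {}" using False gbasis_simps(3)[of 0 r d] by blast
    have "0 \<le> Re (\<Sum>w\<in>S. \<Sum>a<d. \<Sum>b<d. p w $$ (a, b) * word_ker ?T ?Z w (GXi a) (GXi b))"
      unfolding S_def
      by (rule convex_in_x_xdeg_2_part[OF conv p finite_gbasis Tne herm deg]) auto
    moreover have "cmod ((\<Sum>w\<in>S. \<Sum>a<d. \<Sum>b<d. p w $$ (a, b) * word_ker ?T ?Z w (GXi a) (GXi b))
        - (\<Sum>w\<in>S. \<Sum>a<d. \<Sum>b<d. p w $$ (a, b) * V w a b)) \<le> \<epsilon>\<^sup>2 * M"
    proof -
      have "cmod (p w $$ (a, b) * word_ker ?T ?Z w (GXi a) (GXi b) - p w $$ (a, b) * V w a b) \<le> \<epsilon>\<^sup>2 * cmod (p w $$ (a, b))"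
        if w: "w \<in> S" and ab: "a < d" "b < d" for w a b
      proof -
        obtain u v where uv: "u \<in> xborder" "v \<in> xborder" "w = rev u @ v"
          using split w unfolding S_def by blast
        have "word_ker ?T ?Z w (GXi a) (GXi b) - V w a b = (if u = v \<and> a = b then of_real (\<epsilon>\<^sup>2) else 0)"
          unfolding uv(3) word_ker_gker_product[OF e ab uv(1,2) herm] V[OF uv(1,2) ab] by simp
        then have "cmod (word_ker ?T ?Z w (GXi a) (GXi b) - V w a b) \<le> \<epsilon>\<^sup>2" by (simp add: norm_power)
        then show ?thesis
          unfolding right_diff_distrib[symmetric] norm_mult mult.commute[of "\<epsilon>\<^sup>2"]
          by (rule mult_left_mono) simp
      qed
      then show ?thesis
        unfolding sum_subtractf[symmetric] M_def sum_distrib_left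
        by (intro sum_norm_le) auto
    qed
    ultimately show ?thesis
      unfolding S_def[symmetric] using abs_Re_le_cmod[of "(\<Sum>w\<in>S. \<Sum>a<d. \<Sum>b<d. p w $$ (a, b) * word_ker ?T ?Z w (GXi a) (GXi b))
        - (\<Sum>w\<in>S. \<Sum>a<d. \<Sum>b<d. p w $$ (a, b) * V w a b)"] by simp
  qed
  show ?thesis
  proof (rule ccontr)
    assume "\<not> ?thesis"
    then have neg: "Re ?S < 0" by simp
    \<comment> \<open>The error \<open>\<epsilon>^2 * M\<close> is then at most half of
      \<open>- Re ?S\<close>; \<open>M + 1\<close> avoids a zero denominator.\<close>
    define \<epsilon> where "\<epsilon> = sqrt (- Re ?S / (2 * (M + 1)))"
    have pos: "- Re ?S / (2 * (M + 1)) > 0" using neg M0 by (intro divide_pos_pos) auto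
    have e: "\<epsilon> > 0" "\<epsilon>\<^sup>2 = - Re ?S / (2 * (M + 1))" unfolding \<epsilon>_def using pos by simp_all
    have "\<epsilon>\<^sup>2 * M \<le> \<epsilon>\<^sup>2 * (M + 1)" by (intro mult_left_mono) auto
    also have "\<dots> = - Re ?S / 2" unfolding e(2) using M0 by (simp add: field_simps)
    finally show False using bound[OF e(1)] neg by simp
  qed
qed simp

section \<open>The nearest positive semidefinite kernel\<close>

lemma nonpos_if_le_small:
  fixes a b :: real
  assumes "\<And>t. 0 < t \<Longrightarrow> t < 1 \<Longrightarrow> a \<le> t * b"
  shows "a \<le> 0"
proof (rule ccontr)
  assume a: "\<not> a \<le> 0"
  define t where "t = a / (2 * (a + \<bar>b\<bar>))"
  have t: "0 < t" "t < 1" unfolding t_def using a by (auto simp: field_simps)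
  have "t * b \<le> t * (a + \<bar>b\<bar>)" using a t by (intro mult_left_mono) auto
  also have "\<dots> = a / 2" unfolding t_def using a by (simp add: field_simps)
  finally show False using assms[OF t] a by simp
qed

text \<open>Tychonoff in the product topology. Freezing the coordinates outside \<open>A\<close> at
  0 lets kernels be treated as functions on the whole index type.\<close>

lemma compact_bounded_functions:
  fixes C :: real
  shows "compact (PiE UNIV (\<lambda>i. if i \<in> A then cball (0::complex) C else {0}))"
proof -
  have "compactin (product_topology (\<lambda>i. euclidean) UNIV) (PiE UNIV (\<lambda>i. if i \<in> A then cball (0::complex) C else {0}))"
    unfolding compactin_PiE by auto
  then show ?thesis unfolding euclidean_product_topology compactin_euclidean_iff .
qed

lemma continuous_on_coordinate: "continuous_on X (\<lambda>k::'s \<Rightarrow> complex. k i)"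
  by (rule continuous_on_subset[OF continuous_on_product_coordinates]) simp

lemma closed_ker_psd: "closed {k :: 's \<times> 's \<Rightarrow> complex. ker_psd S (\<lambda>s t. k (s, t))}"
  unfolding ker_psd_def ker_herm_def ker_form_def Ball_def
  by (intro closed_Collect_conj closed_Collect_all closed_Collect_imp closed_Collect_eq closed_Collect_le
      continuous_intros continuous_on_coordinate) auto

lemma sum_cmod_diff_square:
  "(\<Sum>j\<in>J. (cmod (e j - of_real t * c j))\<^sup>2) =
     (\<Sum>j\<in>J. (cmod (e j))\<^sup>2) - 2 * t * Re (\<Sum>j\<in>J. cnj (e j) * c j) + t\<^sup>2 * (\<Sum>j\<in>J. (cmod (c j))\<^sup>2)"
proof -
  have "(cmod (x - of_real t * y))\<^sup>2 = (cmod x)\<^sup>2 - 2 * t * Re (cnj x * y) + t\<^sup>2 * (cmod y)\<^sup>2" for x y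
    unfolding cmod_power2 by (simp add: algebra_simps power2_eq_square)
  then show ?thesis
    by (simp only: sum.distrib sum_subtractf sum_distrib_left Re_sum)
qed

text \<open>Least squares approximation of \<open>q\<close> by the values \<open>c K\<close> of the
  cone of positive semidefinite kernels. The minimum is attained because each diagonal entry is an
  equation of its own. The two final conjuncts are the first-order conditions: adding a multiple of
  \<open>K'\<close> gives the inequality, and rescaling \<open>K\<close> gives orthogonality of
  residual and approximant.\<close>

lemma ker_psd_nearest:
  fixes S :: "'s set" and J :: "'c set" and R :: "'c \<Rightarrow> ('s \<times> 's) set" and q :: "'c \<Rightarrow> complex"
  assumes S: "finite S" and J: "finite J" and R: "\<And>j. j \<in> J \<Longrightarrow> R j \<subseteq> S \<times> S"
    and diag: "\<And>s. s \<in> S \<Longrightarrow> \<exists>j\<in>J. R j = {(s, s)}"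
  defines "c \<equiv> \<lambda>K j. \<Sum>(s, t)\<in>R j. K s t"
  shows "\<exists>K. ker_psd S K \<and>
    (\<forall>K'. ker_psd S K' \<longrightarrow> Re (\<Sum>j\<in>J. cnj (q j - c K j) * c K' j) \<le> 0) \<and>
    Re (\<Sum>j\<in>J. cnj (q j - c K j) * q j) = (\<Sum>j\<in>J. (cmod (q j - c K j))\<^sup>2)"
proof -
  define \<Phi> where "\<Phi> = (\<lambda>K. \<Sum>j\<in>J. (cmod (q j - c K j))\<^sup>2)"
  define Z where "Z = (\<lambda>(_::'s) (_::'s). 0::complex)"
  \<comment> \<open>If \<open>K'\<close> does no worse than the zero kernel, then each single-entry
    equation puts \<open>K' s s\<close> within \<open>sqrt (\<Phi> Z)\<close> of its target, hence
    below \<open>C\<close>.\<close>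
  define C where "C = (\<Sum>j\<in>J. cmod (q j)) + sqrt (\<Phi> Z)"
  define \<K> where "\<K> = PiE UNIV (\<lambda>st. if st \<in> S \<times> S then cball (0::complex) C else {0}) \<inter>
      {k. ker_psd S (\<lambda>s t. k (s, t))}"
  have \<Phi>0: "0 \<le> \<Phi> K" for K unfolding \<Phi>_def by (intro sum_nonneg) auto
  have C0: "0 \<le> C" unfolding C_def using \<Phi>0[of Z] by (auto intro!: add_nonneg_nonneg sum_nonneg)
  have "compact \<K>"
    unfolding \<K>_def by (intro compact_Int_closed compact_bounded_functions closed_ker_psd)
  moreover have "(\<lambda>_. 0) \<in> \<K>"
    unfolding \<K>_def using C0 ker_psd_zero by auto
  moreover have "continuous_on \<K> (\<lambda>k. \<Phi> (\<lambda>s t. k (s, t)))"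
    unfolding \<Phi>_def c_def case_prod_unfold
    by (intro continuous_intros continuous_on_coordinate)
  ultimately obtain k where k: "k \<in> \<K>" and kmin: "\<And>k'. k' \<in> \<K> \<Longrightarrow> \<Phi> (\<lambda>s t. k (s, t)) \<le> \<Phi> (\<lambda>s t. k' (s, t))"
    using continuous_attains_inf[of \<K> "\<lambda>k. \<Phi> (\<lambda>s t. k (s, t))"] by blast
  define K where "K = (\<lambda>s t. k (s, t))"
  have psd: "ker_psd S K" using k unfolding \<K>_def K_def by simp
  have min0: "\<Phi> K \<le> \<Phi> Z"
    using kmin[OF \<open>(\<lambda>_. 0) \<in> \<K>\<close>] unfolding K_def Z_def .
  have min: "\<Phi> K \<le> \<Phi> K'" if K': "ker_psd S K'" for K'
  proof (cases "\<Phi> K' \<le> \<Phi> Z")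
    case False
    then show ?thesis using min0 by simp
  next
    case True
    have d: "Re (K' s s) \<le> C" if s: "s \<in> S" for s
    proof -
      obtain j where j: "j \<in> J" "R j = {(s, s)}" using diag[OF s] by blast
      have cj: "c K' j = K' s s" unfolding c_def j(2) by simp
      have "(cmod (q j - c K' j))\<^sup>2 \<le> \<Phi> K'" unfolding \<Phi>_def using J j(1) by (intro member_le_sum) auto
      then have "cmod (q j - K' s s) \<le> sqrt (\<Phi> Z)" using True cj by (intro real_le_rsqrt) simp
      moreover have "cmod (q j) \<le> (\<Sum>j\<in>J. cmod (q j))" using J j(1) by (intro member_le_sum) auto
      moreover have "Re (K' s s) \<le> cmod (q j) + cmod (q j - K' s s)"
        using complex_Re_le_cmod[of "K' s s"] norm_triangle_ineq2[of "K' s s" "q j"] norm_minus_commute[of "K' s s" "q j"]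
        by linarith
      ultimately show ?thesis unfolding C_def by linarith
    qed
    \<comment> \<open>Resetting the values off \<open>S\<close> to 0 puts the kernel into the
      compact set; neither positivity on \<open>S\<close> nor the equations see this change.\<close>
    define k' where "k' = (\<lambda>(s, t). if s \<in> S \<and> t \<in> S then K' s t else 0)"
    have kk: "ker_psd S (\<lambda>s t. k' (s, t))"
      by (rule ker_psd_cong[THEN iffD1, OF _ K']) (simp add: k'_def)
    have "cmod (K' s t) \<le> C" if "s \<in> S" "t \<in> S" for s t
      by (rule ker_psd_entry_le[OF K' S that d[OF that(1)] d[OF that(2)]])
    then have "k' \<in> \<K>" unfolding \<K>_def using kk by (auto simp: k'_def)
    then have "\<Phi> K \<le> \<Phi> (\<lambda>s t. k' (s, t))" unfolding K_def by (rule kmin)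
    also have "\<Phi> (\<lambda>s t. k' (s, t)) = \<Phi> K'"
    proof -
      have "c (\<lambda>s t. k' (s, t)) j = c K' j" if "j \<in> J" for j
        unfolding c_def using R[OF that] by (intro sum.cong) (auto simp: k'_def)
      then show ?thesis unfolding \<Phi>_def by simp
    qed
    finally show ?thesis .
  qed
  define e where "e = (\<lambda>j. q j - c K j)"
  have c_add: "c (\<lambda>s t. K s t + of_real r * K' s t) j = c K j + of_real r * c K' j" for K K' r j
    unfolding c_def by (simp add: case_prod_unfold sum.distrib sum_distrib_left)
  have perturb: "2 * r * Re (\<Sum>j\<in>J. cnj (e j) * c K' j) \<le> r\<^sup>2 * (\<Sum>j\<in>J. (cmod (c K' j))\<^sup>2)"
    if "ker_psd S (\<lambda>s t. K s t + of_real r * K' s t)" for r K'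
  proof -
    have "q j - (c K j + of_real r * c K' j) = e j - of_real r * c K' j" for j unfolding e_def by simp
    then have "\<Phi> (\<lambda>s t. K s t + of_real r * K' s t) = (\<Sum>j\<in>J. (cmod (e j - of_real r * c K' j))\<^sup>2)"
      unfolding \<Phi>_def c_add by (simp only:)
    then show ?thesis
      using min[OF that] unfolding sum_cmod_diff_square unfolding \<Phi>_def e_def by simp
  qed
  have opt: "Re (\<Sum>j\<in>J. cnj (e j) * c K' j) \<le> 0" if K': "ker_psd S K'" for K'
  proof (rule nonpos_if_le_small)
    fix t :: real assume t: "0 < t" "t < 1"
    have "t * (2 * Re (\<Sum>j\<in>J. cnj (e j) * c K' j)) \<le> t * (t * (\<Sum>j\<in>J. (cmod (c K' j))\<^sup>2))"
      using perturb[OF ker_psd_add_scale[OF psd K', of t]] t by (simp add: power2_eq_square mult.assoc mult.left_commute)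
    then have "2 * Re (\<Sum>j\<in>J. cnj (e j) * c K' j) \<le> t * (\<Sum>j\<in>J. (cmod (c K' j))\<^sup>2)"
      using t by (simp only: mult_le_cancel_left_pos)
    then show "Re (\<Sum>j\<in>J. cnj (e j) * c K' j) \<le> t * ((\<Sum>j\<in>J. (cmod (c K' j))\<^sup>2) / 2)" by simp
  qed
  define A where "A = Re (\<Sum>j\<in>J. cnj (e j) * c K j)"
  define B where "B = (\<Sum>j\<in>J. (cmod (c K j))\<^sup>2)"
  \<comment> \<open>The kernel (1 - t) K is still positive semidefinite for 0 < t < 1, so
    \<open>K\<close> may be perturbed in the direction -K; with \<open>opt\<close> this gives
    orthogonality.\<close>
  have "- A \<le> 0"
  proof (rule nonpos_if_le_small)
    fix t :: real assume t: "0 < t" "t < 1"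
    have "(\<lambda>s t'. K s t' + of_real (- t) * K s t') = (\<lambda>s t'. of_real (1 - t) * K s t')"
      by (intro ext) (simp add: algebra_simps)
    then have "ker_psd S (\<lambda>s t'. K s t' + of_real (- t) * K s t')"
      using ker_psd_scale[OF psd, of "1 - t"] t by simp
    then have "2 * (- t) * A \<le> (- t)\<^sup>2 * B" unfolding A_def B_def by (rule perturb)
    then have "t * (- (2 * A)) \<le> t * (t * B)"
      by (simp add: power2_eq_square mult.assoc mult.left_commute)
    then have "- (2 * A) \<le> t * B"
      using t by (simp only: mult_le_cancel_left_pos)
    then show "- A \<le> t * (B / 2)" by simp
  qed
  then have orth: "Re (\<Sum>j\<in>J. cnj (e j) * c K j) = 0" using opt[OF psd] unfolding A_def by simp
  have "(\<Sum>j\<in>J. cnj (e j) * q j) = (\<Sum>j\<in>J. cnj (e j) * e j) + (\<Sum>j\<in>J. cnj (e j) * c K j)"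
    unfolding e_def by (simp add: sum.distrib[symmetric] algebra_simps)
  moreover have "(\<Sum>j\<in>J. cnj (e j) * e j) = of_real (\<Sum>j\<in>J. (cmod (e j))\<^sup>2)"
    unfolding of_real_sum complex_norm_square by (simp add: mult.commute)
  ultimately have "Re (\<Sum>j\<in>J. cnj (e j) * q j) = (\<Sum>j\<in>J. (cmod (e j))\<^sup>2)"
    using orth by simp
  then show ?thesis using psd opt unfolding e_def by blast
qed

section \<open>Exchanging the variables\<close>

fun swap_letter :: "'i letter \<Rightarrow> 'i letter" where
  "swap_letter (Xv j) = Yv j"
| "swap_letter (Yv k) = Xv k"

abbreviation swap_word :: "'i word \<Rightarrow> 'i word" where
  "swap_word \<equiv> map swap_letter"

lemma swap_letter_idem [simp]: "swap_letter (swap_letter l) = l"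
  by (cases l) auto

lemma swap_letter_comp [simp]: "swap_letter \<circ> swap_letter = id"
  by auto

lemma swap_word_idem: "swap_word (swap_word w) = w"
  by simp

lemma is_x_swap [simp]: "is_x (swap_letter l) = (\<not> is_x l)"
  by (cases l) auto

lemma is_x_swap_comp [simp]:
  "is_x \<circ> swap_letter = (\<lambda>l. \<not> is_x l)" "(\<lambda>l. \<not> is_x l) \<circ> swap_letter = is_x"
  by auto

lemma bij_swap_support:
  "bij_betw swap_word (fp_support N d (\<lambda>w. p (swap_word w))) (fp_support N d p)"
  by (rule bij_betwI[where g = swap_word]) (auto simp: fp_support_def)

lemma is_fpoly_swap:
  assumes "is_fpoly N d p"
  shows "is_fpoly N d (\<lambda>w. p (swap_word w))"
  using assms bij_betw_finite[OF bij_swap_support[of N d p]] unfolding is_fpoly_def by simp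

lemma word_eval_swap: "word_eval n X Y (swap_word w) = word_eval n Y X w"
proof (induction w)
  case (Cons l w)
  then show ?case by (cases l) auto
qed simp

lemma fp_eval_swap: "fp_eval N d (\<lambda>w. p (swap_word w)) n X Y = fp_eval N d p n Y X"
proof -
  have "(\<Sum>w\<in>fp_support N d (\<lambda>w. p (swap_word w)). kron (p (swap_word w)) (word_eval n X Y w) $$ ij) =
      (\<Sum>w\<in>fp_support N d p. kron (p w) (word_eval n Y X w) $$ ij)" for ij
    using sum.reindex_bij_betw[OF bij_swap_support[of N d p], of "\<lambda>w. kron (p w) (word_eval n Y X w) $$ ij"]
    by (simp add: word_eval_swap)
  then show ?thesis unfolding fp_eval_def mat_sum_def by simp
qed

lemma convex_in_x_swap:
  assumes "convex_in_y d p"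
  shows "convex_in_x d (\<lambda>w. p (swap_word w))"
  using assms unfolding convex_in_x_def convex_in_y_def fp_eval_swap by blast

lemma convex_in_y_ydeg:
  fixes p :: "('i::finite) fpoly"
  assumes "convex_in_y d p" "is_fpoly d d p" "w \<in> fp_support d d p"
  shows "ydeg w \<le> 2"
proof -
  have "swap_word w \<in> fp_support d d (\<lambda>w. p (swap_word w))"
    using assms(3) unfolding fp_support_def by simp
  from convex_in_x_xdeg[OF convex_in_x_swap[OF assms(1)] is_fpoly_swap[OF assms(2)] this]
  show ?thesis by simp
qed

definition yborder :: "'i word set" where
  "yborder = swap_word ` xborder"

lemma yborder_cases:
  assumes "u \<in> yborder"
  obtains (y) k where "u = [Yv k]" | (xy) j k where "u = [Xv j, Yv k]" | (yx) k j where "u = [Yv k, Xv j]"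
  using assms unfolding yborder_def xborder_def by auto

lemma yborderI [simp, intro]: "[Yv k] \<in> yborder" "[Xv j, Yv k] \<in> yborder" "[Yv k, Xv j] \<in> yborder"
proof -
  have "swap_word [Xv k] \<in> yborder" "swap_word [Yv j, Xv k] \<in> yborder" "swap_word [Xv k, Yv j] \<in> yborder"
    unfolding yborder_def by blast+
  then show "[Yv k] \<in> yborder" "[Xv j, Yv k] \<in> yborder" "[Yv k, Xv j] \<in> yborder" by simp_all
qed

lemma convex_in_y_Gram_test:
  fixes p :: "('i::finite) fpoly" and r :: nat and f :: "'i word \<Rightarrow> nat \<Rightarrow> nat \<Rightarrow> complex"
  assumes conv: "convex_in_y d p" and p: "is_fpoly d d p"
    and deg: "\<And>w. w \<in> fp_support d d p \<Longrightarrow> ydeg w \<le> 2"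
    and split: "\<And>w. w \<in> fp_support d d p \<Longrightarrow> ydeg w = 2 \<Longrightarrow> \<exists>u\<in>yborder. \<exists>v\<in>yborder. w = rev u @ v"
    and V: "\<And>u v a b. u \<in> yborder \<Longrightarrow> v \<in> yborder \<Longrightarrow> a < d \<Longrightarrow> b < d \<Longrightarrow>
      V (rev u @ v) a b = (\<Sum>l<r. cnj (f u a l) * f v b l)"
  shows "0 \<le> Re (\<Sum>w\<in>{w \<in> fp_support d d p. ydeg w = 2}. \<Sum>a<d. \<Sum>b<d. p w $$ (a, b) * V w a b)"
proof -
  let ?p = "\<lambda>w. p (swap_word w)"
  have supp: "swap_word w \<in> fp_support d d p" if "w \<in> fp_support d d ?p" for w
    using that unfolding fp_support_def by simp
  have "0 \<le> Re (\<Sum>w\<in>{w \<in> fp_support d d ?p. xdeg w = 2}. \<Sum>a<d. \<Sum>b<d. ?p w $$ (a, b) * V (swap_word w) a b)"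
  proof (rule convex_in_x_Gram_test[OF convex_in_x_swap[OF conv] is_fpoly_swap[OF p],
        where V = "\<lambda>w. V (swap_word w)" and r = r and f = "\<lambda>u. f (swap_word u)"])
    fix w assume w: "w \<in> fp_support d d ?p"
    show "xdeg w \<le> 2" using deg[OF supp[OF w]] by simp
    assume "xdeg w = 2"
    then obtain u v where "u \<in> yborder" "v \<in> yborder" "swap_word w = rev u @ v"
      using split[OF supp[OF w]] by auto
    then obtain u' v' where uv: "u' \<in> xborder" "v' \<in> xborder" "swap_word w = rev (swap_word u') @ swap_word v'"
      unfolding yborder_def by auto
    have "w = rev u' @ v'"
      using arg_cong[OF uv(3), of swap_word] by (simp add: rev_map)
    then show "\<exists>u\<in>xborder. \<exists>v\<in>xborder. w = rev u @ v" using uv by blast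
  next
    fix u v :: "'i word" and a b assume "u \<in> xborder" "v \<in> xborder" "a < d" "b < d"
    then show "V (swap_word (rev u @ v)) a b = (\<Sum>l<r. cnj (f (swap_word u) a l) * f (swap_word v) b l)"
      using V[of "swap_word u" "swap_word v" a b] unfolding yborder_def by (simp add: rev_map)
  qed
  also have "(\<Sum>w\<in>{w \<in> fp_support d d ?p. xdeg w = 2}. \<Sum>a<d. \<Sum>b<d. ?p w $$ (a, b) * V (swap_word w) a b)
      = (\<Sum>w\<in>{w \<in> fp_support d d p. ydeg w = 2}. \<Sum>a<d. \<Sum>b<d. p w $$ (a, b) * V w a b)"
    by (rule sum.reindex_bij_witness[of _ swap_word swap_word]) (auto simp: fp_support_def)
  finally show ?thesis .
qed

text \<open>Such a word has length 2, 3 or 4. A cut between the two x leaving at most two letters on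
  each side does the job; for length 4 this must be the middle cut, and it fails precisely when both
  x lie on the same side.\<close>

lemma xdeg_2_split:
  assumes "xdeg w = 2" "ydeg w \<le> 2"
  shows "(\<exists>u\<in>xborder. \<exists>v\<in>xborder. w = rev u @ v) \<or>
    (\<exists>i j k l. w = [Xv i, Xv j, Yv k, Yv l]) \<or> (\<exists>i j k l. w = [Yv k, Yv l, Xv i, Xv j])"
proof -
  have sp: "\<exists>u\<in>xborder. \<exists>v\<in>xborder. w = rev u @ v" if "rev (take k w) \<in> xborder" "drop k w \<in> xborder" for k
    using that by (metis append_take_drop_id rev_rev_ident)
  have len: "length w = 2 + ydeg w" using xdeg_ydeg[of w] assms by simp
  then consider "length w = 2" | "length w = 3" | "length w = 4" using assms(2) by linarith
  then show ?thesis
  proof cases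
    case 1
    then obtain a b where w: "w = [a, b]" by (auto simp: length_Suc_conv numeral_eq_Suc)
    show ?thesis using assms sp[of 1] unfolding w by (cases a; cases b) auto
  next
    case 2
    then obtain a b c where w: "w = [a, b, c]" by (auto simp: length_Suc_conv numeral_eq_Suc)
    show ?thesis using assms sp[of 1] sp[of 2] unfolding w by (cases a; cases b; cases c) auto
  next
    case 3
    then obtain a b c e where w: "w = [a, b, c, e]" by (auto simp: length_Suc_conv numeral_eq_Suc)
    show ?thesis using assms sp[of 2] unfolding w by (cases a; cases b; cases c; cases e) auto
  qed
qed

lemma hermitian_fpoly_index:
  assumes "hermitian_fpoly d p" "a < d" "b < d"
  shows "p (rev w) $$ (b, a) = cnj (p w $$ (a, b))"
proof -
  have c: "p v \<in> carrier_mat d d" for v using assms(1) unfolding hermitian_fpoly_def is_fpoly_def by blast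
  have "p (rev w) = mat_adjoint (p w)"
    using fun_cong[OF conjunct2[OF assms(1)[unfolded hermitian_fpoly_def]], of "rev w"]
    unfolding fp_adjoint_def by simp
  then show ?thesis using c[of w] assms(2,3) by auto
qed

lemma hermitian_fpoly_rev_zero:
  assumes "hermitian_fpoly d p" "p (rev w) = 0\<^sub>m d d"
  shows "p w = 0\<^sub>m d d"
proof (rule eq_matI)
  have c: "p w \<in> carrier_mat d d" using assms(1) unfolding hermitian_fpoly_def is_fpoly_def by blast
  then show "dim_row (p w) = dim_row (0\<^sub>m d d)" "dim_col (p w) = dim_col (0\<^sub>m d d)" by auto
  fix a b assume "a < dim_row (0\<^sub>m d d :: complex mat)" "b < dim_col (0\<^sub>m d d :: complex mat)"
  then show "p w $$ (a, b) = 0\<^sub>m d d $$ (a, b)"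
    using hermitian_fpoly_index[OF assms(1), of a b w] assms(2) by simp
qed

text \<open>Convexity in x excludes y y x x, and hermitian symmetry then excludes its reversal x x y
  y; these are the only words within the degree bounds for which the cut fails. The y-statements
  follow by exchanging the variables.\<close>

lemma separately_convex_support:
  fixes p :: "('i::finite) fpoly"
  assumes herm: "hermitian_fpoly d p" and conv: "separately_convex d p" and w: "w \<in> fp_support d d p"
  shows "xdeg w \<le> 2" "ydeg w \<le> 2"
    and "xdeg w = 2 \<Longrightarrow> \<exists>u\<in>xborder. \<exists>v\<in>xborder. w = rev u @ v"
    and "ydeg w = 2 \<Longrightarrow> \<exists>u\<in>yborder. \<exists>v\<in>yborder. w = rev u @ v"
proof -
  have p: "is_fpoly d d p" using herm unfolding hermitian_fpoly_def by blast
  have cx: "convex_in_x d p" and cy: "convex_in_y d p" using conv unfolding separately_convex_def by auto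
  have deg: "xdeg v \<le> 2 \<and> ydeg v \<le> 2" if "v \<in> fp_support d d p" for v
    using convex_in_x_xdeg[OF cx p that] convex_in_y_ydeg[OF cy p that] by simp
  show d: "xdeg w \<le> 2" "ydeg w \<le> 2" using deg[OF w] by auto
  have yyxx: "p [Yv k, Yv l, Xv i, Xv j] = 0\<^sub>m d d" for i j k l
    by (rule convex_in_x_yyxx[OF cx p deg])
  have xxyy: "p [Xv i, Xv j, Yv k, Yv l] = 0\<^sub>m d d" for i j k l
    using hermitian_fpoly_rev_zero[OF herm, of "[Xv i, Xv j, Yv k, Yv l]"] yyxx by simp
  show "\<exists>u\<in>xborder. \<exists>v\<in>xborder. w = rev u @ v" if "xdeg w = 2"
    using xdeg_2_split[OF that d(2)] w yyxx xxyy unfolding fp_support_def by auto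
  assume yd: "ydeg w = 2"
  have "(\<exists>u\<in>xborder. \<exists>v\<in>xborder. swap_word w = rev u @ v) \<or>
    (\<exists>i j k l. swap_word w = [Xv i, Xv j, Yv k, Yv l]) \<or> (\<exists>i j k l. swap_word w = [Yv k, Yv l, Xv i, Xv j])"
    by (rule xdeg_2_split) (use yd d in auto)
  moreover have "swap_word w = v \<longleftrightarrow> w = swap_word v" for v
    by (metis swap_word_idem)
  ultimately have "\<exists>u\<in>xborder. \<exists>v\<in>xborder. w = swap_word (rev u @ v)"
    using w yyxx xxyy unfolding fp_support_def by auto
  then show "\<exists>u\<in>yborder. \<exists>v\<in>yborder. w = rev u @ v"
    unfolding yborder_def by (auto simp: rev_map[symmetric] map_append)
qed

section \<open>A Gram kernel for separately convex polynomials\<close>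

definition border :: "'i word set" where
  "border = xborder \<union> yborder"

lemma finite_border: "finite (border :: ('i::finite) word set)"
  unfolding border_def yborder_def using finite_xborder by blast

lemma border_length: "u \<in> border \<Longrightarrow> length u = 1 \<or> length u = 2"
  unfolding border_def by (auto elim!: xborder_cases yborder_cases)

lemma border_deg: "u \<in> border \<Longrightarrow> xdeg u \<le> 1 \<and> ydeg u \<le> 1"
  unfolding border_def by (auto elim!: xborder_cases yborder_cases)

lemma xborder_xdeg: "u \<in> xborder \<Longrightarrow> xdeg u = 1"
  by (auto elim!: xborder_cases)

lemma yborder_ydeg: "u \<in> yborder \<Longrightarrow> ydeg u = 1"
  by (auto elim!: yborder_cases)

lemma xborder_length_2: "length u = 2 \<Longrightarrow> u \<in> xborder \<longleftrightarrow> u \<in> yborder"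
  by (auto elim!: xborder_cases yborder_cases)

text \<open>The words that may not occur in an xy-pencil. Only their coefficients have to be matched
  by the square, since the pencil absorbs all others.\<close>

definition quad_word :: "'i word \<Rightarrow> bool" where
  "quad_word w \<longleftrightarrow> 2 \<le> xdeg w \<or> 2 \<le> ydeg w"

definition prod_index :: "('i word \<times> nat) \<times> ('i word \<times> nat) \<Rightarrow> 'i word \<times> nat \<times> nat" where
  "prod_index = (\<lambda>((u, a), (v, b)). (rev u @ v, a, b))"

text \<open>The fibre of the multiplication map: all entries of a kernel on border words that
  contribute to the coefficient (a, b) of a given word.\<close>

definition factor_pairs :: "nat \<Rightarrow> 'i word \<times> nat \<times> nat \<Rightarrow> (('i word \<times> nat) \<times> ('i word \<times> nat)) set" where
  "factor_pairs d j = {st \<in> (border \<times> {..<d}) \<times> (border \<times> {..<d}). prod_index st = j}"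

lemma quad_word_product: "quad_word (rev u @ v) \<longleftrightarrow> quad_word (rev v @ u)"
  unfolding quad_word_def by (simp add: rev_filter[symmetric] add.commute)

lemma separately_convex_quad_word:
  fixes p :: "('i::finite) fpoly"
  assumes herm: "hermitian_fpoly d p" and conv: "separately_convex d p"
    and w: "w \<in> fp_support d d p" "quad_word w"
  shows "\<exists>u\<in>border. \<exists>v\<in>border. w = rev u @ v" and "xdeg w = 2 \<or> ydeg w = 2"
proof -
  note sc = separately_convex_support[OF herm conv w(1)]
  show *: "xdeg w = 2 \<or> ydeg w = 2" using sc(1,2) w(2) unfolding quad_word_def by linarith
  show "\<exists>u\<in>border. \<exists>v\<in>border. w = rev u @ v"
    using * sc(3,4) unfolding border_def by blast
qed

text \<open>Border words have length 1 or 2, so a product of length 2 or 4 can only be cut in the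
  middle.\<close>

lemma factor_pairs_diag:
  assumes "u \<in> border" "a < d"
  shows "factor_pairs d (rev u @ u, a, a) = {((u, a), (u, a))}"
proof -
  have "u' = u \<and> v' = u" if "u' \<in> border" "v' \<in> border" "rev u' @ v' = rev u @ u" for u' v' :: "'a word"
  proof -
    have "length u' + length v' = length u + length u"
      using arg_cong[OF that(3), of length] by simp
    then have "length u' = length u"
      using border_length[OF that(1)] border_length[OF that(2)] border_length[OF assms(1)] by linarith
    then show ?thesis using that(3) by simp
  qed
  then show ?thesis using assms unfolding factor_pairs_def prod_index_def by auto
qed

text \<open>The convexity in x tests the part of the dual kernel supported away from the words y, and
  the convexity in y the remaining part; no entry links a word x to a word y, so the dual kernel
  splits into two such positive semidefinite parts.\<close>

lemma separately_convex_Gram: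
  fixes p :: "('i::finite) fpoly"
  assumes herm: "hermitian_fpoly d p" and conv: "separately_convex d p"
  shows "\<exists>K. ker_psd (border \<times> {..<d}) K \<and>
    (\<forall>w a b. quad_word w \<longrightarrow> a < d \<longrightarrow> b < d \<longrightarrow> p w $$ (a, b) = (\<Sum>(s, t)\<in>factor_pairs d (w, a, b). K s t))"
proof -
  have p: "is_fpoly d d p" using herm unfolding hermitian_fpoly_def by blast
  have cx: "convex_in_x d p" and cy: "convex_in_y d p" using conv unfolding separately_convex_def by auto
  have supp: "finite (fp_support d d p)" using p unfolding is_fpoly_def by blast
  define S where "S = (border :: 'i word set) \<times> {..<d}"
  define P where "P = {(s, t). s \<in> S \<and> t \<in> S \<and> quad_word (rev (fst s) @ fst t)}"
  \<comment> \<open>One equation for each quadratic product of two border words and each pair of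
    coordinates, with the coefficient of \<open>p\<close> as target.\<close>
  define J where "J = prod_index ` P"
  define q where "q = (\<lambda>(w, a, b). p w $$ (a, b))"
  have S: "finite S" unfolding S_def using finite_border by blast
  have PS: "P \<subseteq> S \<times> S" unfolding P_def by auto
  have P: "finite P" by (rule finite_subset[OF PS]) (use S in auto)
  have J: "finite J" unfolding J_def using P by blast
  have diag: "\<exists>j\<in>J. factor_pairs d j = {(s, s)}" if s: "s \<in> S" for s
  proof -
    obtain u a where ua: "s = (u, a)" "u \<in> border" "a < d" using s unfolding S_def by auto
    have "(s, s) \<in> P"
      using s ua xborder_xdeg[of u] yborder_ydeg[of u] unfolding P_def quad_word_def border_def
      by (auto simp: rev_filter[symmetric])
    then have "prod_index (s, s) \<in> J" unfolding J_def by blast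
    then show ?thesis using factor_pairs_diag[OF ua(2,3)] unfolding ua(1) prod_index_def by auto
  qed
  have sub: "factor_pairs d j \<subseteq> S \<times> S" for j unfolding factor_pairs_def S_def by auto
  obtain K where K: "ker_psd S K"
    and opt: "\<And>K'. ker_psd S K' \<Longrightarrow>
      Re (\<Sum>j\<in>J. cnj (q j - (\<Sum>(s, t)\<in>factor_pairs d j. K s t)) * (\<Sum>(s, t)\<in>factor_pairs d j. K' s t)) \<le> 0"
    and norm: "Re (\<Sum>j\<in>J. cnj (q j - (\<Sum>(s, t)\<in>factor_pairs d j. K s t)) * q j) =
      (\<Sum>j\<in>J. (cmod (q j - (\<Sum>(s, t)\<in>factor_pairs d j. K s t)))\<^sup>2)"
    using ker_psd_nearest[OF S J sub diag, of q] by blast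
  define e where "e = (\<lambda>j. q j - (\<Sum>(s, t)\<in>factor_pairs d j. K s t))"
  have opt_e: "Re (\<Sum>j\<in>J. cnj (e j) * (\<Sum>(s, t)\<in>factor_pairs d j. K' s t)) \<le> 0" if "ker_psd S K'" for K'
    using opt[OF that] unfolding e_def .
  \<comment> \<open>Minus the residual, pulled back along multiplication. It is a Hankel kernel on
    the constrained pairs, and the choice 0 for the remaining pairs is what keeps x-letters and
    y-letters unlinked.\<close>
  define \<rho> where "\<rho> = (\<lambda>s t. if (s, t) \<in> P then - e (prod_index (s, t)) else 0)"
  have in_P: "((u, a), (v, b)) \<in> P" if "u \<in> border" "v \<in> border" "a < d" "b < d" "quad_word (rev u @ v)" for u v a b
    using that unfolding P_def S_def by simp
  have \<rho>_P: "\<rho> (u, a) (v, b) = - e (rev u @ v, a, b)" if "((u, a), (v, b)) \<in> P" for u v a b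
    using that unfolding \<rho>_def prod_index_def by simp

  have e_herm: "e (prod_index (t, s)) = cnj (e (prod_index (s, t)))" if st: "s \<in> S" "t \<in> S" for s t
  proof -
    obtain u a v b where uv: "s = (u, a)" "t = (v, b)" "a < d" "b < d" using st unfolding S_def by auto
    have "q (rev v @ u, b, a) = cnj (q (rev u @ v, a, b))"
      using hermitian_fpoly_index[OF herm uv(3,4), of "rev u @ v"] unfolding q_def by simp
    moreover have "(\<Sum>(s, t)\<in>factor_pairs d (rev v @ u, b, a). K s t) = cnj (\<Sum>(s, t)\<in>factor_pairs d (rev u @ v, a, b). K s t)"
    proof -
      have sw: "prod_index (prod.swap x) = (rev v @ u, b, a) \<longleftrightarrow> prod_index x = (rev u @ v, a, b)" for x
      proof -
        obtain u' a' v' b' where x: "x = ((u', a'), (v', b'))" by (metis surj_pair)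
        have "rev v' @ u' = rev v @ u \<longleftrightarrow> rev u' @ v' = rev u @ v"
          by (metis rev_append rev_rev_ident)
        then show ?thesis unfolding x prod_index_def by auto
      qed
      have "(\<Sum>(s, t)\<in>factor_pairs d (rev v @ u, b, a). K s t) = (\<Sum>(s, t)\<in>factor_pairs d (rev u @ v, a, b). K t s)"
        by (rule sum.reindex_bij_witness[of _ prod.swap prod.swap])
          (use sw in \<open>auto simp: factor_pairs_def\<close>)
      also have "\<dots> = (\<Sum>(s, t)\<in>factor_pairs d (rev u @ v, a, b). cnj (K s t))"
      proof (rule sum.cong)
        fix x assume "x \<in> factor_pairs d (rev u @ v, a, b)"
        then have "x \<in> S \<times> S" by (rule subsetD[OF sub])
        then have "fst x \<in> S" "snd x \<in> S" by auto
        from ker_hermD[OF ker_psd_herm[OF K] this]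
        show "(case x of (s, t) \<Rightarrow> K t s) = (case x of (s, t) \<Rightarrow> cnj (K s t))"
          by (simp add: case_prod_unfold)
      qed simp
      finally show ?thesis by (simp add: case_prod_unfold)
    qed
    ultimately show ?thesis unfolding uv prod_index_def e_def by simp
  qed
  have \<rho>_herm: "ker_herm S \<rho>"
    unfolding ker_herm_def
  proof (intro ballI)
    fix s t assume st: "s \<in> S" "t \<in> S"
    have "(t, s) \<in> P \<longleftrightarrow> (s, t) \<in> P" unfolding P_def using quad_word_product by auto
    then show "\<rho> t s = cnj (\<rho> s t)" unfolding \<rho>_def using e_herm[OF st] by simp
  qed
  have \<rho>: "ker_psd S \<rho>"
    unfolding ker_psd_def
  proof (intro conjI allI)
    show "ker_herm S \<rho>" by (rule \<rho>_herm)
    fix z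
    \<comment> \<open>Optimality against the rank-one kernel of \<open>z\<close> is positivity of
      the form of \<rho> at \<open>z\<close>, after the sum over the equations has been regrouped as
      a sum over \<open>P\<close>.\<close>
    have "(\<Sum>j\<in>J. cnj (e j) * (\<Sum>(s, t)\<in>factor_pairs d j. z s * cnj (z t)))
        = (\<Sum>j\<in>J. \<Sum>st\<in>{st \<in> P. prod_index st = j}. cnj (e (prod_index st)) * (z (fst st) * cnj (z (snd st))))"
    proof (rule sum.cong)
      fix j assume "j \<in> J"
      then obtain s0 t0 where st0: "(s0, t0) \<in> P" "j = prod_index (s0, t0)" unfolding J_def by auto
      have "factor_pairs d j = {st \<in> P. prod_index st = j}"
        using st0 unfolding factor_pairs_def P_def S_def prod_index_def by (auto simp: case_prod_unfold)
      then show "cnj (e j) * (\<Sum>(s, t)\<in>factor_pairs d j. z s * cnj (z t)) =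
          (\<Sum>st\<in>{st \<in> P. prod_index st = j}. cnj (e (prod_index st)) * (z (fst st) * cnj (z (snd st))))"
        by (simp add: sum_distrib_left case_prod_unfold)
    qed simp
    also have "\<dots> = (\<Sum>st\<in>P. cnj (e (prod_index st)) * (z (fst st) * cnj (z (snd st))))"
      by (rule sum.group[OF P J]) (simp add: J_def)
    also have "\<dots> = - (\<Sum>st\<in>P. cnj (\<rho> (fst st) (snd st)) * (z (fst st) * cnj (z (snd st))))"
      unfolding sum_negf[symmetric] \<rho>_def by (intro sum.cong) simp_all
    also have "\<dots> = - (\<Sum>st\<in>S \<times> S. cnj (\<rho> (fst st) (snd st)) * (z (fst st) * cnj (z (snd st))))"
      unfolding neg_equal_iff_equal
      by (rule sum.mono_neutral_left) (use S PS in \<open>auto simp: \<rho>_def\<close>)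
    also have "\<dots> = - cnj (ker_form S \<rho> z)"
      unfolding ker_form_def by (simp add: sum.cartesian_product case_prod_unfold ac_simps)
    finally show "0 \<le> Re (ker_form S \<rho> z)"
      using opt_e[OF ker_psd_rank_one[of S z]] by (simp only: uminus_complex.sel cnj.sel neg_le_0_iff_le)
  qed

  \<comment> \<open>Eliminating the single x-letters leaves a remainder \<rho>2 without entries in
    their rows and columns; the Gram part serves convexity in x and the remainder convexity in
    y.\<close>
  define X where "X = range (\<lambda>j::'i. [Xv j]) \<times> {..<d}"
  have X: "finite X" "X \<subseteq> S" unfolding X_def S_def border_def by auto
  obtain r :: nat and f \<rho>2 where \<rho>2: "ker_psd S \<rho>2"
    and dec: "\<And>s t. s \<in> S \<Longrightarrow> t \<in> S \<Longrightarrow> \<rho> s t = (\<Sum>l<r. f l s * cnj (f l t)) + \<rho>2 s t"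
    and \<rho>2_X: "\<And>x t. x \<in> X \<Longrightarrow> t \<in> S \<Longrightarrow> \<rho>2 x t = 0"
    and f_zero: "\<And>y l. y \<in> S \<Longrightarrow> (\<forall>x\<in>X. \<rho> y x = 0) \<Longrightarrow> l < r \<Longrightarrow> f l y = 0"
    using ker_psd_split[OF S X \<rho>] by blast
  obtain r2 :: nat and f2 where f2: "\<And>s t. s \<in> S \<Longrightarrow> t \<in> S \<Longrightarrow> \<rho>2 s t = (\<Sum>l<r2. f2 l s * cnj (f2 l t))"
    using ker_psd_Gram[OF S \<rho>2] by blast
  have \<rho>2_X': "\<rho>2 t x = 0" if "x \<in> X" "t \<in> S" for x t
  proof -
    have "x \<in> S" using that X by blast
    then have "\<rho>2 t x = cnj (\<rho>2 x t)" using ker_hermD[OF ker_psd_herm[OF \<rho>2]] that by blast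
    then show ?thesis using \<rho>2_X[OF that] by simp
  qed
  \<comment> \<open>The product y_k x_j is not quadratic, so \<rho> has no entry between the letter
    y_k and \<open>X\<close>, and the last clause of the splitting applies.\<close>
  have f_y: "f l ([Yv k], b) = 0" if "b < d" "l < r" for l k b
  proof (rule f_zero)
    show "([Yv k], b) \<in> S" unfolding S_def border_def using that by simp
    show "\<forall>x\<in>X. \<rho> ([Yv k], b) x = 0"
      unfolding X_def \<rho>_def P_def quad_word_def by auto
  qed (use that in simp)

  \<comment> \<open>Words of length 4 can only be cut in the middle, and each test receives its own
    part of \<rho> there. For a shorter word with two x, one half is a single x-letter, so the other
    part vanishes and the full residual is taken. The conjugate arises because the splitting
    conjugates the second factor and the Gram test the first.\<close>
  define Vx where "Vx = (\<lambda>w a b. if length w = 4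
    then \<Sum>l<r. cnj (f l (rev (take 2 w), a)) * f l (drop 2 w, b) else - cnj (e (w, a, b)))"
  define Vy where "Vy = (\<lambda>w a b. if length w = 4
    then \<Sum>l<r2. cnj (f2 l (rev (take 2 w), a)) * f2 l (drop 2 w, b) else - cnj (e (w, a, b)))"
  have tests: "Vx (rev u @ v) a b = (\<Sum>l<r. cnj (f l (u, a)) * f l (v, b))"
    if u: "u \<in> xborder" and v: "v \<in> xborder" and ab: "a < d" "b < d" for u v a b
  proof (cases "length u = 2 \<and> length v = 2")
    case True
    then show ?thesis unfolding Vx_def by simp
  next
    case False
    have uvb: "u \<in> border" "v \<in> border" using u v unfolding border_def by auto
    then have uvS: "(u, a) \<in> S" "(v, b) \<in> S" using ab unfolding S_def by auto
    have quad: "quad_word (rev u @ v)"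
      using xborder_xdeg[OF u] xborder_xdeg[OF v] unfolding quad_word_def by (simp add: rev_filter[symmetric])
    have len: "length u = 1 \<or> length v = 1" "length (rev u @ v) \<noteq> 4"
      using False border_length[OF uvb(1)] border_length[OF uvb(2)] by auto
    then have "(u, a) \<in> X \<or> (v, b) \<in> X"
      using xborder_length_1[OF u] xborder_length_1[OF v] ab unfolding X_def by auto
    then have "\<rho>2 (u, a) (v, b) = 0" using \<rho>2_X \<rho>2_X' uvS by blast
    then have "- e (rev u @ v, a, b) = (\<Sum>l<r. f l (u, a) * cnj (f l (v, b)))"
      using dec[OF uvS] \<rho>_P[OF in_P[OF uvb ab quad]] by simp
    then have "cnj (- e (rev u @ v, a, b)) = cnj (\<Sum>l<r. f l (u, a) * cnj (f l (v, b)))" by simp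
    then show ?thesis using len(2) unfolding Vx_def by simp
  qed
  have testx: "0 \<le> Re (\<Sum>w\<in>{w \<in> fp_support d d p. xdeg w = 2}. \<Sum>a<d. \<Sum>b<d. p w $$ (a, b) * Vx w a b)"
    by (rule convex_in_x_Gram_test[OF cx p, where r = r and f = "\<lambda>u a l. f l (u, a)"])
      (use separately_convex_support[OF herm conv] tests in auto)
  have testsy: "Vy (rev u @ v) a b = (\<Sum>l<r2. cnj (f2 l (u, a)) * f2 l (v, b))"
    if u: "u \<in> yborder" and v: "v \<in> yborder" and ab: "a < d" "b < d" for u v a b
  proof (cases "length u = 2 \<and> length v = 2")
    case True
    then show ?thesis unfolding Vy_def by simp
  next
    case False
    have uvb: "u \<in> border" "v \<in> border" using u v unfolding border_def by auto
    then have uvS: "(u, a) \<in> S" "(v, b) \<in> S" using ab unfolding S_def by auto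
    have quad: "quad_word (rev u @ v)"
      using yborder_ydeg[OF u] yborder_ydeg[OF v] unfolding quad_word_def by (simp add: rev_filter[symmetric])
    have len: "length u = 1 \<or> length v = 1" "length (rev u @ v) \<noteq> 4"
      using False border_length[OF uvb(1)] border_length[OF uvb(2)] by auto
    then have "(\<exists>k. u = [Yv k]) \<or> (\<exists>k. v = [Yv k])"
      using u v by (auto elim!: yborder_cases)
    then have "(\<Sum>l<r. f l (u, a) * cnj (f l (v, b))) = 0"
      using f_y[OF ab(1)] f_y[OF ab(2)] by auto
    then have "- e (rev u @ v, a, b) = (\<Sum>l<r2. f2 l (u, a) * cnj (f2 l (v, b)))"
      using dec[OF uvS] f2[OF uvS] \<rho>_P[OF in_P[OF uvb ab quad]] by simp
    then have "cnj (- e (rev u @ v, a, b)) = cnj (\<Sum>l<r2. f2 l (u, a) * cnj (f2 l (v, b)))" by simp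
    then show ?thesis using len(2) unfolding Vy_def by simp
  qed
  have testy: "0 \<le> Re (\<Sum>w\<in>{w \<in> fp_support d d p. ydeg w = 2}. \<Sum>a<d. \<Sum>b<d. p w $$ (a, b) * Vy w a b)"
    by (rule convex_in_y_Gram_test[OF cy p, where r = r2 and f = "\<lambda>u a l. f2 l (u, a)"])
      (use separately_convex_support[OF herm conv] testsy in auto)

  \<comment> \<open>Words of degree two in x and in y have length 4, and there the two parts add up
    to \<rho>. Every other quadratic word of the support enters exactly one of the tests, with its
    full value.\<close>
  have sum_V: "(if xdeg w = 2 then Vx w a b else 0) + (if ydeg w = 2 then Vy w a b else 0) =
      (if quad_word w then - cnj (e (w, a, b)) else 0)"
    if w: "w \<in> fp_support d d p" and ab: "a < d" "b < d" for w a b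
  proof -
    note sc = separately_convex_support[OF herm conv w]
    consider "xdeg w = 2" "ydeg w = 2" | "xdeg w = 2" "ydeg w < 2" | "xdeg w < 2" "ydeg w = 2" | "xdeg w < 2" "ydeg w < 2"
      using sc(1,2) by linarith
    then show ?thesis
    proof cases
      case 1
      obtain u v where uv: "u \<in> xborder" "v \<in> xborder" "w = rev u @ v" using sc(3)[OF 1(1)] by blast
      have uvb: "u \<in> border" "v \<in> border" using uv unfolding border_def by auto
      then have uvS: "(u, a) \<in> S" "(v, b) \<in> S" using ab unfolding S_def by auto
      have "length w = 4" using xdeg_ydeg[of w] 1 by simp
      then have "length u = 2" "length v = 2"
        using border_length[OF uvb(1)] border_length[OF uvb(2)] uv(3) by auto
      then have "u \<in> yborder" "v \<in> yborder" using uv xborder_length_2 by auto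
      have quad: "quad_word (rev u @ v)" using 1 unfolding quad_word_def uv(3) by simp
      have "Vx w a b + Vy w a b = cnj (\<Sum>l<r. f l (u, a) * cnj (f l (v, b))) + cnj (\<Sum>l<r2. f2 l (u, a) * cnj (f2 l (v, b)))"
        unfolding uv(3) tests[OF uv(1,2) ab] testsy[OF \<open>u \<in> yborder\<close> \<open>v \<in> yborder\<close> ab] by simp
      also have "\<dots> = cnj (\<rho> (u, a) (v, b))" unfolding dec[OF uvS] f2[OF uvS] by simp
      also have "\<dots> = - cnj (e (w, a, b))" unfolding \<rho>_P[OF in_P[OF uvb ab quad]] uv(3) by simp
      finally show ?thesis using 1 unfolding quad_word_def by simp
    qed (use xdeg_ydeg[of w] in \<open>auto simp: Vx_def Vy_def quad_word_def\<close>)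
  qed
  \<comment> \<open>The pairing of the residual with \<open>p\<close>, rewritten over the support:
    products outside the support have zero coefficients, and every quadratic word of the support is
    a border product.\<close>
  have "(\<Sum>j\<in>J. cnj (e j) * q j) =
      (\<Sum>w\<in>fp_support d d p. \<Sum>a<d. \<Sum>b<d. if quad_word w then cnj (e (w, a, b)) * p w $$ (a, b) else 0)"
  proof -
    define I where "I = fp_support d d p \<times> {..<d} \<times> {..<d}"
    have I: "finite I" unfolding I_def using supp by auto
    define g where "g = (\<lambda>(w, a, b). if quad_word w then cnj (e (w, a, b)) * p w $$ (a, b) else (0::complex))"
    have Jq: "quad_word w \<and> a < d \<and> b < d" if "(w, a, b) \<in> J" for w a b
      using that unfolding J_def P_def S_def prod_index_def by auto
    have "(\<Sum>j\<in>J. cnj (e j) * q j) = sum g J"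
      by (intro sum.cong) (use Jq in \<open>auto simp: g_def q_def\<close>)
    also have "\<dots> = sum g (J \<inter> I)"
    proof (rule sum.mono_neutral_right)
      show "\<forall>j\<in>J - J \<inter> I. g j = 0"
      proof
        fix j assume j: "j \<in> J - J \<inter> I"
        obtain w a b where jw: "j = (w, a, b)" by (metis surj_pair)
        then have ab: "a < d" "b < d" using Jq j by auto
        then have "w \<notin> fp_support d d p" using j unfolding jw I_def by auto
        then show "g j = 0" using ab unfolding g_def jw fp_support_def by simp
      qed
    qed (use J in auto)
    also have "\<dots> = sum g I"
    proof (rule sum.mono_neutral_left)
      show "\<forall>j\<in>I - J \<inter> I. g j = 0"
      proof
        fix j assume j: "j \<in> I - J \<inter> I"
        obtain w a b where jw: "j = (w, a, b)" by (metis surj_pair)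
        then have w: "w \<in> fp_support d d p" "a < d" "b < d" using j unfolding I_def by auto
        have "\<not> quad_word w"
        proof
          assume quad: "quad_word w"
          obtain u v where uv: "u \<in> border" "v \<in> border" "w = rev u @ v"
            using separately_convex_quad_word(1)[OF herm conv w(1) quad] by blast
          have "prod_index ((u, a), (v, b)) \<in> J"
            unfolding J_def using in_P[OF uv(1,2) w(2,3)] quad uv(3) by blast
          then show False using j unfolding jw uv(3) prod_index_def by simp
        qed
        then show "g j = 0" unfolding g_def jw by simp
      qed
    qed (use I in auto)
    also have "\<dots> = (\<Sum>w\<in>fp_support d d p. \<Sum>a<d. \<Sum>b<d. g (w, a, b))"
      unfolding I_def by (simp add: sum.cartesian_product)
    finally show ?thesis unfolding g_def by simp
  qed
  moreover have "(\<Sum>w\<in>{w \<in> fp_support d d p. xdeg w = 2}. \<Sum>a<d. \<Sum>b<d. p w $$ (a, b) * Vx w a b) +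
      (\<Sum>w\<in>{w \<in> fp_support d d p. ydeg w = 2}. \<Sum>a<d. \<Sum>b<d. p w $$ (a, b) * Vy w a b) =
      - (\<Sum>w\<in>fp_support d d p. \<Sum>a<d. \<Sum>b<d. if quad_word w then cnj (e (w, a, b)) * p w $$ (a, b) else 0)"
  proof -
    have "(\<Sum>w\<in>{w \<in> fp_support d d p. xdeg w = 2}. \<Sum>a<d. \<Sum>b<d. p w $$ (a, b) * Vx w a b) +
        (\<Sum>w\<in>{w \<in> fp_support d d p. ydeg w = 2}. \<Sum>a<d. \<Sum>b<d. p w $$ (a, b) * Vy w a b) =
        (\<Sum>w\<in>fp_support d d p. \<Sum>a<d. \<Sum>b<d. p w $$ (a, b) *
          ((if xdeg w = 2 then Vx w a b else 0) + (if ydeg w = 2 then Vy w a b else 0)))"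
      unfolding sum.inter_filter[OF supp]
    proof (subst sum.distrib[symmetric], rule sum.cong[OF refl])
      fix w
      show "(if xdeg w = 2 then \<Sum>a<d. \<Sum>b<d. p w $$ (a, b) * Vx w a b else 0) +
          (if ydeg w = 2 then \<Sum>a<d. \<Sum>b<d. p w $$ (a, b) * Vy w a b else 0) =
          (\<Sum>a<d. \<Sum>b<d. p w $$ (a, b) *
            ((if xdeg w = 2 then Vx w a b else 0) + (if ydeg w = 2 then Vy w a b else 0)))"
        by (cases "xdeg w = 2"; cases "ydeg w = 2") (simp_all add: sum.distrib distrib_left)
    qed
    also have "\<dots> = (\<Sum>w\<in>fp_support d d p. \<Sum>a<d. \<Sum>b<d. - (if quad_word w then cnj (e (w, a, b)) * p w $$ (a, b) else 0))"
      by (intro sum.cong refl) (simp add: sum_V)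
    finally show ?thesis by (simp add: sum_negf)
  qed
  \<comment> \<open>The sum of the two tests is minus this pairing, so the pairing is nonpositive;
    it also equals the squared norm of the residual.\<close>
  ultimately have "Re (\<Sum>j\<in>J. cnj (e j) * q j) \<le> 0"
    using testx testy by (metis (no_types, lifting) add_nonneg_nonneg neg_0_le_iff_le plus_complex.sel(1) uminus_complex.sel(1))
  then have "(\<Sum>j\<in>J. (cmod (e j))\<^sup>2) \<le> 0" using norm unfolding e_def by simp
  then have e0: "e j = 0" if "j \<in> J" for j
    using sum_nonneg_eq_0_iff[OF J, of "\<lambda>j. (cmod (e j))\<^sup>2"] that
    by (metis (no_types, lifting) antisym norm_eq_zero power_eq_0_iff sum_nonneg zero_le_power2)
  have "p w $$ (a, b) = (\<Sum>(s, t)\<in>factor_pairs d (w, a, b). K s t)"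
    if quad: "quad_word w" and ab: "a < d" "b < d" for w a b
  proof (cases "(w, a, b) \<in> J")
    case True
    then show ?thesis using e0[OF True] unfolding e_def q_def by simp
  next
    \<comment> \<open>A quadratic word without a factorization into border words has an empty fibre
      and does not occur in \<open>p\<close>, so both sides are 0.\<close>
    case False
    have empty: "factor_pairs d (w, a, b) = {}"
    proof (rule ccontr)
      assume "factor_pairs d (w, a, b) \<noteq> {}"
      then obtain s t where "s \<in> S" "t \<in> S" "prod_index (s, t) = (w, a, b)"
        unfolding factor_pairs_def S_def by auto
      moreover from this have "(s, t) \<in> P" using quad unfolding P_def prod_index_def by (auto simp: case_prod_unfold)
      ultimately show False using False unfolding J_def by (metis image_eqI)
    qed
    have "w \<notin> fp_support d d p"
    proof
      assume w: "w \<in> fp_support d d p"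
      obtain u v where "u \<in> border" "v \<in> border" "w = rev u @ v"
        using separately_convex_quad_word(1)[OF herm conv w quad] by blast
      then have "((u, a), (v, b)) \<in> factor_pairs d (w, a, b)"
        using ab unfolding factor_pairs_def prod_index_def by simp
      then show False using empty by simp
    qed
    then show ?thesis using ab unfolding empty fp_support_def by simp
  qed
  then show ?thesis using K unfolding S_def by blast
qed

section \<open>Pencils and squares\<close>

lemma not_quad_word_length: "\<not> quad_word w \<Longrightarrow> length w \<le> 2"
  unfolding quad_word_def using xdeg_ydeg[of w] by linarith

lemma finite_not_quad_word: "finite {w :: ('i::finite) word. \<not> quad_word w}"
proof (rule finite_subset)
  show "{w :: 'i word. \<not> quad_word w} \<subseteq> {w. set w \<subseteq> UNIV \<and> length w \<le> 2}"
    using not_quad_word_length by auto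
  have "UNIV = range Xv \<union> range (Yv :: 'i \<Rightarrow> 'i letter)"
    by (metis UNIV_eq_I UnCI letter.exhaust rangeI)
  then have "finite (UNIV :: 'i letter set)" by (metis finite_UnI finite_imageI finite)
  then show "finite {w :: 'i word. set w \<subseteq> UNIV \<and> length w \<le> 2}"
    by (rule finite_lists_length_le)
qed

lemma not_quad_word_cases:
  assumes "\<not> quad_word w"
  obtains "w = []" | j where "w = [Xv j]" | k where "w = [Yv k]"
    | j k where "w = [Xv j, Yv k]" | k j where "w = [Yv k, Xv j]"
proof -
  have "length w \<le> 2" using assms by (rule not_quad_word_length)
  then consider "w = []" | l where "w = [l]" | l l' where "w = [l, l']"
    by (cases w; cases "tl w") auto
  then show thesis
  proof cases
    case (2 l)
    then show ?thesis using that by (cases l) auto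
  next
    case (3 l l')
    then show ?thesis using that assms unfolding quad_word_def by (cases l; cases l') auto
  qed (use that in auto)
qed

text \<open>Turns the explicit shape of a pencil into a condition on its support: a word with at
  most one x and one y has one of the five shapes listed in \<open>pencil\<close>.\<close>

lemma xy_pencil_iff:
  "xy_pencil N d L \<longleftrightarrow> (\<forall>w. L w \<in> carrier_mat N d \<and> (quad_word w \<longrightarrow> L w = 0\<^sub>m N d))"
proof
  assume "xy_pencil N d L"
  then obtain A0 A B C D where c: "A0 \<in> carrier_mat N d" "\<And>j. A j \<in> carrier_mat N d"
    "\<And>k. B k \<in> carrier_mat N d" "\<And>p q. C p q \<in> carrier_mat N d" "\<And>q p. D q p \<in> carrier_mat N d"
    and L: "L = pencil N d A0 A B C D"
    unfolding xy_pencil_def by blast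
  show "\<forall>w. L w \<in> carrier_mat N d \<and> (quad_word w \<longrightarrow> L w = 0\<^sub>m N d)"
  proof (intro allI conjI impI)
    fix w
    have quad: "L w = 0\<^sub>m N d" if "quad_word w"
    proof -
      from that obtain l l' v where w: "w = l # l' # v"
        unfolding quad_word_def by (cases w; cases "tl w") (auto split: if_splits)
      show ?thesis
        using that unfolding w L quad_word_def by (cases l; cases l'; cases v) auto
    qed
    then show "quad_word w \<Longrightarrow> L w = 0\<^sub>m N d" .
    show "L w \<in> carrier_mat N d"
    proof (cases "quad_word w")
      case False
      then show ?thesis by (cases rule: not_quad_word_cases) (use c in \<open>auto simp: L\<close>)
    qed (simp add: quad)
  qed
next
  assume c: "\<forall>w. L w \<in> carrier_mat N d \<and> (quad_word w \<longrightarrow> L w = 0\<^sub>m N d)"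
  have "L w = pencil N d (L []) (\<lambda>j. - L [Xv j]) (\<lambda>k. - L [Yv k])
      (\<lambda>p q. - L [Xv p, Yv q]) (\<lambda>q p. - L [Yv q, Xv p]) w" (is "_ = ?R w") for w
  proof (cases "quad_word w")
    case True
    from True obtain l l' v where w: "w = l # l' # v"
      unfolding quad_word_def by (cases w; cases "tl w") (auto split: if_splits)
    have "?R w = 0\<^sub>m N d"
      using True unfolding w quad_word_def by (cases l; cases l'; cases v) auto
    then show ?thesis using c True by simp
  next
    case False
    have u: "- (- L v) = L v" for v using c by (intro eq_matI) auto
    from False show ?thesis by (cases rule: not_quad_word_cases) (simp_all add: u)
  qed
  then have "L = pencil N d (L []) (\<lambda>j. - L [Xv j]) (\<lambda>k. - L [Yv k])
      (\<lambda>p q. - L [Xv p, Yv q]) (\<lambda>q p. - L [Yv q, Xv p])" by (rule ext)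
  then show "xy_pencil N d L"
    unfolding xy_pencil_def using c
    by (intro exI[of _ "L []"] exI[of _ "\<lambda>j. - L [Xv j]"] exI[of _ "\<lambda>k. - L [Yv k]"]
        exI[of _ "\<lambda>p q. - L [Xv p, Yv q]"] exI[of _ "\<lambda>q p. - L [Yv q, Xv p]"]) auto
qed

lemma fp_square_carrier: "fp_mult d d (fp_adjoint \<Lambda>) \<Lambda> w \<in> carrier_mat d d"
  unfolding fp_mult_def mat_sum_def by simp

lemma fp_square_index:
  assumes "\<And>w. \<Lambda> w \<in> carrier_mat N d" "a < d" "b < d"
  shows "fp_mult d d (fp_adjoint \<Lambda>) \<Lambda> w $$ (a, b) =
    (\<Sum>k\<le>length w. \<Sum>l<N. cnj (\<Lambda> (rev (take k w)) $$ (l, a)) * \<Lambda> (drop k w) $$ (l, b))"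
proof -
  have dims: "dim_row (\<Lambda> w) = N" "dim_col (\<Lambda> w) = d" for w using assms(1)[of w] by auto
  have "(mat_adjoint (\<Lambda> u) * \<Lambda> v) $$ (a, b) = (\<Sum>l<N. cnj (\<Lambda> u $$ (l, a)) * \<Lambda> v $$ (l, b))" for u v
    using assms(2,3) by (simp add: dims scalar_prod_def atLeast0LessThan)
  then show ?thesis
    unfolding fp_mult_def mat_sum_def fp_adjoint_def using assms(2,3) by simp
qed

text \<open>Reversing the word exchanges the cut at \<open>k\<close> with the cut at
  \<open>length w - k\<close>.\<close>

lemma fp_square_herm:
  assumes "\<And>w. \<Lambda> w \<in> carrier_mat N d" "a < d" "b < d"
  shows "fp_mult d d (fp_adjoint \<Lambda>) \<Lambda> (rev w) $$ (b, a) = cnj (fp_mult d d (fp_adjoint \<Lambda>) \<Lambda> w $$ (a, b))"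
proof -
  have "(\<Sum>k\<le>length (rev w). \<Sum>l<N. cnj (\<Lambda> (rev (take k (rev w))) $$ (l, b)) * \<Lambda> (drop k (rev w)) $$ (l, a)) =
      (\<Sum>k\<le>length w. \<Sum>l<N. cnj (\<Lambda> (drop k w) $$ (l, b)) * \<Lambda> (rev (take k w)) $$ (l, a))"
    by (rule sum.reindex_bij_witness[of _ "\<lambda>k. length w - k" "\<lambda>k. length w - k"])
      (auto simp: take_rev drop_rev)
  then show ?thesis
    unfolding fp_square_index[OF assms(1,3,2)] fp_square_index[OF assms]
    by (simp add: mult.commute)
qed

text \<open>Cuts of \<open>w\<close> into two border halves correspond bijectively to factor pairs
  with the given coordinates; all other cuts contribute 0.\<close>

lemma fp_square_factor_pairs:
  assumes \<Lambda>: "\<And>w. \<Lambda> w \<in> carrier_mat N d" "\<And>w. w \<notin> border \<Longrightarrow> \<Lambda> w = 0\<^sub>m N d"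
    and K: "\<And>u v a b. u \<in> border \<Longrightarrow> v \<in> border \<Longrightarrow> a < d \<Longrightarrow> b < d \<Longrightarrow>
      (\<Sum>l<N. cnj (\<Lambda> u $$ (l, a)) * \<Lambda> v $$ (l, b)) = K (u, a) (v, b)"
    and ab: "a < d" "b < d"
  shows "fp_mult d d (fp_adjoint \<Lambda>) \<Lambda> w $$ (a, b) = (\<Sum>(s, t)\<in>factor_pairs d (w, a, b). K s t)"
proof -
  define I where "I = {k. k \<le> length w \<and> rev (take k w) \<in> border \<and> drop k w \<in> border}"
  have "fp_mult d d (fp_adjoint \<Lambda>) \<Lambda> w $$ (a, b) =
      (\<Sum>k\<in>I. \<Sum>l<N. cnj (\<Lambda> (rev (take k w)) $$ (l, a)) * \<Lambda> (drop k w) $$ (l, b))"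
    unfolding fp_square_index[OF \<Lambda>(1) ab]
  proof (rule sum.mono_neutral_right)
    show "\<forall>k\<in>{..length w} - I. (\<Sum>l<N. cnj (\<Lambda> (rev (take k w)) $$ (l, a)) * \<Lambda> (drop k w) $$ (l, b)) = 0"
    proof
      fix k assume "k \<in> {..length w} - I"
      then consider "rev (take k w) \<notin> border" | "drop k w \<notin> border" unfolding I_def by auto
      then show "(\<Sum>l<N. cnj (\<Lambda> (rev (take k w)) $$ (l, a)) * \<Lambda> (drop k w) $$ (l, b)) = 0"
        by cases (use \<Lambda>(2)[of "rev (take k w)"] \<Lambda>(2)[of "drop k w"] ab in simp_all)
    qed
  qed (auto simp: I_def)
  also have "\<dots> = (\<Sum>k\<in>I. K (rev (take k w), a) (drop k w, b))"
    by (intro sum.cong refl K) (use ab in \<open>auto simp: I_def\<close>)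
  also have "\<dots> = (\<Sum>(s, t)\<in>factor_pairs d (w, a, b). K s t)"
    by (rule sum.reindex_bij_witness[of _ "\<lambda>((u, a), (v, b)). length u" "\<lambda>k. ((rev (take k w), a), (drop k w, b))"])
      (use ab in \<open>auto simp: I_def factor_pairs_def prod_index_def\<close>)
  finally show ?thesis .
qed

text \<open>A Gram factorization of the kernel gives the rows of \<Lambda>. The difference of
  \<open>p\<close> and the square vanishes on quadratic words and is therefore a pencil.\<close>

lemma separately_convex_imp_square:
  fixes p :: "('i::finite) fpoly"
  assumes herm: "hermitian_fpoly d p" and conv: "separately_convex d p"
  shows "\<exists>L N \<Lambda>. xy_pencil d d L \<and> hermitian_fpoly d L \<and> 0 < N \<and> xy_pencil N d \<Lambda> \<and>
    p = fp_add L (fp_mult d d (fp_adjoint \<Lambda>) \<Lambda>)"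
proof -
  have pc: "p w \<in> carrier_mat d d" for w using herm unfolding hermitian_fpoly_def is_fpoly_def by blast
  obtain K where K: "ker_psd (border \<times> {..<d}) K"
    and pK: "\<And>w a b. quad_word w \<Longrightarrow> a < d \<Longrightarrow> b < d \<Longrightarrow> p w $$ (a, b) = (\<Sum>(s, t)\<in>factor_pairs d (w, a, b). K s t)"
    using separately_convex_Gram[OF herm conv] by blast
  obtain r :: nat and h where h: "\<And>s t. s \<in> border \<times> {..<d} \<Longrightarrow> t \<in> border \<times> {..<d} \<Longrightarrow> K s t = (\<Sum>l<r. h l s * cnj (h l t))"
    using ker_psd_Gram[OF _ K] finite_border by blast
  \<comment> \<open>The extra zero row guarantees a positive number of rows even for r = 0.
    Conjugates are stored because the square conjugates its first factor, whereas the Gram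
    factorization of \<open>K\<close> conjugates its second.\<close>
  define \<Lambda> where "\<Lambda> = (\<lambda>u. mat (Suc r) d (\<lambda>(l, a). if u \<in> border \<and> l < r then cnj (h l (u, a)) else 0))"
  define M where "M = fp_mult d d (fp_adjoint \<Lambda>) \<Lambda>"
  define L where "L = (\<lambda>w. p w - M w)"
  have \<Lambda>c: "\<Lambda> w \<in> carrier_mat (Suc r) d" for w unfolding \<Lambda>_def by simp
  have \<Lambda>0: "\<Lambda> w = 0\<^sub>m (Suc r) d" if "w \<notin> border" for w
    unfolding \<Lambda>_def using that by (intro eq_matI) auto
  have \<Lambda>K: "(\<Sum>l<Suc r. cnj (\<Lambda> u $$ (l, a)) * \<Lambda> v $$ (l, b)) = K (u, a) (v, b)"
    if "u \<in> border" "v \<in> border" "a < d" "b < d" for u v a b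
    using that h[of "(u, a)" "(v, b)"] by (simp add: \<Lambda>_def)
  have Mc: "M w \<in> carrier_mat d d" for w unfolding M_def by (rule fp_square_carrier)
  have dims: "dim_row (p w) = d" "dim_col (p w) = d" "dim_row (M w) = d" "dim_col (M w) = d" for w
    using pc[of w] Mc[of w] by auto
  have Lc: "L w \<in> carrier_mat d d" for w unfolding L_def by (rule minus_carrier_mat[OF Mc])
  have L0: "L w = 0\<^sub>m d d" if "quad_word w" for w
    by (rule eq_matI) (use pK[OF that] fp_square_factor_pairs[OF \<Lambda>c \<Lambda>0 \<Lambda>K] in
        \<open>auto simp: L_def dims M_def[symmetric]\<close>)
  have LP: "xy_pencil d d L" unfolding xy_pencil_iff using Lc L0 by blast
  have \<Lambda>P: "xy_pencil (Suc r) d \<Lambda>"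
    unfolding xy_pencil_iff
  proof (intro allI conjI impI)
    fix w :: "'i word" assume "quad_word w"
    then have "w \<notin> border" using border_deg[of w] unfolding quad_word_def by auto
    then show "\<Lambda> w = 0\<^sub>m (Suc r) d" by (rule \<Lambda>0)
  qed (rule \<Lambda>c)
  have "is_fpoly d d L"
    unfolding is_fpoly_def
  proof (intro conjI allI Lc)
    show "finite (fp_support d d L)"
      by (rule finite_subset[OF _ finite_not_quad_word]) (use L0 in \<open>auto simp: fp_support_def\<close>)
  qed
  moreover have "fp_adjoint L = L"
  proof
    fix w
    show "fp_adjoint L w = L w"
    proof (rule eq_matI)
      fix a b assume "a < dim_row (L w)" "b < dim_col (L w)"
      then have ab: "a < d" "b < d" using Lc[of w] by auto
      have "M (rev w) $$ (b, a) = cnj (M w $$ (a, b))"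
        unfolding M_def by (rule fp_square_herm[of \<Lambda>, OF \<Lambda>c ab])
      then have "L (rev w) $$ (b, a) = cnj (L w $$ (a, b))"
        using hermitian_fpoly_index[OF herm ab, of w] ab
        by (simp add: L_def dims)
      then show "fp_adjoint L w $$ (a, b) = L w $$ (a, b)"
        using Lc[of "rev w"] ab by (simp add: fp_adjoint_def)
    qed (use Lc[of w] Lc[of "rev w"] in \<open>auto simp: fp_adjoint_def\<close>)
  qed
  ultimately have "hermitian_fpoly d L" unfolding hermitian_fpoly_def by blast
  moreover have "p = fp_add L M"
  proof
    fix w show "p w = fp_add L M w"
      by (rule eq_matI) (auto simp: fp_add_def L_def dims)
  qed
  ultimately show ?thesis using LP \<Lambda>P unfolding M_def by blast
qed

section \<open>Compressions and direct sums\<close>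

lemma mat_adjoint_adjoint [simp]: "mat_adjoint (mat_adjoint A) = (A :: complex mat)"
  by (rule eq_matI) auto

lemma mat_adjoint_mult:
  fixes A B :: "complex mat"
  assumes "A \<in> carrier_mat n k" "B \<in> carrier_mat k m"
  shows "mat_adjoint (A * B) = mat_adjoint B * mat_adjoint A"
proof (rule eq_matI)
  fix i j assume "i < dim_row (mat_adjoint B * mat_adjoint A)" "j < dim_col (mat_adjoint B * mat_adjoint A)"
  then show "mat_adjoint (A * B) $$ (i, j) = (mat_adjoint B * mat_adjoint A) $$ (i, j)"
    using assms by (simp add: scalar_prod_def mult.commute)
qed (use assms in auto)

lemma mat_adjoint_minus:
  fixes A B :: "complex mat"
  assumes "A \<in> carrier_mat n k" "B \<in> carrier_mat n k"
  shows "mat_adjoint (A - B) = mat_adjoint A - mat_adjoint B"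
  by (rule eq_matI) (use assms in auto)

lemma mat_adjoint_one: "mat_adjoint (1\<^sub>m n :: complex mat) = 1\<^sub>m n"
  by (rule eq_matI) auto

lemma word_eval_append:
  assumes "herm_tuple n X" "herm_tuple n Y"
  shows "word_eval n X Y (u @ v) = word_eval n X Y u * word_eval n X Y v"
proof (induction u)
  case Nil
  then show ?case using left_mult_one_mat[OF word_eval_carrier[OF assms]] by simp
next
  case (Cons l u)
  then show ?case
    using assoc_mult_mat[OF letter_eval_carrier[OF assms] word_eval_carrier[OF assms] word_eval_carrier[OF assms]]
    by simp
qed

lemma word_eval_rev:
  assumes "herm_tuple n X" "herm_tuple n Y"
  shows "word_eval n X Y (rev w) = mat_adjoint (word_eval n X Y w)"
proof (induction w)
  case Nil
  show ?case by (simp add: mat_adjoint_one)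
next
  case (Cons l w)
  have l: "mat_adjoint (letter_eval X Y l) = letter_eval X Y l"
    using herm_tuple_letter[OF assms] unfolding hermitian_mat_def by blast
  have "word_eval n X Y (rev (l # w)) = mat_adjoint (word_eval n X Y w) * letter_eval X Y l"
    using Cons word_eval_append[OF assms, of "rev w" "[l]"]
      right_mult_one_mat[OF letter_eval_carrier[OF assms, of l]] by simp
  then show ?case
    using mat_adjoint_mult[OF letter_eval_carrier[OF assms] word_eval_carrier[OF assms], of l w] l by simp
qed

lemma compress_carrier:
  assumes "V \<in> carrier_mat n m" "A \<in> carrier_mat n n"
  shows "compress V A \<in> carrier_mat m m"
  unfolding compress_def using assms by (intro mult_carrier_mat[of _ m n] mult_carrier_mat[of _ m n _ n]) auto

lemma compress_index:
  assumes V: "V \<in> carrier_mat n m" and A: "A \<in> carrier_mat n n" and ij: "i < m" "j < m"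
  shows "compress V A $$ (i, j) = (\<Sum>s<n. \<Sum>t<n. cnj (V $$ (s, i)) * A $$ (s, t) * V $$ (t, j))"
proof -
  have "compress V A $$ (i, j) = (\<Sum>s<n. cnj (V $$ (s, i)) * (\<Sum>t<n. A $$ (s, t) * V $$ (t, j)))"
    unfolding compress_def using assms by (simp add: scalar_prod_def atLeast0LessThan)
  also have "\<dots> = (\<Sum>s<n. \<Sum>t<n. cnj (V $$ (s, i)) * A $$ (s, t) * V $$ (t, j))"
    by (simp add: sum_distrib_left mult.assoc)
  finally show ?thesis .
qed

lemma compress_hermitian:
  assumes V: "V \<in> carrier_mat n m" and A: "hermitian_mat n A"
  shows "hermitian_mat m (compress V A)"
proof -
  have Ac: "A \<in> carrier_mat n n" "mat_adjoint A = A" using A unfolding hermitian_mat_def by auto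
  have Vc: "mat_adjoint V \<in> carrier_mat m n" using V by simp
  have "mat_adjoint (mat_adjoint V * A * V) = mat_adjoint V * (mat_adjoint A * V)"
    using mat_adjoint_mult[OF mult_carrier_mat[OF Vc Ac(1)] V] mat_adjoint_mult[OF Vc Ac(1)] by simp
  also have "\<dots> = mat_adjoint V * A * V" using assoc_mult_mat[OF Vc Ac(1) V] Ac(2) by simp
  finally show ?thesis unfolding hermitian_mat_def using compress_carrier[OF V Ac(1)] by (simp add: compress_def)
qed

lemma compress_tuple:
  assumes "V \<in> carrier_mat n m" "herm_tuple n X"
  shows "herm_tuple m (\<lambda>j. compress V (X j))"
  using assms compress_hermitian unfolding herm_tuple_def by blast

lemma block_index_exhaust:
  assumes "x < d * (n::nat)"
  obtains a s where "a < d" "s < n" "x = a * n + s"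
proof -
  have "x \<in> (\<lambda>(a, s). a * n + s) ` ({..<d} \<times> {..<n})"
    using assms unfolding bij_betw_imp_surj_on[OF bij_betw_block_index] by simp
  then obtain q where q: "x = (\<lambda>(a, s). a * n + s) q" "q \<in> {..<d} \<times> {..<n}"
    by (rule imageE)
  show thesis
    by (rule that[of "fst q" "snd q"]) (use q in \<open>simp_all add: case_prod_unfold mem_Times_iff\<close>)
qed

lemma fp_eval_hermitian:
  assumes p: "hermitian_fpoly d p" and XY: "herm_tuple n X" "herm_tuple n Y"
  shows "hermitian_mat (d * n) (fp_eval d d p n X Y)"
proof -
  have fp: "is_fpoly d d p" using p unfolding hermitian_fpoly_def by blast
  let ?P = "fp_eval d d p n X Y"
  have entry: "?P $$ (b * n + t, a * n + s) = cnj (?P $$ (a * n + s, b * n + t))"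
    if as: "a < d" "s < n" "b < d" "t < n" for a s b t
  proof -
    have "(\<Sum>w\<in>fp_support d d p. p w $$ (b, a) * word_eval n X Y w $$ (t, s)) =
        (\<Sum>w\<in>fp_support d d p. cnj (p w $$ (a, b) * word_eval n X Y w $$ (s, t)))"
    proof (rule sum.reindex_bij_witness[of _ rev rev])
      fix w assume w: "w \<in> fp_support d d p"
      show "rev w \<in> fp_support d d p"
        using hermitian_fpoly_rev_zero[OF p, of w] w unfolding fp_support_def by auto
      have c: "word_eval n X Y w \<in> carrier_mat n n" by (rule word_eval_carrier[OF XY])
      show "cnj (p (rev w) $$ (a, b) * word_eval n X Y (rev w) $$ (s, t)) = p w $$ (b, a) * word_eval n X Y w $$ (t, s)"
        unfolding hermitian_fpoly_index[OF p as(3,1)] word_eval_rev[OF XY] using c as by auto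
    next
      fix w assume w: "w \<in> fp_support d d p"
      show "rev w \<in> fp_support d d p"
        using hermitian_fpoly_rev_zero[OF p, of w] w unfolding fp_support_def by auto
    qed auto
    then show ?thesis
      unfolding fp_eval_index[OF fp word_eval_carrier[OF XY] as(3,4,1,2)]
        fp_eval_index[OF fp word_eval_carrier[OF XY] as] by simp
  qed
  have "ker_herm {..<d * n} (\<lambda>i j. ?P $$ (i, j))"
    unfolding ker_herm_def
  proof (intro ballI)
    fix i j assume "i \<in> {..<d * n}" "j \<in> {..<d * n}"
    then obtain a s b t where i: "a < d" "s < n" "i = a * n + s" and j: "b < d" "t < n" "j = b * n + t"
      by (metis block_index_exhaust lessThan_iff)
    show "?P $$ (j, i) = cnj (?P $$ (i, j))" unfolding i(3) j(3) by (rule entry[OF i(1,2) j(1,2)])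
  qed
  then show ?thesis unfolding hermitian_mat_iff using fp_eval_carrier by blast
qed

lemma kron_one_carrier: "V \<in> carrier_mat n m \<Longrightarrow> kron (1\<^sub>m d) V \<in> carrier_mat (d * n) (d * m)"
  unfolding kron_def by auto

lemma kron_one_index:
  assumes "V \<in> carrier_mat n m" "a < d" "s < n" "b < d" "j < m"
  shows "kron (1\<^sub>m d) V $$ (a * n + s, b * m + j) = (if a = b then V $$ (s, j) else 0)"
  unfolding kron_def using assms by (auto simp: block_index_less)

lemma sum_block_index:
  "(\<Sum>x<d * n. f x) = (\<Sum>a<d. \<Sum>s<n. f (a * n + s))" for f :: "nat \<Rightarrow> complex"
proof -
  have "(\<Sum>x<d * n. f x) = (\<Sum>(a, s)\<in>{..<d} \<times> {..<n}. f (a * n + s))"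
    using sum.reindex_bij_betw[OF bij_betw_block_index[of n d], of f] by (simp add: case_prod_unfold)
  then show ?thesis by (simp add: sum.cartesian_product)
qed

text \<open>The identity factor leaves the coefficient index alone, so the compression acts on the
  word evaluations only.\<close>

lemma compress_fp_eval_index:
  assumes p: "is_fpoly d d p" and V: "V \<in> carrier_mat n m" and XY: "herm_tuple n X" "herm_tuple n Y"
    and ij: "a < d" "i < m" "b < d" "j < m"
  shows "compress (kron (1\<^sub>m d) V) (fp_eval d d p n X Y) $$ (a * m + i, b * m + j) =
    (\<Sum>w\<in>fp_support d d p. p w $$ (a, b) * compress V (word_eval n X Y w) $$ (i, j))"
proof -
  let ?K = "kron (1\<^sub>m d) V" and ?P = "fp_eval d d p n X Y"
  let ?W = "\<lambda>w. word_eval n X Y w"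
  have left: "(\<Sum>x<d * n. cnj (?K $$ (x, a * m + i)) * g x) = (\<Sum>s<n. cnj (V $$ (s, i)) * g (a * n + s))"
    if "a < d" "i < m" for a i and g :: "nat \<Rightarrow> complex"
  proof -
    have "(\<Sum>x<d * n. cnj (?K $$ (x, a * m + i)) * g x) =
        (\<Sum>c<d. if c = a then (\<Sum>s<n. cnj (V $$ (s, i)) * g (a * n + s)) else 0)"
      unfolding sum_block_index using that by (intro sum.cong) (auto simp: kron_one_index[OF V])
    then show ?thesis using that by simp
  qed
  have right: "(\<Sum>x<d * n. g x * ?K $$ (x, b * m + j)) = (\<Sum>t<n. g (b * n + t) * V $$ (t, j))"
    if "b < d" "j < m" for b j and g :: "nat \<Rightarrow> complex"
  proof -
    have "(\<Sum>x<d * n. g x * ?K $$ (x, b * m + j)) =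
        (\<Sum>c<d. if c = b then (\<Sum>t<n. g (b * n + t) * V $$ (t, j)) else 0)"
      unfolding sum_block_index using that by (intro sum.cong) (auto simp: kron_one_index[OF V])
    then show ?thesis using that by simp
  qed
  have "compress ?K ?P $$ (a * m + i, b * m + j) =
      (\<Sum>x<d * n. cnj (?K $$ (x, a * m + i)) * (\<Sum>y<d * n. ?P $$ (x, y) * ?K $$ (y, b * m + j)))"
    unfolding compress_index[OF kron_one_carrier[OF V] fp_eval_carrier block_index_less[OF ij(1,2)] block_index_less[OF ij(3,4)]]
    by (simp add: sum_distrib_left mult.assoc)
  also have "\<dots> = (\<Sum>s<n. cnj (V $$ (s, i)) * (\<Sum>t<n. ?P $$ (a * n + s, b * n + t) * V $$ (t, j)))"
    unfolding left[OF ij(1,2)] right[OF ij(3,4)] ..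
  also have "\<dots> = (\<Sum>s<n. \<Sum>t<n. \<Sum>w\<in>fp_support d d p. p w $$ (a, b) * (cnj (V $$ (s, i)) * ?W w $$ (s, t) * V $$ (t, j)))"
    unfolding sum_distrib_left
  proof (intro sum.cong refl)
    fix s t assume st: "s \<in> {..<n}" "t \<in> {..<n}"
    have "?P $$ (a * n + s, b * n + t) = (\<Sum>w\<in>fp_support d d p. p w $$ (a, b) * ?W w $$ (s, t))"
      by (rule fp_eval_index[OF p word_eval_carrier[OF XY]]) (use ij st in auto)
    then show "cnj (V $$ (s, i)) * (?P $$ (a * n + s, b * n + t) * V $$ (t, j)) =
        (\<Sum>w\<in>fp_support d d p. p w $$ (a, b) * (cnj (V $$ (s, i)) * ?W w $$ (s, t) * V $$ (t, j)))"
      by (simp only: sum_distrib_left sum_distrib_right ac_simps)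
  qed
  also have "\<dots> = (\<Sum>w\<in>fp_support d d p. \<Sum>s<n. \<Sum>t<n. p w $$ (a, b) * (cnj (V $$ (s, i)) * ?W w $$ (s, t) * V $$ (t, j)))"
    by (subst sum.swap[of _ "fp_support d d p"], subst sum.swap[of _ "fp_support d d p"]) simp
  also have "\<dots> = (\<Sum>w\<in>fp_support d d p. p w $$ (a, b) * compress V (?W w) $$ (i, j))"
    unfolding compress_index[OF V word_eval_carrier[OF XY] ij(2,4)] by (simp add: sum_distrib_left)
  finally show ?thesis .
qed

lemma ker_psd_sum:
  assumes "\<And>i. i \<in> I \<Longrightarrow> ker_psd S (K i)"
  shows "ker_psd S (\<lambda>s t. \<Sum>i\<in>I. K i s t)"
  using assms
proof (induction I rule: infinite_finite_induct)
  case (insert i I)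
  have "ker_psd S (\<lambda>s t. (\<Sum>i\<in>I. K i s t) + of_real 1 * K i s t)"
    using insert by (intro ker_psd_add_scale) auto
  then show ?case using insert by (simp add: add.commute)
qed (simp_all add: ker_psd_zero)

text \<open>Any scalar weighting \<open>g\<close> of words splits along the decomposition of
  \<open>p\<close>. It will be used for the entries by which a compressed evaluation differs from
  the evaluation at the compressed tuple.\<close>

lemma fp_sum_square:
  fixes p :: "('i::finite) fpoly" and g :: "'i word \<Rightarrow> complex"
  assumes p: "is_fpoly d d p" and pL: "p = fp_add L (fp_mult d d (fp_adjoint \<Lambda>) \<Lambda>)"
    and L: "xy_pencil d d L" and \<Lambda>: "xy_pencil N d \<Lambda>" and ab: "a < d" "b < d"
  defines "B \<equiv> {w. \<not> quad_word w}"
  shows "(\<Sum>w\<in>fp_support d d p. p w $$ (a, b) * g w) = (\<Sum>w\<in>B. L w $$ (a, b) * g w) +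
    (\<Sum>u\<in>B. \<Sum>v\<in>B. (\<Sum>l<N. cnj (\<Lambda> u $$ (l, a)) * \<Lambda> v $$ (l, b)) * g (rev u @ v))"
proof -
  let ?M = "fp_mult d d (fp_adjoint \<Lambda>) \<Lambda>"
  define G where "G = (\<lambda>u v. \<Sum>l<N. cnj (\<Lambda> u $$ (l, a)) * \<Lambda> v $$ (l, b))"
  have B: "finite B" unfolding B_def by (rule finite_not_quad_word)
  have \<Lambda>c: "\<Lambda> w \<in> carrier_mat N d" for w using \<Lambda> unfolding xy_pencil_iff by blast
  have G0: "G u v = 0" if "u \<notin> B \<or> v \<notin> B" for u v
  proof -
    have "\<Lambda> u = 0\<^sub>m N d \<or> \<Lambda> v = 0\<^sub>m N d" using \<Lambda> that unfolding xy_pencil_iff B_def by blast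
    then show ?thesis unfolding G_def using ab by (intro sum.neutral) auto
  qed
  \<comment> \<open>A finite set containing the support and every word that the pencil or the square
    can produce, so that all sums can be taken over it.\<close>
  define W where "W = fp_support d d p \<union> B \<union> (\<lambda>(u, v). rev u @ v) ` (B \<times> B)"
  have uvW: "rev u @ v \<in> W" if "u \<in> B" "v \<in> B" for u v using that unfolding W_def by force
  have W: "finite W" unfolding W_def using B p unfolding is_fpoly_def by blast
  have pw: "p w $$ (a, b) = L w $$ (a, b) + ?M w $$ (a, b)" for w
    unfolding pL fp_add_def using fp_square_carrier[of d \<Lambda> w] ab by auto
  have "(\<Sum>w\<in>fp_support d d p. p w $$ (a, b) * g w) = (\<Sum>w\<in>W. p w $$ (a, b) * g w)"
    by (rule sum.mono_neutral_left) (use W ab in \<open>auto simp: W_def fp_support_def\<close>)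
  also have "\<dots> = (\<Sum>w\<in>W. L w $$ (a, b) * g w) + (\<Sum>w\<in>W. ?M w $$ (a, b) * g w)"
    unfolding pw by (simp add: distrib_right sum.distrib)
  also have "(\<Sum>w\<in>W. L w $$ (a, b) * g w) = (\<Sum>w\<in>B. L w $$ (a, b) * g w)"
  proof (rule sum.mono_neutral_right)
    show "\<forall>w\<in>W - B. L w $$ (a, b) * g w = 0"
      using L ab unfolding xy_pencil_iff B_def by simp
  qed (use W in \<open>auto simp: W_def\<close>)
  also have "(\<Sum>w\<in>W. ?M w $$ (a, b) * g w) = (\<Sum>w\<in>W. \<Sum>k\<le>length w. G (rev (take k w)) (drop k w) * g w)"
    unfolding fp_square_index[OF \<Lambda>c ab] G_def sum_distrib_right ..
  also have "\<dots> = (\<Sum>(w, k)\<in>Sigma W (\<lambda>w. {..length w}). G (rev (take k w)) (drop k w) * g w)"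
    by (rule sum.Sigma) (use W in auto)
  also have "\<dots> = (\<Sum>(w, k)\<in>{(w, k). w \<in> W \<and> k \<le> length w \<and> rev (take k w) \<in> B \<and> drop k w \<in> B}. G (rev (take k w)) (drop k w) * g w)"
  proof (rule sum.mono_neutral_right)
    show "\<forall>i\<in>Sigma W (\<lambda>w. {..length w}) - {(w, k). w \<in> W \<and> k \<le> length w \<and> rev (take k w) \<in> B \<and> drop k w \<in> B}.
        (case i of (w, k) \<Rightarrow> G (rev (take k w)) (drop k w) * g w) = 0"
    proof
      fix i assume i: "i \<in> Sigma W (\<lambda>w. {..length w}) - {(w, k). w \<in> W \<and> k \<le> length w \<and> rev (take k w) \<in> B \<and> drop k w \<in> B}"
      obtain w k where word_ker: "i = (w, k)" by (cases i)
      have "rev (take k w) \<notin> B \<or> drop k w \<notin> B" using i unfolding word_ker by auto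
      from G0[OF this] show "(case i of (w, k) \<Rightarrow> G (rev (take k w)) (drop k w) * g w) = 0"
        unfolding word_ker by simp
    qed
  qed (use W in \<open>auto intro!: finite_SigmaI\<close>)
  also have "\<dots> = (\<Sum>(u, v)\<in>B \<times> B. G u v * g (rev u @ v))"
    by (rule sum.reindex_bij_witness[of _ "\<lambda>(u, v). (rev u @ v, length u)" "\<lambda>(w, k). (rev (take k w), drop k w)"])
      (auto simp: uvW)
  also have "\<dots> = (\<Sum>u\<in>B. \<Sum>v\<in>B. G u v * g (rev u @ v))"
    by (rule sum.cartesian_product[symmetric])
  finally show ?thesis unfolding G_def .
qed

text \<open>For an isometry \<open>V\<close>, the matrix 1 - V * mat_adjoint V is an orthogonal
  projection, so the products of the projected columns are the defect of the compression.\<close>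

lemma isometry_defect:
  assumes V: "isometry_mat m n V" and A: "A \<in> carrier_mat n k" and B: "B \<in> carrier_mat n k"
  shows "mat_adjoint (A - V * (mat_adjoint V * A)) * (B - V * (mat_adjoint V * B)) =
    mat_adjoint A * B - mat_adjoint (mat_adjoint V * A) * (mat_adjoint V * B)"
proof -
  define a where "a = mat_adjoint V * A"
  define b where "b = mat_adjoint V * B"
  have Vc: "V \<in> carrier_mat n m" and iso: "mat_adjoint V * V = 1\<^sub>m m" using V unfolding isometry_mat_def by auto
  have Va: "mat_adjoint V \<in> carrier_mat m n" using Vc by simp
  have a: "a \<in> carrier_mat m k" and b: "b \<in> carrier_mat m k" unfolding a_def b_def using mult_carrier_mat[OF Va] A B by auto
  have aa: "mat_adjoint a \<in> carrier_mat k m" and Aa: "mat_adjoint A \<in> carrier_mat k n" using a A by auto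
  have Vb: "V * b \<in> carrier_mat n k" and VVa: "V * a \<in> carrier_mat n k" using mult_carrier_mat[OF Vc] a b by auto
  have aV: "mat_adjoint a * mat_adjoint V \<in> carrier_mat k n" using mult_carrier_mat[OF aa Va] .
  have 1: "mat_adjoint (V * a) = mat_adjoint a * mat_adjoint V" by (rule mat_adjoint_mult[OF Vc a])
  have 2: "mat_adjoint A * (V * b) = mat_adjoint a * b"
    unfolding a_def mat_adjoint_mult[OF Va A] mat_adjoint_adjoint by (rule assoc_mult_mat[OF Aa Vc b, symmetric])
  have 3: "mat_adjoint a * mat_adjoint V * B = mat_adjoint a * b"
    unfolding b_def by (rule assoc_mult_mat[OF aa Va B])
  have 4: "mat_adjoint a * mat_adjoint V * (V * b) = mat_adjoint a * b"
  proof -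
    have "mat_adjoint a * mat_adjoint V * (V * b) = mat_adjoint a * (mat_adjoint V * (V * b))"
      by (rule assoc_mult_mat[OF aa Va Vb])
    also have "mat_adjoint V * (V * b) = mat_adjoint V * V * b" by (rule assoc_mult_mat[OF Va Vc b, symmetric])
    finally show ?thesis unfolding iso left_mult_one_mat[OF b] .
  qed
  have AV: "mat_adjoint A - mat_adjoint a * mat_adjoint V \<in> carrier_mat k n" by (rule minus_carrier_mat[OF aV])
  have ab: "mat_adjoint a * b \<in> carrier_mat k k" using mult_carrier_mat[OF aa b] .
  have "mat_adjoint (A - V * a) * (B - V * b) =
      (mat_adjoint A - mat_adjoint a * mat_adjoint V) * (B - V * b)"
    unfolding mat_adjoint_minus[OF A VVa] 1 ..
  also have "\<dots> = (mat_adjoint A - mat_adjoint a * mat_adjoint V) * B - (mat_adjoint A - mat_adjoint a * mat_adjoint V) * (V * b)"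
    by (rule mult_minus_distrib_mat[OF AV B Vb])
  also have "\<dots> = (mat_adjoint A * B - mat_adjoint a * b) - (mat_adjoint a * b - mat_adjoint a * b)"
    unfolding minus_mult_distrib_mat[OF Aa aV B] minus_mult_distrib_mat[OF Aa aV Vb] 2 3 4 ..
  also have "\<dots> = mat_adjoint A * B - mat_adjoint a * b"
  proof -
    have "P - R - (R - R) = P - R" if "R \<in> carrier_mat k k" for P R :: "complex mat"
      by (rule eq_matI) (use that in auto)
    then show ?thesis using ab by blast
  qed
  finally show ?thesis unfolding a_def b_def .
qed

text \<open>The defining condition of a pair covers x_i y_j; the words y_k x_j follow by taking
  adjoints. Longer or repeated words are not preserved in general.\<close>

lemma xy_pair_word:
  assumes pair: "xy_pair m n X Y V" and w: "\<not> quad_word w"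
  shows "compress V (word_eval n X Y w) = word_eval m (\<lambda>j. compress V (X j)) (\<lambda>k. compress V (Y k)) w"
proof -
  have XY: "herm_tuple n X" "herm_tuple n Y" and iso: "isometry_mat m n V"
    and xy: "\<And>i j. compress V (X i * Y j) = compress V (X i) * compress V (Y j)"
    using pair unfolding xy_pair_def by auto
  have V: "V \<in> carrier_mat n m" "mat_adjoint V * V = 1\<^sub>m m" using iso unfolding isometry_mat_def by auto
  have Va: "mat_adjoint V \<in> carrier_mat m n" using V by simp
  have Xc: "X j \<in> carrier_mat n n" "mat_adjoint (X j) = X j" and Yc: "Y j \<in> carrier_mat n n" "mat_adjoint (Y j) = Y j" for j
    using XY unfolding herm_tuple_def hermitian_mat_def by auto
  have cX: "compress V (X j) \<in> carrier_mat m m" "mat_adjoint (compress V (X j)) = compress V (X j)"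
    and cY: "compress V (Y j) \<in> carrier_mat m m" "mat_adjoint (compress V (Y j)) = compress V (Y j)" for j
    using compress_tuple[OF V(1) XY(1)] compress_tuple[OF V(1) XY(2)] unfolding herm_tuple_def hermitian_mat_def by auto
  have yx: "compress V (Y k * X j) = compress V (Y k) * compress V (X j)" for k j
  proof -
    have XYc: "X j * Y k \<in> carrier_mat n n" using mult_carrier_mat[OF Xc(1) Yc(1)] .
    have "compress V (Y k * X j) = mat_adjoint (compress V (X j * Y k))"
    proof -
      have "mat_adjoint (mat_adjoint V * (X j * Y k) * V) = mat_adjoint V * (mat_adjoint (X j * Y k) * V)"
        using mat_adjoint_mult[OF mult_carrier_mat[OF Va XYc] V(1)] mat_adjoint_mult[OF Va XYc] by simp
      also have "mat_adjoint (X j * Y k) = Y k * X j" using mat_adjoint_mult[OF Xc(1) Yc(1)] Xc Yc by simp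
      also have "mat_adjoint V * (Y k * X j * V) = mat_adjoint V * (Y k * X j) * V"
        by (rule assoc_mult_mat[OF Va mult_carrier_mat[OF Yc(1) Xc(1)] V(1), symmetric])
      finally show ?thesis unfolding compress_def by simp
    qed
    also have "\<dots> = compress V (Y k) * compress V (X j)"
      unfolding xy mat_adjoint_mult[OF cX(1) cY(1)] cX(2) cY(2) ..
    finally show ?thesis .
  qed
  from w show ?thesis
  proof (cases rule: not_quad_word_cases)
    case 1
    then show ?thesis unfolding compress_def using V Va right_mult_one_mat[OF Va] by simp
  qed (use xy yx right_mult_one_mat[OF Xc(1)] right_mult_one_mat[OF Yc(1)]
      right_mult_one_mat[OF cX(1)] right_mult_one_mat[OF cY(1)] in simp_all)
qed

text \<open>Compression commutes with the pencil, so only the square contributes to the difference;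
  there the defect of rev u @ v is a product of projected word columns, which makes the difference a
  Gram matrix.\<close>

lemma square_imp_xy_convex:
  fixes p :: "('i::finite) fpoly"
  assumes herm: "hermitian_fpoly d p" and pL: "p = fp_add L (fp_mult d d (fp_adjoint \<Lambda>) \<Lambda>)"
    and L: "xy_pencil d d L" and \<Lambda>: "xy_pencil N d \<Lambda>"
  shows "xy_convex d p"
  unfolding xy_convex_def
proof (intro allI impI)
  fix m n V and X Y :: "'i \<Rightarrow> complex mat"
  assume pair: "xy_pair m n X Y V"
  have p: "is_fpoly d d p" using herm unfolding hermitian_fpoly_def by blast
  have XY: "herm_tuple n X" "herm_tuple n Y" and iso: "isometry_mat m n V"
    using pair unfolding xy_pair_def by auto
  have V: "V \<in> carrier_mat n m" using iso unfolding isometry_mat_def by auto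
  define X' where "X' = (\<lambda>j. compress V (X j))"
  define Y' where "Y' = (\<lambda>k. compress V (Y k))"
  have XY': "herm_tuple m X'" "herm_tuple m Y'" unfolding X'_def Y'_def by (intro compress_tuple[OF V] XY)+
  define B where "B = {w :: 'i word. \<not> quad_word w}"
  let ?W = "\<lambda>w. word_eval n X Y w" and ?W' = "\<lambda>w. word_eval m X' Y' w"
  have W: "?W w \<in> carrier_mat n n" and W': "?W' w \<in> carrier_mat m m" for w
    using word_eval_carrier[OF XY] word_eval_carrier[OF XY'] by auto
  have WB: "compress V (?W w) = ?W' w" if "w \<in> B" for w
    using xy_pair_word[OF pair] that unfolding B_def X'_def Y'_def by blast
  \<comment> \<open>The component of the columns of v(X, Y) V orthogonal to the range of
    \<open>V\<close>.\<close>
  define Q where "Q = (\<lambda>v. ?W v * V - V * (mat_adjoint V * (?W v * V)))"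
  have WV: "?W v * V \<in> carrier_mat n m" for v using mult_carrier_mat[OF W V] .
  have Va: "mat_adjoint V \<in> carrier_mat m n" using V by simp
  have Qc: "Q v \<in> carrier_mat n m" for v
    unfolding Q_def by (intro minus_carrier_mat mult_carrier_mat[OF V] mult_carrier_mat[OF Va] WV)
  have diff: "compress V (?W (rev u @ v)) $$ (i, j) - ?W' (rev u @ v) $$ (i, j) = (\<Sum>r<n. cnj (Q u $$ (r, i)) * Q v $$ (r, j))"
    if uv: "u \<in> B" "v \<in> B" and ij: "i < m" "j < m" for u v i j
  proof -
    have Wu: "mat_adjoint (?W u) \<in> carrier_mat n n" using W by simp
    have "compress V (?W (rev u @ v)) = mat_adjoint V * (mat_adjoint (?W u) * ?W v) * V"
      unfolding compress_def word_eval_append[OF XY] word_eval_rev[OF XY] ..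
    also have "\<dots> = mat_adjoint V * mat_adjoint (?W u) * ?W v * V"
      unfolding assoc_mult_mat[OF Va Wu W] ..
    also have "\<dots> = mat_adjoint V * mat_adjoint (?W u) * (?W v * V)"
      by (rule assoc_mult_mat[OF mult_carrier_mat[OF Va Wu] W V])
    also have "mat_adjoint V * mat_adjoint (?W u) = mat_adjoint (?W u * V)"
      by (rule mat_adjoint_mult[OF W V, symmetric])
    finally have c1: "compress V (?W (rev u @ v)) = mat_adjoint (?W u * V) * (?W v * V)" .
    have w': "?W' v = mat_adjoint V * (?W v * V)" if "v \<in> B" for v
      unfolding WB[OF that, symmetric] compress_def by (rule assoc_mult_mat[OF Va W V])
    have c2: "?W' (rev u @ v) = mat_adjoint (mat_adjoint V * (?W u * V)) * (mat_adjoint V * (?W v * V))"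
      unfolding word_eval_append[OF XY'] word_eval_rev[OF XY'] w'[OF uv(1)] w'[OF uv(2)] ..
    have "mat_adjoint (Q u) * Q v = compress V (?W (rev u @ v)) - ?W' (rev u @ v)"
      unfolding c1 c2 Q_def by (rule isometry_defect[OF iso WV WV])
    then have "(compress V (?W (rev u @ v)) - ?W' (rev u @ v)) $$ (i, j) = (mat_adjoint (Q u) * Q v) $$ (i, j)" by simp
    also have "\<dots> = (\<Sum>r<n. cnj (Q u $$ (r, i)) * Q v $$ (r, j))"
      using Qc[of u] Qc[of v] ij by (simp add: scalar_prod_def atLeast0LessThan)
    finally show ?thesis using W'[of "rev u @ v"] ij by auto
  qed
  \<comment> \<open>Gram vectors of the difference: \<Lambda> applied to the orthogonal components
    \<open>Q\<close>, with one coordinate for each row \<open>l\<close> of \<Lambda> and each row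
    \<open>r\<close> of \<open>Q\<close>.\<close>
  define \<phi> where "\<phi> = (\<lambda>l r. \<lambda>(a, i). \<Sum>v\<in>B. \<Lambda> v $$ (l, a) * Q v $$ (r, i))"
  let ?P' = "fp_eval d d p m X' Y'" and ?C = "compress (kron (1\<^sub>m d) V) (fp_eval d d p n X Y)"
  have Cc: "?C \<in> carrier_mat (d * m) (d * m)" by (rule compress_carrier[OF kron_one_carrier[OF V] fp_eval_carrier])
  have Pc: "?P' \<in> carrier_mat (d * m) (d * m)" by (rule fp_eval_carrier)
  have entry: "(?C - ?P') $$ (a * m + i, b * m + j) = (\<Sum>l<N. \<Sum>r<n. cnj (\<phi> l r (a, i)) * \<phi> l r (b, j))"
    if ij: "a < d" "i < m" "b < d" "j < m" for a i b j
  proof -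
    define g where "g = (\<lambda>w. compress V (?W w) $$ (i, j) - ?W' w $$ (i, j))"
    have "(?C - ?P') $$ (a * m + i, b * m + j) = ?C $$ (a * m + i, b * m + j) - ?P' $$ (a * m + i, b * m + j)"
      using Pc block_index_less[OF ij(1,2)] block_index_less[OF ij(3,4)] by auto
    also have "\<dots> = (\<Sum>w\<in>fp_support d d p. p w $$ (a, b) * g w)"
      unfolding compress_fp_eval_index[OF p V XY ij] fp_eval_index[OF p W' ij] g_def
      by (simp add: sum_subtractf right_diff_distrib)
    also have "\<dots> = (\<Sum>w\<in>B. L w $$ (a, b) * g w) +
        (\<Sum>u\<in>B. \<Sum>v\<in>B. (\<Sum>l<N. cnj (\<Lambda> u $$ (l, a)) * \<Lambda> v $$ (l, b)) * g (rev u @ v))"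
      unfolding B_def by (rule fp_sum_square[OF p pL L \<Lambda> ij(1,3)])
    also have "(\<Sum>w\<in>B. L w $$ (a, b) * g w) = 0"
      by (intro sum.neutral) (simp add: g_def WB)
    also have "(\<Sum>u\<in>B. \<Sum>v\<in>B. (\<Sum>l<N. cnj (\<Lambda> u $$ (l, a)) * \<Lambda> v $$ (l, b)) * g (rev u @ v)) =
        (\<Sum>u\<in>B. \<Sum>v\<in>B. \<Sum>l<N. \<Sum>r<n. cnj (\<Lambda> u $$ (l, a) * Q u $$ (r, i)) * (\<Lambda> v $$ (l, b) * Q v $$ (r, j)))"
    proof (intro sum.cong refl)
      fix u v assume "u \<in> B" "v \<in> B"
      then have g: "g (rev u @ v) = (\<Sum>r<n. cnj (Q u $$ (r, i)) * Q v $$ (r, j))"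
        unfolding g_def using diff ij by blast
      show "(\<Sum>l<N. cnj (\<Lambda> u $$ (l, a)) * \<Lambda> v $$ (l, b)) * g (rev u @ v) =
          (\<Sum>l<N. \<Sum>r<n. cnj (\<Lambda> u $$ (l, a) * Q u $$ (r, i)) * (\<Lambda> v $$ (l, b) * Q v $$ (r, j)))"
        unfolding g sum_product by (intro sum.cong refl) (simp add: ac_simps)
    qed
    also have "\<dots> = (\<Sum>l<N. \<Sum>r<n. \<Sum>u\<in>B. \<Sum>v\<in>B. cnj (\<Lambda> u $$ (l, a) * Q u $$ (r, i)) * (\<Lambda> v $$ (l, b) * Q v $$ (r, j)))"
      by (simp only: sum.swap[of _ "{..<N}" B] sum.swap[of _ "{..<n}" B])
    also have "\<dots> = (\<Sum>l<N. \<Sum>r<n. cnj (\<phi> l r (a, i)) * \<phi> l r (b, j))"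
      unfolding \<phi>_def by (simp add: sum_product)
    finally show ?thesis by simp
  qed
  have "ker_psd ({..<d} \<times> {..<m}) (\<lambda>s t. \<Sum>l<N. \<Sum>r<n. cnj (\<phi> l r s) * \<phi> l r t)"
    using ker_psd_rank_one[of _ "\<lambda>s. cnj (\<phi> l r s)" for l r] by (intro ker_psd_sum) simp
  then have "ker_psd ({..<d} \<times> {..<m}) (\<lambda>(a, i) (b, j). (?C - ?P') $$ (a * m + i, b * m + j))"
    by (rule ker_psd_cong[THEN iffD1, rotated]) (auto simp: entry)
  then have "ker_psd {..<d * m} (\<lambda>x y. (?C - ?P') $$ (x, y))" unfolding block_kernel .
  then have psd: "psd_mat (d * m) (?C - ?P')" unfolding psd_mat_iff using minus_carrier_mat[OF Pc] by blast
  have "psd_le (d * m) ?P' ?C"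
    unfolding psd_le_def using psd fp_eval_hermitian[OF herm XY']
      compress_hermitian[OF kron_one_carrier[OF V] fp_eval_hermitian[OF herm XY]] by blast
  then show "psd_le (d * m) (fp_eval d d p m (\<lambda>j. compress V (X j)) (\<lambda>k. compress V (Y k))) ?C"
    unfolding X'_def Y'_def .
qed

section \<open>Direct sums as xy-pairs\<close>

definition block_diag :: "complex mat \<Rightarrow> complex mat \<Rightarrow> complex mat" where
  "block_diag A B = four_block_mat A (0\<^sub>m (dim_row A) (dim_col B)) (0\<^sub>m (dim_row B) (dim_col A)) B"

lemma block_diag_carrier: "A \<in> carrier_mat n n \<Longrightarrow> B \<in> carrier_mat n n \<Longrightarrow> block_diag A B \<in> carrier_mat (n + n) (n + n)"
  unfolding block_diag_def by (rule four_block_carrier_mat)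

lemma block_diag_mult:
  assumes "A \<in> carrier_mat n n" "B \<in> carrier_mat n n" "A' \<in> carrier_mat n n" "B' \<in> carrier_mat n n"
  shows "block_diag A B * block_diag A' B' = block_diag (A * A') (B * B')"
proof -
  have "block_diag A B * block_diag A' B' =
      four_block_mat (A * A' + 0\<^sub>m n n * 0\<^sub>m n n) (A * 0\<^sub>m n n + 0\<^sub>m n n * B') (0\<^sub>m n n * A' + B * 0\<^sub>m n n) (0\<^sub>m n n * 0\<^sub>m n n + B * B')"
    unfolding block_diag_def using assms by (subst mult_four_block_mat[of _ n n _ n _ n]) auto
  also have "\<dots> = block_diag (A * A') (B * B')"
    unfolding block_diag_def using assms by simp
  finally show ?thesis .
qed

lemma block_diag_hermitian:
  assumes "hermitian_mat n A" "hermitian_mat n B"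
  shows "hermitian_mat (n + n) (block_diag A B)"
proof -
  have c: "A \<in> carrier_mat n n" "B \<in> carrier_mat n n" and a: "mat_adjoint A = A" "mat_adjoint B = B"
    using assms unfolding hermitian_mat_def by auto
  have "mat_adjoint (block_diag A B) = block_diag (mat_adjoint A) (mat_adjoint B)"
    unfolding block_diag_def by (rule eq_matI) (use c in auto)
  then show ?thesis unfolding hermitian_mat_def a using block_diag_carrier[OF c] by simp
qed

lemma block_diag_one: "block_diag (1\<^sub>m n) (1\<^sub>m n) = 1\<^sub>m (n + n)"
  unfolding block_diag_def by simp

text \<open>The column with blocks sqrt t and sqrt (1 - t) times the identity; compressing a direct
  sum by it gives the convex combination of the two summands.\<close>

definition comb_isometry :: "nat \<Rightarrow> real \<Rightarrow> complex mat" where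
  "comb_isometry n t = mat (n + n) n (\<lambda>(s, i). if s = i then of_real (sqrt t)
     else if s = n + i then of_real (sqrt (1 - t)) else 0)"

lemma comb_isometry_carrier: "comb_isometry n t \<in> carrier_mat (n + n) n"
  unfolding comb_isometry_def by simp

lemma compress_block_diag:
  assumes t: "0 < t" "t < 1" and A: "A \<in> carrier_mat n n" and B: "B \<in> carrier_mat n n"
  shows "compress (comb_isometry n t) (block_diag A B) = complex_of_real t \<cdot>\<^sub>m A + complex_of_real (1 - t) \<cdot>\<^sub>m B"
proof (rule eq_matI)
  let ?V = "comb_isometry n t" and ?D = "block_diag A B"
  note c = compress_carrier[OF comb_isometry_carrier block_diag_carrier[OF A B], of t]
  show "dim_row (compress ?V ?D) = dim_row (complex_of_real t \<cdot>\<^sub>m A + complex_of_real (1 - t) \<cdot>\<^sub>m B)"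
    "dim_col (compress ?V ?D) = dim_col (complex_of_real t \<cdot>\<^sub>m A + complex_of_real (1 - t) \<cdot>\<^sub>m B)"
    using c B by auto
  fix i j assume "i < dim_row (complex_of_real t \<cdot>\<^sub>m A + complex_of_real (1 - t) \<cdot>\<^sub>m B)"
    "j < dim_col (complex_of_real t \<cdot>\<^sub>m A + complex_of_real (1 - t) \<cdot>\<^sub>m B)"
  then have ij: "i < n" "j < n" using B by auto
  have col: "(\<Sum>u<n + n. g u * ?V $$ (u, j)) = g j * of_real (sqrt t) + g (n + j) * of_real (sqrt (1 - t))"
    if "j < n" for g :: "nat \<Rightarrow> complex" and j
  proof -
    have "(\<Sum>u<n + n. g u * ?V $$ (u, j)) = (\<Sum>u\<in>{j, n + j}. g u * ?V $$ (u, j))"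
      by (rule sum.mono_neutral_right) (use that in \<open>auto simp: comb_isometry_def\<close>)
    then show ?thesis using that by (simp add: comb_isometry_def)
  qed
  have cnjV: "cnj (?V $$ (u, i)) = ?V $$ (u, i)" if "u < n + n" for u
    using that ij by (simp add: comb_isometry_def)
  have sq: "of_real (sqrt t) * of_real (sqrt t) = complex_of_real t"
    "of_real (sqrt (1 - t)) * of_real (sqrt (1 - t)) = complex_of_real (1 - t)"
    using t by (simp_all flip: of_real_mult)
  have "compress ?V ?D $$ (i, j) = (\<Sum>u<n + n. (\<Sum>v<n + n. ?D $$ (u, v) * ?V $$ (v, j)) * ?V $$ (u, i))"
    unfolding compress_index[OF comb_isometry_carrier block_diag_carrier[OF A B] ij]
    by (intro sum.cong refl) (simp add: cnjV sum_distrib_left sum_distrib_right ac_simps)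
  also have "\<dots> = (?D $$ (i, j) * of_real (sqrt t) + ?D $$ (i, n + j) * of_real (sqrt (1 - t))) * of_real (sqrt t) +
      (?D $$ (n + i, j) * of_real (sqrt t) + ?D $$ (n + i, n + j) * of_real (sqrt (1 - t))) * of_real (sqrt (1 - t))"
    unfolding col[OF ij(1)] col[OF ij(2)] ..
  also have "\<dots> = A $$ (i, j) * (of_real (sqrt t) * of_real (sqrt t)) + B $$ (i, j) * (of_real (sqrt (1 - t)) * of_real (sqrt (1 - t)))"
    using A B ij by (simp add: block_diag_def mult.assoc)
  finally show "compress ?V ?D $$ (i, j) = (complex_of_real t \<cdot>\<^sub>m A + complex_of_real (1 - t) \<cdot>\<^sub>m B) $$ (i, j)"
    unfolding sq using A B ij by (simp add: mult.commute)
qed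

lemma comb_isometry:
  assumes "0 < t" "t < 1"
  shows "isometry_mat n (n + n) (comb_isometry n t)"
proof -
  have "mat_adjoint (comb_isometry n t) * comb_isometry n t = compress (comb_isometry n t) (block_diag (1\<^sub>m n) (1\<^sub>m n))"
    unfolding compress_def block_diag_one
    using right_mult_one_mat[of "mat_adjoint (comb_isometry n t)" n "n + n"] comb_isometry_carrier by simp
  also have "\<dots> = complex_of_real t \<cdot>\<^sub>m 1\<^sub>m n + complex_of_real (1 - t) \<cdot>\<^sub>m 1\<^sub>m n"
    by (rule compress_block_diag[OF assms]) auto
  also have "\<dots> = 1\<^sub>m n" by (rule eq_matI) auto
  finally show ?thesis unfolding isometry_mat_def using comb_isometry_carrier by blast
qed

text \<open>The hypothesis on products is precisely the pair condition for the direct sum compressed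
  by \<open>comb_isometry\<close>. It holds when one of the two tuples is held fixed, which is how
  separate convexity arises.\<close>

lemma xy_convex_combination:
  fixes p :: "('i::finite) fpoly"
  assumes conv: "xy_convex d p" and p: "is_fpoly d d p" and n: "0 < n" and t: "0 < t" "t < 1"
    and X1: "herm_tuple n X1" and X2: "herm_tuple n X2" and Y1: "herm_tuple n Y1" and Y2: "herm_tuple n Y2"
    and XY: "\<And>i j. complex_of_real t \<cdot>\<^sub>m (X1 i * Y1 j) + complex_of_real (1 - t) \<cdot>\<^sub>m (X2 i * Y2 j) =
      tuple_comb t X1 X2 i * tuple_comb t Y1 Y2 j"
  shows "psd_le (d * n) (fp_eval d d p n (tuple_comb t X1 X2) (tuple_comb t Y1 Y2))
    (complex_of_real t \<cdot>\<^sub>m fp_eval d d p n X1 Y1 + complex_of_real (1 - t) \<cdot>\<^sub>m fp_eval d d p n X2 Y2)"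
proof -
  let ?V = "comb_isometry n t"
  define X where "X = (\<lambda>j. block_diag (X1 j) (X2 j))"
  define Y where "Y = (\<lambda>j. block_diag (Y1 j) (Y2 j))"
  have c: "X1 j \<in> carrier_mat n n" "X2 j \<in> carrier_mat n n" "Y1 j \<in> carrier_mat n n" "Y2 j \<in> carrier_mat n n" for j
    using X1 X2 Y1 Y2 unfolding herm_tuple_def hermitian_mat_def by auto
  have HX: "herm_tuple (n + n) X" "herm_tuple (n + n) Y"
    unfolding X_def Y_def using X1 X2 Y1 Y2 block_diag_hermitian unfolding herm_tuple_def by blast+
  have cX: "(\<lambda>j. compress ?V (X j)) = tuple_comb t X1 X2" and cY: "(\<lambda>j. compress ?V (Y j)) = tuple_comb t Y1 Y2"
    unfolding X_def Y_def tuple_comb_def using compress_block_diag[OF t] c by auto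
  have "compress ?V (X i * Y j) = compress ?V (X i) * compress ?V (Y j)" for i j
  proof -
    have "compress ?V (X i * Y j) = complex_of_real t \<cdot>\<^sub>m (X1 i * Y1 j) + complex_of_real (1 - t) \<cdot>\<^sub>m (X2 i * Y2 j)"
      unfolding X_def Y_def block_diag_mult[OF c(1,2,3,4)]
      by (rule compress_block_diag[OF t mult_carrier_mat[OF c(1,3)] mult_carrier_mat[OF c(2,4)]])
    then show ?thesis unfolding XY fun_cong[OF cX, of i] fun_cong[OF cY, of j] .
  qed
  then have pair: "xy_pair n (n + n) X Y ?V"
    unfolding xy_pair_def using n HX comb_isometry[OF t] by auto
  have word: "word_eval (n + n) X Y w = block_diag (word_eval n X1 Y1 w) (word_eval n X2 Y2 w)" for w
  proof (induction w)
    case Nil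
    show ?case by (simp add: block_diag_one)
  next
    case (Cons l w)
    have "letter_eval X Y l = block_diag (letter_eval X1 Y1 l) (letter_eval X2 Y2 l)"
      unfolding X_def Y_def by (cases l) auto
    then show ?case
      using Cons block_diag_mult[OF letter_eval_carrier[OF X1 Y1] letter_eval_carrier[OF X2 Y2]
          word_eval_carrier[OF X1 Y1] word_eval_carrier[OF X2 Y2]] by simp
  qed
  have "compress (kron (1\<^sub>m d) ?V) (fp_eval d d p (n + n) X Y) =
      complex_of_real t \<cdot>\<^sub>m fp_eval d d p n X1 Y1 + complex_of_real (1 - t) \<cdot>\<^sub>m fp_eval d d p n X2 Y2" (is "?C = ?R")
  proof (rule eq_matI)
    have Cc: "?C \<in> carrier_mat (d * n) (d * n)"
      by (rule compress_carrier[OF kron_one_carrier[OF comb_isometry_carrier] fp_eval_carrier])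
    have Pc: "fp_eval d d p n X' Y' \<in> carrier_mat (d * n) (d * n)" for X' Y' by (rule fp_eval_carrier)
    then have dims: "dim_row (fp_eval d d p n X' Y') = d * n" "dim_col (fp_eval d d p n X' Y') = d * n" for X' Y'
      using fp_eval_carrier[of d d p n X' Y'] by auto
    show "dim_row ?C = dim_row ?R" "dim_col ?C = dim_col ?R" using Cc by (auto simp: dims)
    fix x y assume "x < dim_row ?R" "y < dim_col ?R"
    then have xy: "x < d * n" "y < d * n" by (auto simp: dims)
    then obtain a i b j where ai: "a < d" "i < n" "x = a * n + i" and bj: "b < d" "j < n" "y = b * n + j"
      by (metis block_index_exhaust)
    have "?C $$ (x, y) = (\<Sum>w\<in>fp_support d d p. p w $$ (a, b) *
        (complex_of_real t \<cdot>\<^sub>m word_eval n X1 Y1 w + complex_of_real (1 - t) \<cdot>\<^sub>m word_eval n X2 Y2 w) $$ (i, j))"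
      unfolding ai(3) bj(3) compress_fp_eval_index[OF p comb_isometry_carrier HX ai(1,2) bj(1,2)] word
        compress_block_diag[OF t word_eval_carrier[OF X1 Y1] word_eval_carrier[OF X2 Y2]] ..
    also have "\<dots> = (\<Sum>w\<in>fp_support d d p. p w $$ (a, b) *
        (complex_of_real t * word_eval n X1 Y1 w $$ (i, j) + complex_of_real (1 - t) * word_eval n X2 Y2 w $$ (i, j)))"
    proof (intro sum.cong refl)
      fix w
      have "dim_row (word_eval n X1 Y1 w) = n" "dim_col (word_eval n X1 Y1 w) = n"
        "dim_row (word_eval n X2 Y2 w) = n" "dim_col (word_eval n X2 Y2 w) = n"
        using word_eval_carrier[OF X1 Y1, of w] word_eval_carrier[OF X2 Y2, of w] by auto
      then show "p w $$ (a, b) * (complex_of_real t \<cdot>\<^sub>m word_eval n X1 Y1 w + complex_of_real (1 - t) \<cdot>\<^sub>m word_eval n X2 Y2 w) $$ (i, j) =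
          p w $$ (a, b) * (complex_of_real t * word_eval n X1 Y1 w $$ (i, j) + complex_of_real (1 - t) * word_eval n X2 Y2 w $$ (i, j))"
        using ai bj by simp
    qed
    also have "\<dots> = complex_of_real t * fp_eval d d p n X1 Y1 $$ (x, y) + complex_of_real (1 - t) * fp_eval d d p n X2 Y2 $$ (x, y)"
      unfolding ai(3) bj(3) fp_eval_index[OF p word_eval_carrier[OF X1 Y1] ai(1,2) bj(1,2)]
        fp_eval_index[OF p word_eval_carrier[OF X2 Y2] ai(1,2) bj(1,2)]
      by (simp only: distrib_left sum.distrib sum_distrib_left mult.left_commute)
    also have "\<dots> = ?R $$ (x, y)" using xy by (simp add: dims)
    finally show "?C $$ (x, y) = ?R $$ (x, y)" .
  qed
  moreover have "psd_le (d * n) (fp_eval d d p n (\<lambda>j. compress ?V (X j)) (\<lambda>k. compress ?V (Y k)))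
      (compress (kron (1\<^sub>m d) ?V) (fp_eval d d p (n + n) X Y))"
    using conv pair unfolding xy_convex_def by blast
  ultimately show ?thesis unfolding cX cY by simp
qed

lemma xy_convex_imp_separately_convex:
  fixes p :: "('i::finite) fpoly"
  assumes conv: "xy_convex d p" and p: "is_fpoly d d p"
  shows "separately_convex d p"
proof -
  \<comment> \<open>A constant tuple is its own convex combination, so a fixed variable fits the
    general statement.\<close>
  have same: "tuple_comb t Z Z = Z" for t and Z :: "'i \<Rightarrow> complex mat"
    unfolding tuple_comb_def
    by (rule ext, rule eq_matI) (auto simp: algebra_simps)
  have c: "Z j \<in> carrier_mat n n" if "herm_tuple n Z" for n and Z :: "'i \<Rightarrow> complex mat" and j
    using that unfolding herm_tuple_def hermitian_mat_def by blast
  have "convex_in_x d p"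
    unfolding convex_in_x_def
  proof (intro allI impI)
    fix n and t :: real and X1 X2 Y :: "'i \<Rightarrow> complex mat"
    assume *: "0 < n \<and> herm_tuple n X1 \<and> herm_tuple n X2 \<and> herm_tuple n Y \<and> 0 < t \<and> t < 1"
    then have h: "0 < n" "0 < t" "t < 1" "herm_tuple n X1" "herm_tuple n X2" "herm_tuple n Y" by auto
    have "complex_of_real t \<cdot>\<^sub>m (X1 i * Y j) + complex_of_real (1 - t) \<cdot>\<^sub>m (X2 i * Y j) =
        tuple_comb t X1 X2 i * tuple_comb t Y Y j" for i j
      unfolding same unfolding tuple_comb_def
      using add_mult_distrib_mat[OF smult_carrier_mat[OF c[OF h(4)]] smult_carrier_mat[OF c[OF h(5)]] c[OF h(6)]]
        mult_smult_assoc_mat[OF c[OF h(4)] c[OF h(6)]] mult_smult_assoc_mat[OF c[OF h(5)] c[OF h(6)]] by simp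
    from xy_convex_combination[OF conv p h(1-5) h(6,6) this]
    show "psd_le (d * n) (fp_eval d d p n (tuple_comb t X1 X2) Y)
        (complex_of_real t \<cdot>\<^sub>m fp_eval d d p n X1 Y + complex_of_real (1 - t) \<cdot>\<^sub>m fp_eval d d p n X2 Y)"
      unfolding same .
  qed
  moreover have "convex_in_y d p"
    unfolding convex_in_y_def
  proof (intro allI impI)
    fix n and t :: real and X Y1 Y2 :: "'i \<Rightarrow> complex mat"
    assume *: "0 < n \<and> herm_tuple n X \<and> herm_tuple n Y1 \<and> herm_tuple n Y2 \<and> 0 < t \<and> t < 1"
    then have h: "0 < n" "0 < t" "t < 1" "herm_tuple n X" "herm_tuple n Y1" "herm_tuple n Y2" by auto
    have "complex_of_real t \<cdot>\<^sub>m (X i * Y1 j) + complex_of_real (1 - t) \<cdot>\<^sub>m (X i * Y2 j) =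
        tuple_comb t X X i * tuple_comb t Y1 Y2 j" for i j
      unfolding same unfolding tuple_comb_def
      using mult_add_distrib_mat[OF c[OF h(4)] smult_carrier_mat[OF c[OF h(5)]] smult_carrier_mat[OF c[OF h(6)]]]
        mult_smult_distrib[OF c[OF h(4)] c[OF h(5)]] mult_smult_distrib[OF c[OF h(4)] c[OF h(6)]] by simp
    from xy_convex_combination[OF conv p h(1-3) h(4,4) h(5,6) this]
    show "psd_le (d * n) (fp_eval d d p n X (tuple_comb t Y1 Y2))
        (complex_of_real t \<cdot>\<^sub>m fp_eval d d p n X Y1 + complex_of_real (1 - t) \<cdot>\<^sub>m fp_eval d d p n X Y2)"
      unfolding same .
  qed
  ultimately show ?thesis unfolding separately_convex_def by blast
qed

theorem proposition1p3:
  fixes p :: "('i::finite) fpoly" and d :: nat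
  assumes "hermitian_fpoly d p"
  shows "(xy_convex d p \<longleftrightarrow> separately_convex d p) \<and>
    (separately_convex d p \<longleftrightarrow>
      (\<exists>L N \<Lambda>. xy_pencil d d L \<and> hermitian_fpoly d L \<and> 0 < N \<and> xy_pencil N d \<Lambda> \<and>
         p = fp_add L (fp_mult d d (fp_adjoint \<Lambda>) \<Lambda>)))"
proof -
  have "is_fpoly d d p" using assms unfolding hermitian_fpoly_def by blast
  \<comment> \<open>The implications close a cycle: separate convexity gives the square, the square
    gives xy-convexity, and this gives separate convexity.\<close>
  then show ?thesis
    using separately_convex_imp_square[OF assms] square_imp_xy_convex[OF assms]
      xy_convex_imp_separately_convex by metis
qed

end
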